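(* Let $G$ be a second countable almost unimodular group and let $(\pi_1,\mathcal{H}_1)$ be a factorial square integrable representation of $\ker\Delta_G$. Then the induced representation $\operatorname{Ind}_{\ker\Delta_G}^G(\pi_1,\mathcal{H}_1)$ of $G$ is factorial and square integrable.
   Context: Locally compact groups are Hausdorff; representations on Hilbert spaces are strongly continuous unitary representations. $\Delta_G\colon G\to\mathbb{R}_+=(0,\infty)$ is the modular function, $\mu_G(E\cdot s)=\Delta_G(s)\mu_G(E)$ for a left Haar measure $\mu_G$. A locally compact group $G$ is almost unimodular if $\ker\Delta_G$ is open in $G$. A representation $(\pi,\mathcal{H})$ of a locally compact group $G$ is factorial if $\pi(G)''$ is a factor. A factorial representation is square integrable if there exist $\xi,\eta\in\mathcal{H}$ such that the coefficient $c_{\xi,\eta}(s)=\langle\pi(s)\xi,\eta\rangle$ is a non-zero element of $L^2(G)$ (with respect to a left Haar measure). Induced representation: for $G$ almost unimodular, fix a normalized section $\sigma\colon\Delta_G(G)\to G$ for $\Delta_G$ ($\sigma(1)=e$, $\Delta_G\circ\sigma=\mathrm{id}$). Then $\operatorname{Ind}_{\ker\Delta_G}^G(\pi_1,\mathcal{H}_1)$ is realized on $\ell^2(\Delta_G(G))\otimes\mathcal{H}_1$ by $[(\operatorname{Ind}\pi_1)(s)f](\delta)=\pi_1\big(\sigma(\delta)^{-1}s\,\sigma(\Delta_G(s)^{-1}\delta)\big)f(\Delta_G(s)^{-1}\delta)$ for $s\in G$, $\delta\in\Delta_G(G)$; up to unitary equivalence this does not depend on $\sigma$. *)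

theory Defs
  imports "HOL-Analysis.Analysis" "HOL-Algebra.Coset" "HOL-Library.Function_Algebras"
begin

subsection \<open>Locally compact groups, Haar measure and the modular function\<close>

text \<open>A group is a HOL-Algebra structure \<open>G\<close> together with a topology \<open>T\<close> on its carrier, so
  that a subgroup \<open>K\<close> is the group \<open>G\<lparr>carrier := K\<rparr>\<close> with topology \<open>subtopology T K\<close>.\<close>

locale topological_group = group G for G (structure) +
  fixes T :: "'g topology"
  assumes topspace_eq: "topspace T = carrier G"
    and continuous_mult: "continuous_map (prod_topology T T) T (\<lambda>(x, y). x \<otimes> y)"
    and continuous_inv: "continuous_map T T (\<lambda>x. inv x)"

locale locally_compact_group = topological_group +
  assumes locally_compact: "locally_compact_space T"
    and Hausdorff: "Hausdorff_space T"

definition borel_of :: "'g topology \<Rightarrow> 'g measure" where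
  "borel_of T = sigma (topspace T) {U. openin T U}"

text \<open>Left Haar measures are nonzero left invariant Radon measures: finite on compact sets, outer
  regular on Borel sets, inner regular on open sets.\<close>

definition left_haar_measure ::
  "('g, 'm) monoid_scheme \<Rightarrow> 'g topology \<Rightarrow> 'g measure \<Rightarrow> bool" where
  "left_haar_measure G T \<mu> \<longleftrightarrow>
     sets \<mu> = sets (borel_of T) \<and>
     emeasure \<mu> (space \<mu>) \<noteq> 0 \<and>
     (\<forall>K. compactin T K \<longrightarrow> emeasure \<mu> K < \<infinity>) \<and>
     (\<forall>E\<in>sets \<mu>. emeasure \<mu> E = (INF U\<in>{U. openin T U \<and> E \<subseteq> U}. emeasure \<mu> U)) \<and>
     (\<forall>U. openin T U \<longrightarrow>
        emeasure \<mu> U = (SUP K\<in>{K. compactin T K \<and> K \<subseteq> U}. emeasure \<mu> K)) \<and>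
     (\<forall>s\<in>carrier G. \<forall>E\<in>sets \<mu>. emeasure \<mu> (s <#\<^bsub>G\<^esub> E) = emeasure \<mu> E)"

text \<open>The value does not depend on the choice of \<open>\<mu>\<close>, by uniqueness of Haar measure up to a
  positive factor.\<close>

definition modular_function :: "('g, 'm) monoid_scheme \<Rightarrow> 'g topology \<Rightarrow> 'g \<Rightarrow> real" where
  "modular_function G T s =
     (THE d. d > 0 \<and> (\<exists>\<mu>. left_haar_measure G T \<mu> \<and>
        (\<forall>E\<in>sets \<mu>. emeasure \<mu> (E #>\<^bsub>G\<^esub> s) = ennreal d * emeasure \<mu> E)))"

definition modular_kernel :: "('g, 'm) monoid_scheme \<Rightarrow> 'g topology \<Rightarrow> 'g set" where
  "modular_kernel G T = {s \<in> carrier G. modular_function G T s = 1}"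

definition modular_range :: "('g, 'm) monoid_scheme \<Rightarrow> 'g topology \<Rightarrow> real set" where
  "modular_range G T = modular_function G T ` carrier G"

definition almost_unimodular :: "('g, 'm) monoid_scheme \<Rightarrow> 'g topology \<Rightarrow> bool" where
  "almost_unimodular G T \<longleftrightarrow> locally_compact_group G T \<and> openin T (modular_kernel G T)"

definition normalized_section ::
  "('g, 'm) monoid_scheme \<Rightarrow> 'g topology \<Rightarrow> (real \<Rightarrow> 'g) \<Rightarrow> bool" where
  "normalized_section G T \<sigma> \<longleftrightarrow>
     \<sigma> 1 = \<one>\<^bsub>G\<^esub> \<and>
     (\<forall>\<delta>\<in>modular_range G T. \<sigma> \<delta> \<in> carrier G \<and> modular_function G T (\<sigma> \<delta>) = \<delta>)"

subsection \<open>Complex Hilbert spaces and von Neumann algebras\<close>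

text \<open>The vectors of a Hilbert space form a complex subspace of a type with a vector space
  structure; the inner product only matters on that subspace. This makes it possible to form
  \<open>\<ell>\<^sup>2\<close>-spaces over an index set that is a term. The inner product is linear in its first
  argument.\<close>

record 'v hilbert =
  vecs :: "'v set"
  scl :: "complex \<Rightarrow> 'v \<Rightarrow> 'v"
  ip :: "'v \<Rightarrow> 'v \<Rightarrow> complex"

definition hnorm :: "'v hilbert \<Rightarrow> 'v \<Rightarrow> real" where
  "hnorm H x = sqrt (Re (ip H x x))"

locale hilbert_space =
  fixes H :: "'v::ab_group_add hilbert"
  assumes vector_space: "vector_space (scl H)"
    and subspace: "module.subspace (scl H) (vecs H)"
    and ip_add: "\<lbrakk>x \<in> vecs H; y \<in> vecs H; z \<in> vecs H\<rbrakk> \<Longrightarrow> ip H (x + y) z = ip H x z + ip H y z"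
    and ip_scl: "\<lbrakk>x \<in> vecs H; y \<in> vecs H\<rbrakk> \<Longrightarrow> ip H (scl H c x) y = c * ip H x y"
    and ip_commute: "\<lbrakk>x \<in> vecs H; y \<in> vecs H\<rbrakk> \<Longrightarrow> ip H y x = cnj (ip H x y)"
    and ip_nonneg: "x \<in> vecs H \<Longrightarrow> Re (ip H x x) \<ge> 0"
    and ip_eq_0: "\<lbrakk>x \<in> vecs H; ip H x x = 0\<rbrakk> \<Longrightarrow> x = 0"
    and complete: "\<lbrakk>\<And>n. X n \<in> vecs H;
        \<And>e. e > 0 \<Longrightarrow> \<exists>N. \<forall>m\<ge>N. \<forall>n\<ge>N. hnorm H (X m - X n) < e\<rbrakk>
      \<Longrightarrow> \<exists>x\<in>vecs H. (\<lambda>n. hnorm H (X n - x)) \<longlonglongrightarrow> 0"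

text \<open>Operators on \<open>H\<close> are functions on the ambient type of which only the values on \<open>vecs H\<close>
  matter; the conditions below are insensitive to the values elsewhere.\<close>

definition linear_op :: "'v::ab_group_add hilbert \<Rightarrow> ('v \<Rightarrow> 'v) \<Rightarrow> bool" where
  "linear_op H A \<longleftrightarrow>
     (\<forall>x\<in>vecs H. A x \<in> vecs H) \<and>
     (\<forall>x\<in>vecs H. \<forall>y\<in>vecs H. A (x + y) = A x + A y) \<and>
     (\<forall>c. \<forall>x\<in>vecs H. A (scl H c x) = scl H c (A x))"

definition bounded_ops :: "'v::ab_group_add hilbert \<Rightarrow> ('v \<Rightarrow> 'v) set" where
  "bounded_ops H = {A. linear_op H A \<and> (\<exists>B. \<forall>x\<in>vecs H. hnorm H (A x) \<le> B * hnorm H x)}"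

definition unitary_op :: "'v::ab_group_add hilbert \<Rightarrow> ('v \<Rightarrow> 'v) \<Rightarrow> bool" where
  "unitary_op H U \<longleftrightarrow>
     linear_op H U \<and> bij_betw U (vecs H) (vecs H) \<and>
     (\<forall>x\<in>vecs H. \<forall>y\<in>vecs H. ip H (U x) (U y) = ip H x y)"

definition scalar_ops :: "'v::ab_group_add hilbert \<Rightarrow> ('v \<Rightarrow> 'v) set" where
  "scalar_ops H = {A. \<exists>c. \<forall>x\<in>vecs H. A x = scl H c x}"

definition commutant :: "'v::ab_group_add hilbert \<Rightarrow> ('v \<Rightarrow> 'v) set \<Rightarrow> ('v \<Rightarrow> 'v) set" where
  "commutant H S = {A \<in> bounded_ops H. \<forall>B\<in>S. \<forall>x\<in>vecs H. A (B x) = B (A x)}"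

definition von_neumann_algebra :: "'v::ab_group_add hilbert \<Rightarrow> ('v \<Rightarrow> 'v) set \<Rightarrow> bool" where
  "von_neumann_algebra H M \<longleftrightarrow>
     M \<subseteq> bounded_ops H \<and>
     (\<forall>A\<in>M. \<exists>B\<in>M. \<forall>x\<in>vecs H. \<forall>y\<in>vecs H. ip H (A x) y = ip H x (B y)) \<and>
     commutant H (commutant H M) = M"

definition factor :: "'v::ab_group_add hilbert \<Rightarrow> ('v \<Rightarrow> 'v) set \<Rightarrow> bool" where
  "factor H M \<longleftrightarrow> von_neumann_algebra H M \<and> M \<inter> commutant H M = scalar_ops H"

subsection \<open>Unitary representations\<close>

definition unitary_representation ::
  "('g, 'm) monoid_scheme \<Rightarrow> 'g topology \<Rightarrow> 'v::ab_group_add hilbert \<Rightarrow> ('g \<Rightarrow> 'v \<Rightarrow> 'v) \<Rightarrow> bool"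
  where
  "unitary_representation G T H \<pi> \<longleftrightarrow>
     hilbert_space H \<and>
     (\<forall>s\<in>carrier G. unitary_op H (\<pi> s)) \<and>
     (\<forall>s\<in>carrier G. \<forall>t\<in>carrier G. \<forall>x\<in>vecs H. \<pi> (s \<otimes>\<^bsub>G\<^esub> t) x = \<pi> s (\<pi> t x)) \<and>
     (\<forall>x\<in>vecs H. \<forall>s\<in>carrier G. ((\<lambda>t. hnorm H (\<pi> t x - \<pi> s x)) \<longlongrightarrow> 0) (atin T s))"

definition factorial_representation ::
  "('g, 'm) monoid_scheme \<Rightarrow> 'g topology \<Rightarrow> 'v::ab_group_add hilbert \<Rightarrow> ('g \<Rightarrow> 'v \<Rightarrow> 'v) \<Rightarrow> bool"
  where
  "factorial_representation G T H \<pi> \<longleftrightarrow>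
     unitary_representation G T H \<pi> \<and>
     factor H (commutant H (commutant H (\<pi> ` carrier G)))"

definition coefficient ::
  "'v hilbert \<Rightarrow> ('g \<Rightarrow> 'v \<Rightarrow> 'v) \<Rightarrow> 'v \<Rightarrow> 'v \<Rightarrow> 'g \<Rightarrow> complex" where
  "coefficient H \<pi> \<xi> \<eta> s = ip H (\<pi> s \<xi>) \<eta>"

definition square_integrable_representation ::
  "('g, 'm) monoid_scheme \<Rightarrow> 'g topology \<Rightarrow> 'v::ab_group_add hilbert \<Rightarrow> ('g \<Rightarrow> 'v \<Rightarrow> 'v) \<Rightarrow> bool"
  where
  "square_integrable_representation G T H \<pi> \<longleftrightarrow>
     (\<exists>\<mu>. left_haar_measure G T \<mu> \<and>
       (\<exists>\<xi>\<in>vecs H. \<exists>\<eta>\<in>vecs H.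
          coefficient H \<pi> \<xi> \<eta> \<in> borel_measurable \<mu> \<and>
          integrable \<mu> (\<lambda>s. (cmod (coefficient H \<pi> \<xi> \<eta> s))\<^sup>2) \<and>
          \<not> (AE s in \<mu>. coefficient H \<pi> \<xi> \<eta> s = 0)))"

subsection \<open>Induction from the kernel of the modular function\<close>

text \<open>The Hilbert space \<open>\<ell>\<^sup>2(D) \<otimes> H\<close>, realized as the square summable functions from \<open>D\<close> to \<open>H\<close>;
  functions are extended by \<open>0\<close> outside \<open>D\<close>.\<close>

definition ell2 :: "'i set \<Rightarrow> 'v::ab_group_add hilbert \<Rightarrow> ('i \<Rightarrow> 'v) hilbert" where
  "ell2 D H =
     \<lparr>vecs = {f. (\<forall>\<delta>\<in>D. f \<delta> \<in> vecs H) \<and> (\<forall>\<delta>. \<delta> \<notin> D \<longrightarrow> f \<delta> = 0) \<and>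
                 (\<lambda>\<delta>. (hnorm H (f \<delta>))\<^sup>2) summable_on D},
      scl = (\<lambda>c f \<delta>. scl H c (f \<delta>)),
      ip = (\<lambda>f g. \<Sum>\<^sub>\<infinity>\<delta>\<in>D. ip H (f \<delta>) (g \<delta>))\<rparr>"

definition induced_space ::
  "('g, 'm) monoid_scheme \<Rightarrow> 'g topology \<Rightarrow> 'v::ab_group_add hilbert \<Rightarrow> (real \<Rightarrow> 'v) hilbert" where
  "induced_space G T H = ell2 (modular_range G T) H"

definition induced_representation ::
  "('g, 'm) monoid_scheme \<Rightarrow> 'g topology \<Rightarrow> (real \<Rightarrow> 'g) \<Rightarrow> ('g \<Rightarrow> 'v::ab_group_add \<Rightarrow> 'v)
     \<Rightarrow> 'g \<Rightarrow> (real \<Rightarrow> 'v) \<Rightarrow> (real \<Rightarrow> 'v)" where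
  "induced_representation G T \<sigma> \<pi> s f = (\<lambda>\<delta>.
     if \<delta> \<in> modular_range G T
     then \<pi> (inv\<^bsub>G\<^esub> (\<sigma> \<delta>) \<otimes>\<^bsub>G\<^esub> s \<otimes>\<^bsub>G\<^esub> \<sigma> (inverse (modular_function G T s) * \<delta>))
            (f (inverse (modular_function G T s) * \<delta>))
     else 0)"

end

theory Submission
  imports Defs
begin

text \<open>Write \<open>K\<close> for the kernel and \<open>D\<close> for the range of the modular function \<open>\<Delta>\<close>, and let
  \<open>M = \<pi>(K)''\<close>. On \<open>K\<close> the induced representation is the direct sum over \<open>\<delta> \<in> D\<close> of the conjugates
  \<open>k \<mapsto> \<pi>(\<sigma>(\<delta>)\<^sup>-\<^sup>1 k \<sigma>(\<delta>))\<close>. Let \<open>A\<close> be in the center of the von Neumann algebra that it generates. As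
  \<open>A\<close> commutes with \<open>1 \<otimes> \<pi>(K)'\<close>, its matrix entries over \<open>D\<close> lie in \<open>M\<close>. As \<open>A\<close> commutes with the action
  of \<open>K\<close>, the entry at \<open>(\<delta>, \<epsilon>)\<close> intertwines \<open>\<pi>\<close> with its conjugate by \<open>g = \<sigma>(\<delta>)\<^sup>-\<^sup>1 \<sigma>(\<epsilon>)\<close>, and
  conjugation by \<open>g\<close> multiplies Haar measure of \<open>K\<close> by a power of \<open>\<Delta>(g) = \<epsilon> / \<delta>\<close>. Such an
  intertwiner vanishes unless \<open>\<delta> = \<epsilon>\<close>, by the rigidity explained next. The diagonal entries lie in
  the center of \<open>M\<close>, so they are scalars, and they agree because \<open>G\<close> permutes the coordinates
  transitively. Hence \<open>A\<close> is a scalar (\<open>central_single_vec\<close>, \<open>Ind_factorial\<close>).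

  Rigidity (\<open>intertwiner_preserves_haar\<close>): if a nonzero \<open>x \<in> M\<close> intertwines \<open>\<pi>\<close> with \<open>\<pi> \<circ> \<alpha>\<close> for an
  automorphism \<open>\<alpha>\<close> of \<open>K\<close>, then \<open>\<alpha>\<close> preserves Haar measure. For irreducible \<open>\<pi>\<close> this compares formal
  degrees. In general \<open>\<pi>\<circ>\<alpha>\<close> may well be quasi-equivalent to \<open>\<pi>\<close>, as a type II factor with infinite
  trace can have automorphisms that scale the trace, so the hypothesis that \<open>x\<close> lies in \<open>M\<close> has to be used. It
  enters through the form \<open>q\<^sub>\<xi>(\<eta>) = \<integral>|\<langle>\<pi>(k)\<xi>, \<eta>\<rangle>|\<^sup>2 dk\<close>, which is closed and \<open>\<pi>(K)\<close>-invariant. The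
  operator that belongs to it is therefore affiliated with \<open>\<pi>(K)'\<close>, and \<open>q\<^sub>\<xi>\<close> is invariant under the
  unitary part of \<open>x\<close>. Since \<open>K\<close> is unimodular, \<open>q\<close> is symmetric in its two arguments up to a constant,
  so it is invariant under \<open>x\<close> in both, while the substitution \<open>k \<mapsto> \<alpha>(k)\<close> multiplies it by the modulus of
  \<open>\<alpha>\<close>. Square integrability provides a value of \<open>q\<close> that is neither \<open>0\<close> nor \<open>\<infinity>\<close>. The resolvent of the
  form (\<open>resolvent\<close>, \<open>coeff_norm2_le\<close>) turns affiliation into commutation of bounded operators.

  Square integrability of the induced representation is seen on vectors supported at \<open>1 \<in> D\<close>: their
  coefficients are coefficients of \<open>\<pi>\<close> extended by \<open>0\<close> from the open subgroup \<open>K\<close>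
  (\<open>Ind_square_integrable\<close>).

  That \<open>\<Delta>\<close> is a homomorphism which describes right translation rests on uniqueness of Haar measure
  (\<open>haar_unique\<close>), a computation with Fubini's theorem. A Haar measure on \<open>G\<close> exists because the
  hypothesis supplies one on \<open>K\<close> (\<open>left_haar_measure_exists\<close>).\<close>


section \<open>Hilbert spaces\<close>

context hilbert_space
begin

sublocale vs: vector_space "scl H"
  by (rule vector_space)

lemma zero_closed [simp, intro]: "0 \<in> vecs H"
  and add_closed [simp, intro]: "\<lbrakk>x \<in> vecs H; y \<in> vecs H\<rbrakk> \<Longrightarrow> x + y \<in> vecs H"
  and scl_closed [simp, intro]: "x \<in> vecs H \<Longrightarrow> scl H c x \<in> vecs H"
  and minus_closed [simp, intro]: "x \<in> vecs H \<Longrightarrow> - x \<in> vecs H"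
  and diff_closed [simp, intro]: "\<lbrakk>x \<in> vecs H; y \<in> vecs H\<rbrakk> \<Longrightarrow> x - y \<in> vecs H"
  using subspace vs.subspace_0 vs.subspace_add vs.subspace_scale vs.subspace_neg vs.subspace_diff
  by blast+

lemma ip_add_right:
  "\<lbrakk>x \<in> vecs H; y \<in> vecs H; z \<in> vecs H\<rbrakk> \<Longrightarrow> ip H z (x + y) = ip H z x + ip H z y"
  by (metis add_closed complex_cnj_add ip_add ip_commute)

lemma ip_scl_right: "\<lbrakk>x \<in> vecs H; y \<in> vecs H\<rbrakk> \<Longrightarrow> ip H x (scl H c y) = cnj c * ip H x y"
  by (metis complex_cnj_mult ip_commute ip_scl scl_closed)

lemma ip_minus: "\<lbrakk>x \<in> vecs H; y \<in> vecs H\<rbrakk> \<Longrightarrow> ip H (- x) y = - ip H x y"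
  using ip_scl[of x y "-1"] by simp

lemma ip_minus_right: "\<lbrakk>x \<in> vecs H; y \<in> vecs H\<rbrakk> \<Longrightarrow> ip H x (- y) = - ip H x y"
  using ip_scl_right[of x y "-1"] by simp

lemma ip_diff:
  "\<lbrakk>x \<in> vecs H; y \<in> vecs H; z \<in> vecs H\<rbrakk> \<Longrightarrow> ip H (x - y) z = ip H x z - ip H y z"
  using ip_add[of x "- y" z] ip_minus[of y z] by simp

lemma ip_diff_right:
  "\<lbrakk>x \<in> vecs H; y \<in> vecs H; z \<in> vecs H\<rbrakk> \<Longrightarrow> ip H z (x - y) = ip H z x - ip H z y"
  using ip_add_right[of x "- y" z] ip_minus_right[of z y] by simp

lemma ip_zero [simp]: "x \<in> vecs H \<Longrightarrow> ip H 0 x = 0" "x \<in> vecs H \<Longrightarrow> ip H x 0 = 0"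
  using ip_diff[of 0 0 x] ip_diff_right[of 0 0 x] by simp_all

lemma ip_self: "x \<in> vecs H \<Longrightarrow> ip H x x = of_real ((hnorm H x)\<^sup>2)"
  using ip_commute[of x x] ip_nonneg[of x]
  by (simp add: hnorm_def complex_eq_iff)

lemma hnorm_sq: "x \<in> vecs H \<Longrightarrow> (hnorm H x)\<^sup>2 = Re (ip H x x)"
  using ip_self[of x] by simp

lemma hnorm_nonneg [simp]: "x \<in> vecs H \<Longrightarrow> hnorm H x \<ge> 0"
  using ip_nonneg by (simp add: hnorm_def)

lemma hnorm_eq_0: "x \<in> vecs H \<Longrightarrow> hnorm H x = 0 \<longleftrightarrow> x = 0"
  using ip_self ip_eq_0 by fastforce

lemma hnorm_zero [simp]: "hnorm H 0 = 0"
  using hnorm_eq_0[of 0] by simp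

lemma hnorm_scl: "x \<in> vecs H \<Longrightarrow> hnorm H (scl H c x) = cmod c * hnorm H x"
proof -
  assume x: "x \<in> vecs H"
  have "ip H (scl H c x) (scl H c x) = of_real ((cmod c)\<^sup>2 * (hnorm H x)\<^sup>2)"
  proof -
    have "ip H (scl H c x) (scl H c x) = (c * cnj c) * ip H x x"
      using x by (simp add: ip_scl ip_scl_right)
    then show ?thesis using x by (simp only: complex_norm_square[symmetric] ip_self of_real_mult)
  qed
  then have "hnorm H (scl H c x) = sqrt ((cmod c * hnorm H x)\<^sup>2)"
    by (simp add: hnorm_def power_mult_distrib)
  then show ?thesis using x by simp
qed

lemma hnorm_minus: "x \<in> vecs H \<Longrightarrow> hnorm H (- x) = hnorm H x"
  using hnorm_scl[of x "-1"] by simp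

lemma hnorm_minus_commute: "\<lbrakk>x \<in> vecs H; y \<in> vecs H\<rbrakk> \<Longrightarrow> hnorm H (x - y) = hnorm H (y - x)"
  using hnorm_minus[of "x - y"] by simp

lemma hnorm_add_sq:
  assumes "x \<in> vecs H" "y \<in> vecs H"
  shows "(hnorm H (x + y))\<^sup>2 = (hnorm H x)\<^sup>2 + 2 * Re (ip H x y) + (hnorm H y)\<^sup>2"
  using assms ip_commute[of x y] by (simp add: hnorm_sq ip_add ip_add_right)

lemma parallelogram:
  assumes "x \<in> vecs H" "y \<in> vecs H"
  shows "(hnorm H (x + y))\<^sup>2 + (hnorm H (x - y))\<^sup>2 = 2 * (hnorm H x)\<^sup>2 + 2 * (hnorm H y)\<^sup>2"
  using assms hnorm_add_sq[of x y] hnorm_add_sq[of x "- y"]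
  by (simp add: ip_minus_right hnorm_minus)

lemma cauchy_schwarz:
  assumes x: "x \<in> vecs H" and y: "y \<in> vecs H"
  shows "cmod (ip H x y) \<le> hnorm H x * hnorm H y"
proof (cases "y = 0")
  case True
  then show ?thesis using x by simp
next
  case False
  then have n: "hnorm H y \<noteq> 0" using hnorm_eq_0[OF y] by simp
  define t where "t = ip H x y / of_real ((hnorm H y)\<^sup>2)"
  have "0 \<le> (hnorm H (x + scl H (- t) y))\<^sup>2" by simp
  also have "\<dots> = (hnorm H x)\<^sup>2 - 2 * Re (cnj t * ip H x y) + (cmod t)\<^sup>2 * (hnorm H y)\<^sup>2"
    using x y by (subst hnorm_add_sq) (auto simp: hnorm_scl ip_scl_right power_mult_distrib
        simp del: vs.scale_minus_left)
  also have "cnj t * ip H x y = of_real ((cmod (ip H x y))\<^sup>2 / (hnorm H y)\<^sup>2)"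
    unfolding t_def by (simp add: mult.commute complex_norm_square[symmetric])
  also have "(cmod t)\<^sup>2 * (hnorm H y)\<^sup>2 = (cmod (ip H x y))\<^sup>2 / (hnorm H y)\<^sup>2"
    using n by (simp add: t_def norm_divide norm_mult norm_power field_simps power2_eq_square)
  finally have "(cmod (ip H x y))\<^sup>2 / (hnorm H y)\<^sup>2 \<le> (hnorm H x)\<^sup>2"
    by simp
  then have "(cmod (ip H x y))\<^sup>2 \<le> (hnorm H x * hnorm H y)\<^sup>2"
    using n by (simp add: field_simps power_mult_distrib)
  then show ?thesis
    using x y by (meson abs_le_square_iff hnorm_nonneg mult_nonneg_nonneg power2_le_imp_le)
qed

lemma hnorm_triangle:
  assumes "x \<in> vecs H" "y \<in> vecs H"
  shows "hnorm H (x + y) \<le> hnorm H x + hnorm H y"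
proof (rule power2_le_imp_le)
  have "Re (ip H x y) \<le> hnorm H x * hnorm H y"
    using cauchy_schwarz[OF assms] complex_Re_le_cmod order_trans by blast
  then show "(hnorm H (x + y))\<^sup>2 \<le> (hnorm H x + hnorm H y)\<^sup>2"
    using assms by (simp add: hnorm_add_sq power2_sum)
qed (use assms in simp)

lemma hnorm_diff_sq_le:
  assumes "x \<in> vecs H" "y \<in> vecs H"
  shows "(hnorm H (x - y))\<^sup>2 \<le> 2 * (hnorm H x)\<^sup>2 + 2 * (hnorm H y)\<^sup>2"
  using parallelogram[OF assms] by (smt (verit) zero_le_power2)

lemma hnorm_add_sq_le:
  assumes "x \<in> vecs H" "y \<in> vecs H"
  shows "(hnorm H (x + y))\<^sup>2 \<le> 2 * (hnorm H x)\<^sup>2 + 2 * (hnorm H y)\<^sup>2"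
  using parallelogram[OF assms] by (smt (verit) zero_le_power2)

lemma ip_tendsto:
  assumes "\<And>n. X n \<in> vecs H" "x \<in> vecs H" "y \<in> vecs H"
    and "((\<lambda>n. hnorm H (X n - x)) \<longlongrightarrow> 0) F"
  shows "((\<lambda>n. ip H (X n) y) \<longlongrightarrow> ip H x y) F"
proof -
  have "((\<lambda>n. ip H (X n) y - ip H x y) \<longlongrightarrow> 0) F"
  proof (rule Lim_null_comparison)
    show "\<forall>\<^sub>F n in F. cmod (ip H (X n) y - ip H x y) \<le> hnorm H (X n - x) * hnorm H y"
      using assms cauchy_schwarz[of "X n - x" y for n] by (simp add: ip_diff)
    show "((\<lambda>n. hnorm H (X n - x) * hnorm H y) \<longlongrightarrow> 0) F"
      using tendsto_mult_right[OF assms(4), of "hnorm H y"] by simp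
  qed
  then show ?thesis by (simp add: LIM_zero_iff)
qed

lemma hnorm_tendsto:
  assumes "\<And>n. X n \<in> vecs H" "x \<in> vecs H" and "((\<lambda>n. hnorm H (X n - x)) \<longlongrightarrow> 0) F"
  shows "((\<lambda>n. hnorm H (X n)) \<longlongrightarrow> hnorm H x) F"
proof -
  have "((\<lambda>n. hnorm H (X n) - hnorm H x) \<longlongrightarrow> 0) F"
  proof (rule Lim_null_comparison)
    show "\<forall>\<^sub>F n in F. norm (hnorm H (X n) - hnorm H x) \<le> hnorm H (X n - x)"
    proof (rule always_eventually, rule allI)
      fix n
      have "hnorm H (X n) \<le> hnorm H (X n - x) + hnorm H x"
        using hnorm_triangle[of "X n - x" x] assms by simp
      moreover have "hnorm H x \<le> hnorm H (x - X n) + hnorm H (X n)"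
        using hnorm_triangle[of "x - X n" "X n"] assms by simp
      ultimately show "norm (hnorm H (X n) - hnorm H x) \<le> hnorm H (X n - x)"
        using assms by (simp add: hnorm_minus_commute[of x])
    qed
  qed (rule assms(3))
  then show ?thesis by (simp add: LIM_zero_iff)
qed

lemma eq_by_ip:
  assumes "x \<in> vecs H" "y \<in> vecs H" "\<And>z. z \<in> vecs H \<Longrightarrow> ip H z x = ip H z y"
  shows "x = y"
proof -
  have "ip H (x - y) (x - y) = 0"
    using assms by (simp add: ip_diff_right)
  then show ?thesis using ip_eq_0[of "x - y"] assms by simp
qed

lemma eq_by_ip_left:
  assumes "x \<in> vecs H" "y \<in> vecs H" "\<And>z. z \<in> vecs H \<Longrightarrow> ip H x z = ip H y z"
  shows "x = y"
proof (rule eq_by_ip)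
  show "ip H z x = ip H z y" if "z \<in> vecs H" for z
    using assms that by (metis ip_commute)
qed (use assms in auto)

text \<open>The representing vector is the limit of a minimizing sequence of \<open>\<parallel>x\<parallel>\<^sup>2 - 2 Re (\<phi> x)\<close>. The
  functional is given on an arbitrary subspace \<open>W\<close>; later \<open>W\<close> is the range of a resolvent, and the
  bound on \<open>\<phi>\<close> puts a vector into the domain of a closed form.\<close>

lemma riesz_representation:
  assumes W: "W \<subseteq> vecs H" "0 \<in> W" "\<And>x y. x \<in> W \<Longrightarrow> y \<in> W \<Longrightarrow> x + y \<in> W"
      "\<And>c x. x \<in> W \<Longrightarrow> scl H c x \<in> W"
    and \<phi>: "\<And>x y. x \<in> W \<Longrightarrow> y \<in> W \<Longrightarrow> \<phi> (x + y) = \<phi> x + \<phi> y"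
      "\<And>c x. x \<in> W \<Longrightarrow> \<phi> (scl H c x) = c * \<phi> x"
    and bound: "\<And>x. x \<in> W \<Longrightarrow> cmod (\<phi> x) \<le> B * hnorm H x"
  obtains z where "z \<in> vecs H" "\<And>x. x \<in> W \<Longrightarrow> \<phi> x = ip H x z" "hnorm H z \<le> max B 0"
proof -
  define J where "J x = (hnorm H x)\<^sup>2 - 2 * Re (\<phi> x)" for x
  have WV: "x \<in> vecs H" if "x \<in> W" for x using W(1) that by blast
  have lower: "J x \<ge> - (B\<^sup>2)" if "x \<in> W" for x
  proof -
    have "Re (\<phi> x) \<le> B * hnorm H x"
      using bound[OF that] complex_Re_le_cmod order_trans by blast
    then have "J x \<ge> (hnorm H x)\<^sup>2 - 2 * (B * hnorm H x)" unfolding J_def by simp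
    also have "(hnorm H x)\<^sup>2 - 2 * (B * hnorm H x) = (hnorm H x - B)\<^sup>2 - B\<^sup>2"
      by (simp add: power2_diff)
    finally show ?thesis by (smt (verit) zero_le_power2)
  qed
  define d where "d = Inf (J ` W)"
  have bdd: "bdd_below (J ` W)" using lower by (auto intro!: bdd_belowI2)
  have d_le: "d \<le> J x" if "x \<in> W" for x
    unfolding d_def by (rule cINF_lower[OF bdd that])
  have "\<exists>x\<in>W. J x < d + 1 / real (Suc n)" for n
  proof -
    have "Inf (J ` W) < d + 1 / real (Suc n)" by (simp add: d_def)
    then show ?thesis using cInf_lessD[of "J ` W"] W(2) by blast
  qed
  then obtain X where X: "\<And>n. X n \<in> W" "\<And>n. J (X n) < d + 1 / real (Suc n)"
    by metis
  have XV: "X n \<in> vecs H" for n using X WV by blast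
  have close: "(hnorm H (x - y))\<^sup>2 \<le> 2 * (J x - d) + 2 * (J y - d)"
    if "x \<in> W" "y \<in> W" for x y
  proof -
    let ?m = "scl H (1/2) (x + y)"
    have m: "?m \<in> W" using that W by blast
    have "4 * (hnorm H ?m)\<^sup>2 = (hnorm H (x + y))\<^sup>2"
      using that WV by (simp add: hnorm_scl power_mult_distrib power2_eq_square)
    moreover have "2 * Re (\<phi> ?m) = Re (\<phi> x) + Re (\<phi> y)"
      using that W \<phi> by simp
    ultimately have "4 * J ?m = (hnorm H (x + y))\<^sup>2 - 4 * (Re (\<phi> x) + Re (\<phi> y))"
      unfolding J_def by simp
    then show ?thesis
      using parallelogram[of x y] that WV d_le[OF m] unfolding J_def by simp
  qed
  have cauchy: "\<exists>N. \<forall>m\<ge>N. \<forall>n\<ge>N. hnorm H (X m - X n) < e" if e: "e > 0" for e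
  proof -
    obtain N where N: "4 / real (Suc N) < e\<^sup>2"
      using reals_Archimedean[of "e\<^sup>2 / 4"] e by (auto simp: field_simps)
    have "hnorm H (X m - X n) < e" if "m \<ge> N" "n \<ge> N" for m n
    proof -
      have "1 / real (Suc m) \<le> 1 / real (Suc N)" "1 / real (Suc n) \<le> 1 / real (Suc N)"
        using that by (auto intro!: divide_left_mono)
      then have "(hnorm H (X m - X n))\<^sup>2 \<le> 4 / real (Suc N)"
        using close[OF X(1)[of m] X(1)[of n]] X(2)[of m] X(2)[of n] by simp
      then have "(hnorm H (X m - X n))\<^sup>2 < e\<^sup>2" using N by linarith
      then show ?thesis using e by (simp add: power_less_imp_less_base)
    qed
    then show ?thesis by blast
  qed
  obtain z where z: "z \<in> vecs H" and lim: "(\<lambda>n. hnorm H (X n - z)) \<longlonglongrightarrow> 0"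
    using complete[OF XV cauchy] by blast
  have variation: "Re (ip H x z) = Re (\<phi> x)" if x: "x \<in> W" for x
  proof -
    have ineq: "0 \<le> t\<^sup>2 * (hnorm H x)\<^sup>2 + 2 * t * (Re (ip H x z) - Re (\<phi> x))" for t :: real
    proof (rule LIMSEQ_le)
      have "J (X n + scl H (of_real t) x)
          = J (X n) + t\<^sup>2 * (hnorm H x)\<^sup>2 + 2 * t * (Re (ip H x (X n)) - Re (\<phi> x))" for n
        using XV[of n] WV[OF x] x X(1)[of n] W ip_commute[OF XV[of n] WV[OF x]]
        by (simp add: J_def \<phi> hnorm_add_sq hnorm_scl ip_scl_right power_mult_distrib algebra_simps)
      moreover have "d \<le> J (X n + scl H (of_real t) x)" for n
        by (rule d_le[OF W(3)[OF X(1) W(4)[OF x]]])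
      ultimately have "- (1 / real (Suc n))
          \<le> t\<^sup>2 * (hnorm H x)\<^sup>2 + 2 * t * (Re (ip H x (X n)) - Re (\<phi> x))" for n
        using X(2)[of n] by (smt (verit))
      then show "\<exists>N. \<forall>n\<ge>N. - (1 / real (Suc n))
          \<le> t\<^sup>2 * (hnorm H x)\<^sup>2 + 2 * t * (Re (ip H x (X n)) - Re (\<phi> x))"
        by blast
      show "(\<lambda>n. - (1 / real (Suc n))) \<longlonglongrightarrow> 0"
        using tendsto_minus[OF LIMSEQ_inverse_real_of_nat] by (simp add: inverse_eq_divide)
      have "(\<lambda>n. cnj (ip H (X n) x)) \<longlonglongrightarrow> cnj (ip H z x)"
        by (intro tendsto_intros ip_tendsto XV z lim WV x)
      then have "(\<lambda>n. ip H x (X n)) \<longlonglongrightarrow> ip H x z"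
        using XV z WV[OF x] by (simp add: ip_commute[symmetric])
      then show "(\<lambda>n. t\<^sup>2 * (hnorm H x)\<^sup>2 + 2 * t * (Re (ip H x (X n)) - Re (\<phi> x)))
          \<longlonglongrightarrow> t\<^sup>2 * (hnorm H x)\<^sup>2 + 2 * t * (Re (ip H x z) - Re (\<phi> x))"
        by (intro tendsto_intros)
    qed
    \<comment> \<open>A quadratic polynomial in \<open>t\<close> that is nonnegative and vanishes at \<open>0\<close> has no linear term.\<close>
    define a where "a = (hnorm H x)\<^sup>2"
    define b where "b = Re (ip H x z) - Re (\<phi> x)"
    have a: "a \<ge> 0" by (simp add: a_def)
    define t where "t = - b / (a + 1)"
    have b: "b = - ((a + 1) * t)" using a by (simp add: t_def)
    have "0 \<le> t\<^sup>2 * a + 2 * t * b"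
      using ineq[of t] by (simp add: a_def b_def)
    also have "t\<^sup>2 * a + 2 * t * b = - (t\<^sup>2 * (a + 2))"
      by (simp add: b power2_eq_square algebra_simps)
    finally have "t = 0"
      using a by (smt (verit) mult_pos_pos zero_less_power2)
    then have "b = 0" by (simp add: b)
    then show ?thesis by (simp add: b_def)
  qed
  have rep: "\<phi> x = ip H x z" if x: "x \<in> W" for x
  proof (rule complex_eqI)
    show "Re (\<phi> x) = Re (ip H x z)" using variation[OF x] by simp
    \<comment> \<open>The imaginary part is the real part at \<open>\<i> x\<close>.\<close>
    have "Re (ip H (scl H \<i> x) z) = Re (\<phi> (scl H \<i> x))"
      using variation[OF W(4)[OF x]] .
    then show "Im (\<phi> x) = Im (ip H x z)"
      using x z WV \<phi> by (simp add: ip_scl)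
  qed
  have "hnorm H z \<le> max B 0"
  proof -
    have "(hnorm H z)\<^sup>2 \<le> B * hnorm H z"
    proof (rule LIMSEQ_le)
      show "(\<lambda>n. cmod (ip H (X n) z)) \<longlonglongrightarrow> (hnorm H z)\<^sup>2"
        using tendsto_norm[OF ip_tendsto[OF XV z z lim]] z by (simp add: ip_self norm_power)
      show "(\<lambda>n. B * hnorm H (X n)) \<longlonglongrightarrow> B * hnorm H z"
        by (intro tendsto_intros hnorm_tendsto XV z lim)
      show "\<exists>N. \<forall>n\<ge>N. cmod (ip H (X n) z) \<le> B * hnorm H (X n)"
        using bound X rep by metis
    qed
    then have "hnorm H z * hnorm H z \<le> B * hnorm H z" by (simp add: power2_eq_square)
    then show ?thesis
      using hnorm_nonneg[OF z] by (smt (verit) mult_right_le_imp_le)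
  qed
  then show ?thesis using that z rep by blast
qed

subsection \<open>Bounded operators and commutants\<close>

lemma bounded_opsD:
  assumes "A \<in> bounded_ops H"
  shows "\<And>x. x \<in> vecs H \<Longrightarrow> A x \<in> vecs H"
    and "\<And>x y. \<lbrakk>x \<in> vecs H; y \<in> vecs H\<rbrakk> \<Longrightarrow> A (x + y) = A x + A y"
    and "\<And>c x. x \<in> vecs H \<Longrightarrow> A (scl H c x) = scl H c (A x)"
    and "\<And>x y. \<lbrakk>x \<in> vecs H; y \<in> vecs H\<rbrakk> \<Longrightarrow> A (x - y) = A x - A y"
    and "A 0 = 0"
proof -
  show *: "\<And>x. x \<in> vecs H \<Longrightarrow> A x \<in> vecs H"
    and add: "\<And>x y. \<lbrakk>x \<in> vecs H; y \<in> vecs H\<rbrakk> \<Longrightarrow> A (x + y) = A x + A y"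
    and scl: "\<And>c x. x \<in> vecs H \<Longrightarrow> A (scl H c x) = scl H c (A x)"
    using assms by (auto simp: bounded_ops_def linear_op_def)
  show "A (x - y) = A x - A y" if "x \<in> vecs H" "y \<in> vecs H" for x y
    using add[of "x - y" y] that by (simp add: algebra_simps)
  show "A 0 = 0"
    using scl[of 0 0] by simp
qed

lemma bounded_ops_bound:
  assumes "A \<in> bounded_ops H"
  obtains B where "B \<ge> 0" "\<And>x. x \<in> vecs H \<Longrightarrow> hnorm H (A x) \<le> B * hnorm H x"
proof -
  obtain B where B: "\<And>x. x \<in> vecs H \<Longrightarrow> hnorm H (A x) \<le> B * hnorm H x"
    using assms by (auto simp: bounded_ops_def)
  have "hnorm H (A x) \<le> \<bar>B\<bar> * hnorm H x" if "x \<in> vecs H" for x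
    using B[OF that] mult_right_mono[OF abs_ge_self, of "hnorm H x" B] that by simp
  then show ?thesis using that[of "\<bar>B\<bar>"] by simp
qed

lemma bounded_opsI:
  assumes "\<And>x. x \<in> vecs H \<Longrightarrow> A x \<in> vecs H"
    and "\<And>x y. \<lbrakk>x \<in> vecs H; y \<in> vecs H\<rbrakk> \<Longrightarrow> A (x + y) = A x + A y"
    and "\<And>c x. x \<in> vecs H \<Longrightarrow> A (scl H c x) = scl H c (A x)"
    and "\<And>x. x \<in> vecs H \<Longrightarrow> hnorm H (A x) \<le> B * hnorm H x"
  shows "A \<in> bounded_ops H"
  unfolding bounded_ops_def linear_op_def
  by (intro CollectI conjI exI[of _ B] ballI allI assms)

lemma adjoint_exists:
  assumes A: "A \<in> bounded_ops H"
  obtains B where "B \<in> bounded_ops H"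
    "\<And>x y. \<lbrakk>x \<in> vecs H; y \<in> vecs H\<rbrakk> \<Longrightarrow> ip H (A x) y = ip H x (B y)"
proof -
  obtain a where a: "a \<ge> 0" "\<And>x. x \<in> vecs H \<Longrightarrow> hnorm H (A x) \<le> a * hnorm H x"
    using bounded_ops_bound[OF A] by blast
  note [simp] = bounded_opsD[OF A]
  have "\<exists>z\<in>vecs H. \<forall>x\<in>vecs H. ip H (A x) y = ip H x z" if y: "y \<in> vecs H" for y
  proof -
    obtain z where "z \<in> vecs H" "\<And>x. x \<in> vecs H \<Longrightarrow> ip H (A x) y = ip H x z"
    proof (rule riesz_representation[where W = "vecs H" and \<phi> = "\<lambda>x. ip H (A x) y" and B = "a * hnorm H y"])
      fix z assume "z \<in> vecs H" "\<And>x. x \<in> vecs H \<Longrightarrow> ip H (A x) y = ip H x z"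
      then show thesis by (rule that)
    next
      show "cmod (ip H (A x) y) \<le> a * hnorm H y * hnorm H x" if "x \<in> vecs H" for x
        using cauchy_schwarz[of "A x" y] a(2)[OF that] y that
          mult_right_mono[OF a(2)[OF that] hnorm_nonneg[OF y]]
        by (simp add: mult.commute mult.left_commute)
    qed (use y in \<open>auto simp: ip_add ip_scl\<close>)
    then show ?thesis by blast
  qed
  then obtain B where B: "\<And>y. y \<in> vecs H \<Longrightarrow> B y \<in> vecs H"
    "\<And>x y. \<lbrakk>x \<in> vecs H; y \<in> vecs H\<rbrakk> \<Longrightarrow> ip H (A x) y = ip H x (B y)"
    by metis
  have "B \<in> bounded_ops H"
  proof (rule bounded_opsI[of _ a])
    fix x y assume xy: "x \<in> vecs H" "y \<in> vecs H"
    show "B (x + y) = B x + B y"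
      by (rule eq_by_ip) (use xy B(1) in \<open>auto simp: ip_add_right B(2)[symmetric]\<close>)
  next
    fix c x assume x: "x \<in> vecs H"
    show "B (scl H c x) = scl H c (B x)"
      by (rule eq_by_ip) (use x B(1) in \<open>auto simp: ip_scl_right B(2)[symmetric]\<close>)
  next
    fix y assume y: "y \<in> vecs H"
    have "(hnorm H (B y))\<^sup>2 = cmod (ip H (A (B y)) y)"
      using y B by (simp add: ip_self norm_power)
    also have "\<dots> \<le> hnorm H (A (B y)) * hnorm H y"
      using cauchy_schwarz y B(1) by simp
    also have "\<dots> \<le> a * hnorm H (B y) * hnorm H y"
      using a(2)[of "B y"] y B(1) by (intro mult_right_mono) auto
    finally have "hnorm H (B y) * hnorm H (B y) \<le> (a * hnorm H y) * hnorm H (B y)"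
      by (simp add: power2_eq_square mult_ac)
    then show "hnorm H (B y) \<le> a * hnorm H y"
      using hnorm_nonneg[OF B(1)[OF y]] a y
      by (smt (verit) hnorm_nonneg mult_nonneg_nonneg mult_right_le_imp_le)
  qed (use B in auto)
  then show ?thesis using B that by blast
qed

lemma commutantD:
  assumes "A \<in> commutant H S"
  shows "A \<in> bounded_ops H" "\<And>B x. \<lbrakk>B \<in> S; x \<in> vecs H\<rbrakk> \<Longrightarrow> A (B x) = B (A x)"
  using assms by (auto simp: commutant_def)

lemma commutant_subset: "commutant H S \<subseteq> bounded_ops H"
  by (auto simp: commutant_def)

lemma commutant_antimono: "S \<subseteq> S' \<Longrightarrow> commutant H S' \<subseteq> commutant H S"
  by (auto simp: commutant_def)

lemma subset_bicommutant: "S \<subseteq> bounded_ops H \<Longrightarrow> S \<subseteq> commutant H (commutant H S)"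
  by (auto simp: commutant_def)

lemma tricommutant:
  "S \<subseteq> bounded_ops H \<Longrightarrow> commutant H (commutant H (commutant H S)) = commutant H S"
  by (simp add: commutant_antimono commutant_subset subset_antisym subset_bicommutant)

lemma adjoint_sym:
  assumes "A \<in> bounded_ops H" "B \<in> bounded_ops H"
    and "\<And>x y. \<lbrakk>x \<in> vecs H; y \<in> vecs H\<rbrakk> \<Longrightarrow> ip H (A x) y = ip H x (B y)"
    and "x \<in> vecs H" "y \<in> vecs H"
  shows "ip H (B x) y = ip H x (A y)"
  using assms bounded_opsD(1)[OF assms(1)] bounded_opsD(1)[OF assms(2)] by (metis ip_commute)

lemma commutant_adjoint:
  assumes S: "S \<subseteq> bounded_ops H"
    and adj: "\<And>A. A \<in> S \<Longrightarrow> \<exists>B\<in>S. \<forall>x\<in>vecs H. \<forall>y\<in>vecs H. ip H (A x) y = ip H x (B y)"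
    and A: "A \<in> commutant H S"
  shows "\<exists>B\<in>commutant H S. \<forall>x\<in>vecs H. \<forall>y\<in>vecs H. ip H (A x) y = ip H x (B y)"
proof -
  note A' = commutantD[OF A]
  obtain B where B: "B \<in> bounded_ops H"
    "\<And>x y. \<lbrakk>x \<in> vecs H; y \<in> vecs H\<rbrakk> \<Longrightarrow> ip H (A x) y = ip H x (B y)"
    using adjoint_exists[OF A'(1)] by blast
  have "B (C x) = C (B x)" if C: "C \<in> S" and x: "x \<in> vecs H" for C x
  proof (rule eq_by_ip)
    obtain C' where C': "C' \<in> S" "\<And>x y. \<lbrakk>x \<in> vecs H; y \<in> vecs H\<rbrakk> \<Longrightarrow> ip H (C x) y = ip H x (C' y)"
      using adj[OF C] by blast
    have bd: "C \<in> bounded_ops H" "C' \<in> bounded_ops H" using S C C' by auto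
    note cl = bounded_opsD(1)[OF bd(1)] bounded_opsD(1)[OF bd(2)]
      bounded_opsD(1)[OF A'(1)] bounded_opsD(1)[OF B(1)]
    show "B (C x) \<in> vecs H" "C (B x) \<in> vecs H" using x cl by auto
    fix z assume z: "z \<in> vecs H"
    have "ip H z (B (C x)) = ip H (A z) (C x)" using B(2) z x cl by simp
    also have "\<dots> = ip H (C' (A z)) x"
      using adjoint_sym[OF bd C'(2), of "A z" x] z x cl by simp
    also have "\<dots> = ip H (A (C' z)) x" using A'(2)[OF C'(1) z] by simp
    also have "\<dots> = ip H (C' z) (B x)" using B(2) z x cl by simp
    also have "\<dots> = ip H z (C (B x))"
      using adjoint_sym[OF bd C'(2), of z "B x"] z x cl by simp
    finally show "ip H z (B (C x)) = ip H z (C (B x))" .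
  qed
  then have "B \<in> commutant H S" using B(1) by (auto simp: commutant_def)
  then show ?thesis using B(2) by blast
qed

lemma bicommutant_von_neumann_algebra:
  assumes S: "S \<subseteq> bounded_ops H"
    and adj: "\<And>A. A \<in> S \<Longrightarrow> \<exists>B\<in>S. \<forall>x\<in>vecs H. \<forall>y\<in>vecs H. ip H (A x) y = ip H x (B y)"
  shows "von_neumann_algebra H (commutant H (commutant H S))"
  unfolding von_neumann_algebra_def
  using commutant_adjoint[OF commutant_subset commutant_adjoint[OF S adj]]
    tricommutant[OF commutant_subset] commutant_subset by blast

lemma scalar_subset_commutant:
  assumes "S \<subseteq> bounded_ops H"
  shows "scalar_ops H \<subseteq> commutant H S"
proof
  fix A assume "A \<in> scalar_ops H"
  then obtain c where c: "\<And>x. x \<in> vecs H \<Longrightarrow> A x = scl H c x" by (auto simp: scalar_ops_def)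
  have "A \<in> bounded_ops H"
    by (rule bounded_opsI[of _ "cmod c"])
      (auto simp: c vs.scale_right_distrib hnorm_scl vs.scale_left_commute)
  moreover have "A (B x) = B (A x)" if "B \<in> S" "x \<in> vecs H" for B x
    using that assms bounded_opsD[of B] c by (metis subsetD)
  ultimately show "A \<in> commutant H S" by (auto simp: commutant_def)
qed

text \<open>Since \<open>S''' = S'\<close>, the center of \<open>S''\<close> is \<open>S' \<inter> S''\<close>.\<close>

lemma factor_bicommutantI:
  assumes S: "S \<subseteq> bounded_ops H"
    and adj: "\<And>A. A \<in> S \<Longrightarrow> \<exists>B\<in>S. \<forall>x\<in>vecs H. \<forall>y\<in>vecs H. ip H (A x) y = ip H x (B y)"
    and central: "\<And>A. \<lbrakk>A \<in> commutant H S; A \<in> commutant H (commutant H S)\<rbrakk> \<Longrightarrow> A \<in> scalar_ops H"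
  shows "factor H (commutant H (commutant H S))"
  unfolding factor_def
proof (intro conjI bicommutant_von_neumann_algebra S adj)
  show "commutant H (commutant H S) \<inter> commutant H (commutant H (commutant H S)) = scalar_ops H"
    unfolding tricommutant[OF S]
    using central scalar_subset_commutant[OF S] scalar_subset_commutant[OF commutant_subset] by blast
qed

lemma unitary_opD:
  assumes "unitary_op H U"
  shows "U \<in> bounded_ops H"
    and "\<And>x y. \<lbrakk>x \<in> vecs H; y \<in> vecs H\<rbrakk> \<Longrightarrow> ip H (U x) (U y) = ip H x y"
    and "\<And>x. x \<in> vecs H \<Longrightarrow> hnorm H (U x) = hnorm H x"
    and "\<And>x. x \<in> vecs H \<Longrightarrow> U x \<in> vecs H"
proof -
  show n: "hnorm H (U x) = hnorm H x" if "x \<in> vecs H" for x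
    using assms that by (simp add: unitary_op_def hnorm_def)
  show "ip H (U x) (U y) = ip H x y" if "x \<in> vecs H" "y \<in> vecs H" for x y
    using assms that by (simp add: unitary_op_def)
  have "\<forall>x\<in>vecs H. hnorm H (U x) \<le> 1 * hnorm H x" using n by simp
  then show "U \<in> bounded_ops H"
    using assms unfolding unitary_op_def bounded_ops_def by blast
  then show "U x \<in> vecs H" if "x \<in> vecs H" for x
    using bounded_opsD(1) that by blast
qed

end

section \<open>Square summable families\<close>

context hilbert_space
begin

lemma vecs_ell2:
  "f \<in> vecs (ell2 D H) \<longleftrightarrow> (\<forall>\<delta>\<in>D. f \<delta> \<in> vecs H) \<and> (\<forall>\<delta>. \<delta> \<notin> D \<longrightarrow> f \<delta> = 0)
     \<and> (\<lambda>\<delta>. (hnorm H (f \<delta>))\<^sup>2) summable_on D"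
  by (simp add: ell2_def)

lemma ell2_apply: "f \<in> vecs (ell2 D H) \<Longrightarrow> f \<delta> \<in> vecs H"
  by (cases "\<delta> \<in> D") (auto simp: vecs_ell2)

lemma ell2_outside: "\<lbrakk>f \<in> vecs (ell2 D H); \<delta> \<notin> D\<rbrakk> \<Longrightarrow> f \<delta> = 0"
  by (simp add: vecs_ell2)

lemma ell2_summable: "f \<in> vecs (ell2 D H) \<Longrightarrow> (\<lambda>\<delta>. (hnorm H (f \<delta>))\<^sup>2) summable_on D"
  by (simp add: vecs_ell2)

lemma scl_ell2: "scl (ell2 D H) c f = (\<lambda>\<delta>. scl H c (f \<delta>))"
  and ip_ell2: "ip (ell2 D H) f g = (\<Sum>\<^sub>\<infinity>\<delta>\<in>D. ip H (f \<delta>) (g \<delta>))"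
  by (simp_all only: ell2_def hilbert.simps)

lemma add_vecs_ell2:
  assumes "f \<in> vecs (ell2 D H)" "g \<in> vecs (ell2 D H)"
  shows "f + g \<in> vecs (ell2 D H)"
proof -
  note [simp] = ell2_apply[OF assms(1)] ell2_apply[OF assms(2)]
  have "(\<lambda>\<delta>. (hnorm H ((f + g) \<delta>))\<^sup>2) summable_on D"
  proof (rule summable_on_comparison_test)
    show "(\<lambda>\<delta>. 2 * (hnorm H (f \<delta>))\<^sup>2 + 2 * (hnorm H (g \<delta>))\<^sup>2) summable_on D"
      using assms by (intro summable_on_add summable_on_cmult_right ell2_summable)
    show "(hnorm H ((f + g) \<delta>))\<^sup>2 \<le> 2 * (hnorm H (f \<delta>))\<^sup>2 + 2 * (hnorm H (g \<delta>))\<^sup>2" for \<delta>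
      using assms by (simp add: hnorm_add_sq_le)
  qed simp
  then show ?thesis using assms by (simp add: vecs_ell2)
qed

lemma scl_vecs_ell2:
  assumes "f \<in> vecs (ell2 D H)"
  shows "scl (ell2 D H) c f \<in> vecs (ell2 D H)"
proof -
  note [simp] = ell2_apply[OF assms(1)]
  have "(\<lambda>\<delta>. (hnorm H (scl H c (f \<delta>)))\<^sup>2) summable_on D"
    using assms by (simp add: hnorm_scl power_mult_distrib summable_on_cmult_right ell2_summable)
  then show ?thesis using assms by (simp add: vecs_ell2 scl_ell2)
qed

lemma ell2_ip_summable:
  assumes "f \<in> vecs (ell2 D H)" "g \<in> vecs (ell2 D H)"
  shows "(\<lambda>\<delta>. ip H (f \<delta>) (g \<delta>)) summable_on D"
proof (rule abs_summable_summable, rule summable_on_comparison_test)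
  note [simp] = ell2_apply[OF assms(1)] ell2_apply[OF assms(2)]
  show "(\<lambda>\<delta>. (hnorm H (f \<delta>))\<^sup>2 + (hnorm H (g \<delta>))\<^sup>2) summable_on D"
    using assms by (intro summable_on_add ell2_summable)
  show "cmod (ip H (f \<delta>) (g \<delta>)) \<le> (hnorm H (f \<delta>))\<^sup>2 + (hnorm H (g \<delta>))\<^sup>2" for \<delta>
  proof -
    have "cmod (ip H (f \<delta>) (g \<delta>)) \<le> hnorm H (f \<delta>) * hnorm H (g \<delta>)"
      using assms by (simp add: cauchy_schwarz)
    also have "\<dots> \<le> (hnorm H (f \<delta>))\<^sup>2 + (hnorm H (g \<delta>))\<^sup>2"
    proof -
      have "0 \<le> hnorm H (f \<delta>) * hnorm H (g \<delta>)" by simp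
      then show ?thesis
        using sum_squares_bound[of "hnorm H (f \<delta>)" "hnorm H (g \<delta>)"] unfolding mult.assoc
        by linarith
    qed
    finally show ?thesis .
  qed
qed simp

lemma ip_self_ell2:
  assumes "f \<in> vecs (ell2 D H)"
  shows "ip (ell2 D H) f f = of_real (\<Sum>\<^sub>\<infinity>\<delta>\<in>D. (hnorm H (f \<delta>))\<^sup>2)"
proof -
  note [simp] = ell2_apply[OF assms(1)]
  have "((\<lambda>\<delta>. complex_of_real ((hnorm H (f \<delta>))\<^sup>2))
      has_sum of_real (\<Sum>\<^sub>\<infinity>\<delta>\<in>D. (hnorm H (f \<delta>))\<^sup>2)) D"
    using ell2_summable[OF assms] by (intro has_sum_of_real has_sum_infsum)
  then show ?thesis
    using assms by (simp add: ip_ell2 ip_self infsumI del: of_real_power)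
qed

lemma hnorm_ell2_sq:
  assumes "f \<in> vecs (ell2 D H)"
  shows "(hnorm (ell2 D H) f)\<^sup>2 = (\<Sum>\<^sub>\<infinity>\<delta>\<in>D. (hnorm H (f \<delta>))\<^sup>2)"
  unfolding hnorm_def[of "ell2 D H"] ip_self_ell2[OF assms]
  by (simp add: infsum_nonneg)

lemma hnorm_le_ell2:
  assumes "f \<in> vecs (ell2 D H)"
  shows "hnorm H (f \<delta>) \<le> hnorm (ell2 D H) f"
proof (cases "\<delta> \<in> D")
  case True
  then have "(hnorm H (f \<delta>))\<^sup>2 \<le> (hnorm (ell2 D H) f)\<^sup>2"
    using finite_sum_le_infsum[OF ell2_summable[OF assms], of "{\<delta>}"] assms
    by (simp add: hnorm_ell2_sq)
  then show ?thesis
    by (rule power2_le_imp_le) (simp add: hnorm_def ip_self_ell2[OF assms] infsum_nonneg)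
next
  case False
  then show ?thesis
    using assms by (simp add: ell2_outside hnorm_def[of "ell2 D H"] ip_self_ell2 infsum_nonneg)
qed

lemma ell2_finite_sum_le:
  assumes f: "\<And>\<delta>. \<delta> \<in> D \<Longrightarrow> f \<delta> \<in> vecs H" "\<And>\<delta>. \<delta> \<notin> D \<Longrightarrow> f \<delta> = 0"
    and le: "\<And>F. \<lbrakk>finite F; F \<subseteq> D\<rbrakk> \<Longrightarrow> (\<Sum>\<delta>\<in>F. (hnorm H (f \<delta>))\<^sup>2) \<le> C"
  shows "f \<in> vecs (ell2 D H)" "(hnorm (ell2 D H) f)\<^sup>2 \<le> C"
proof -
  have "(\<lambda>\<delta>. (hnorm H (f \<delta>))\<^sup>2) summable_on D"
    using le by (intro nonneg_bdd_above_summable_on bdd_aboveI2) auto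
  then show *: "f \<in> vecs (ell2 D H)" using f by (simp add: vecs_ell2)
  show "(hnorm (ell2 D H) f)\<^sup>2 \<le> C"
    unfolding hnorm_ell2_sq[OF *] by (intro infsum_le_finite_sums ell2_summable[OF *] le)
qed

text \<open>The limit is taken in each coordinate. A bound on finite partial sums survives the limit, and
  gives both square summability and convergence in norm.\<close>

lemma ell2_complete:
  assumes X: "\<And>n. X n \<in> vecs (ell2 D H)"
    and cauchy: "\<And>e. e > 0 \<Longrightarrow> \<exists>N. \<forall>m\<ge>N. \<forall>n\<ge>N. hnorm (ell2 D H) (X m - X n) < e"
  shows "\<exists>x\<in>vecs (ell2 D H). (\<lambda>n. hnorm (ell2 D H) (X n - x)) \<longlonglongrightarrow> 0"
proof -
  have diff: "f - g \<in> vecs (ell2 D H)" if "f \<in> vecs (ell2 D H)" "g \<in> vecs (ell2 D H)" for f g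
  proof -
    have eq: "f - g = f + scl (ell2 D H) (-1) g"
      by (simp add: scl_ell2 fun_eq_iff)
    show ?thesis
      by (subst eq) (intro add_vecs_ell2 scl_vecs_ell2 that)
  qed
  have "\<exists>x\<in>vecs H. (\<lambda>n. hnorm H (X n \<delta> - x)) \<longlonglongrightarrow> 0" for \<delta>
  proof (rule complete)
    show "X n \<delta> \<in> vecs H" for n using X by (rule ell2_apply)
    fix e :: real assume "e > 0"
    then obtain N where "\<And>m n. \<lbrakk>m \<ge> N; n \<ge> N\<rbrakk> \<Longrightarrow> hnorm (ell2 D H) (X m - X n) < e"
      using cauchy by blast
    then show "\<exists>N. \<forall>m\<ge>N. \<forall>n\<ge>N. hnorm H (X m \<delta> - X n \<delta>) < e"
      using hnorm_le_ell2[OF diff[OF X X], of _ _ \<delta>] by (metis le_less_trans minus_apply)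
  qed
  then obtain x where x: "\<And>\<delta>. x \<delta> \<in> vecs H" "\<And>\<delta>. (\<lambda>n. hnorm H (X n \<delta> - x \<delta>)) \<longlonglongrightarrow> 0"
    by metis
  have x0: "x \<delta> = 0" if "\<delta> \<notin> D" for \<delta>
  proof -
    have "X n \<delta> = 0" for n using ell2_outside[OF X that] .
    then have "(\<lambda>n. hnorm H (- x \<delta>)) \<longlonglongrightarrow> 0" using x(2)[of \<delta>] by simp
    then have "hnorm H (x \<delta>) = 0" using x(1) by (simp add: hnorm_minus LIMSEQ_const_iff)
    then show ?thesis using hnorm_eq_0 x(1) by blast
  qed
  have near: "\<exists>N. \<forall>n\<ge>N. X n - x \<in> vecs (ell2 D H) \<and> (hnorm (ell2 D H) (X n - x))\<^sup>2 \<le> e\<^sup>2"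
    if e: "e > 0" for e :: real
  proof -
    obtain N where N: "\<And>m n. \<lbrakk>m \<ge> N; n \<ge> N\<rbrakk> \<Longrightarrow> hnorm (ell2 D H) (X m - X n) < e"
      using cauchy[OF e] by blast
    have "X n - x \<in> vecs (ell2 D H) \<and> (hnorm (ell2 D H) (X n - x))\<^sup>2 \<le> e\<^sup>2" if n: "n \<ge> N" for n
    proof -
      have *: "(\<Sum>\<delta>\<in>F. (hnorm H ((X n - x) \<delta>))\<^sup>2) \<le> e\<^sup>2" if F: "finite F" "F \<subseteq> D" for F
      proof (rule LIMSEQ_le_const2)
        have "(\<lambda>m. hnorm H (X n \<delta> - X m \<delta>)) \<longlonglongrightarrow> hnorm H (X n \<delta> - x \<delta>)" for \<delta>
          by (rule hnorm_tendsto) (use ell2_apply[OF X] x hnorm_minus_commute in auto)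
        then show "(\<lambda>m. \<Sum>\<delta>\<in>F. (hnorm H ((X n - X m) \<delta>))\<^sup>2)
            \<longlonglongrightarrow> (\<Sum>\<delta>\<in>F. (hnorm H ((X n - x) \<delta>))\<^sup>2)"
          by (auto intro!: tendsto_intros)
        have "(\<Sum>\<delta>\<in>F. (hnorm H ((X n - X m) \<delta>))\<^sup>2) \<le> e\<^sup>2" if "m \<ge> N" for m
        proof -
          have "(\<Sum>\<delta>\<in>F. (hnorm H ((X n - X m) \<delta>))\<^sup>2) \<le> (hnorm (ell2 D H) (X n - X m))\<^sup>2"
            unfolding hnorm_ell2_sq[OF diff[OF X X]]
            by (rule finite_sum_le_infsum[OF ell2_summable[OF diff[OF X X]] F]) simp
          also have "\<dots> \<le> e\<^sup>2"
            using N[OF n that]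
            by (intro power_mono) (auto simp: hnorm_def ip_self_ell2[OF diff[OF X X]] infsum_nonneg)
          finally show ?thesis .
        qed
        then show "\<exists>N. \<forall>m\<ge>N. (\<Sum>\<delta>\<in>F. (hnorm H ((X n - X m) \<delta>))\<^sup>2) \<le> e\<^sup>2" by blast
      qed
      show ?thesis
        by (intro conjI ell2_finite_sum_le[of D "X n - x" "e\<^sup>2"])
          (use ell2_apply[OF X] x x0 * in \<open>auto simp: ell2_outside[OF X]\<close>)
    qed
    then show ?thesis by blast
  qed
  obtain n where "X n - x \<in> vecs (ell2 D H)" using near[of 1] by auto
  then have "X n - (X n - x) \<in> vecs (ell2 D H)" by (rule diff[OF X])
  then have xV: "x \<in> vecs (ell2 D H)" by simp
  have "(\<lambda>n. hnorm (ell2 D H) (X n - x)) \<longlonglongrightarrow> 0"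
  proof (rule LIMSEQ_I)
    fix e :: real assume e: "e > 0"
    obtain N where N: "\<And>n. n \<ge> N \<Longrightarrow> (hnorm (ell2 D H) (X n - x))\<^sup>2 \<le> (e / 2)\<^sup>2"
      using near[of "e / 2"] e by auto
    have "norm (hnorm (ell2 D H) (X n - x) - 0) < e" if "n \<ge> N" for n
    proof -
      have "\<bar>hnorm (ell2 D H) (X n - x)\<bar> \<le> \<bar>e / 2\<bar>"
        using N[OF that] abs_le_square_iff by blast
      then show ?thesis using e by simp
    qed
    then show "\<exists>N. \<forall>n\<ge>N. norm (hnorm (ell2 D H) (X n - x) - 0) < e" by blast
  qed
  then show ?thesis using xV by blast
qed

theorem hilbert_space_ell2: "hilbert_space (ell2 D H)"
proof
  show "scl (ell2 D H) a (x + y) = scl (ell2 D H) a x + scl (ell2 D H) a y"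
    "scl (ell2 D H) (a + b) x = scl (ell2 D H) a x + scl (ell2 D H) b x"
    "scl (ell2 D H) a (scl (ell2 D H) b x) = scl (ell2 D H) (a * b) x"
    "scl (ell2 D H) 1 x = x" for a b x y
    by (auto simp: scl_ell2 vs.scale_right_distrib vs.scale_left_distrib)
  then have "vector_space (scl (ell2 D H))" by unfold_locales
  then have m: "module (scl (ell2 D H))" by (simp only: module_iff_vector_space)
  have "0 \<in> vecs (ell2 D H)" by (simp add: vecs_ell2)
  then show "module.subspace (scl (ell2 D H)) (vecs (ell2 D H))"
    by (simp only: module.subspace_def[OF m]) (simp add: add_vecs_ell2 scl_vecs_ell2)
next
  fix x y z assume *: "x \<in> vecs (ell2 D H)" "y \<in> vecs (ell2 D H)" "z \<in> vecs (ell2 D H)"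
  show "ip (ell2 D H) (x + y) z = ip (ell2 D H) x z + ip (ell2 D H) y z"
    using * by (simp add: ip_ell2 ip_add infsum_add ell2_ip_summable ell2_apply[OF *(1)]
        ell2_apply[OF *(2)] ell2_apply[OF *(3)])
next
  fix c x y assume *: "x \<in> vecs (ell2 D H)" "y \<in> vecs (ell2 D H)"
  show "ip (ell2 D H) (scl (ell2 D H) c x) y = c * ip (ell2 D H) x y"
    using * by (simp add: ip_ell2 scl_ell2 ip_scl infsum_cmult_right ell2_ip_summable
        ell2_apply[OF *(1)] ell2_apply[OF *(2)])
  show "ip (ell2 D H) y x = cnj (ip (ell2 D H) x y)"
    using ip_commute[OF ell2_apply[OF *(1)] ell2_apply[OF *(2)]]
    by (simp add: ip_ell2 infsum_cnj[symmetric] del: infsum_cnj)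
next
  fix x assume x: "x \<in> vecs (ell2 D H)"
  show "Re (ip (ell2 D H) x x) \<ge> 0" using ip_self_ell2[OF x] by (simp add: infsum_nonneg)
  assume "ip (ell2 D H) x x = 0"
  then have "hnorm (ell2 D H) x = 0" by (simp add: hnorm_def)
  then have "hnorm H (x \<delta>) = 0" for \<delta>
    using hnorm_le_ell2[OF x, of \<delta>] hnorm_nonneg[OF ell2_apply[OF x]] by (simp add: order_antisym)
  then show "x = 0" using hnorm_eq_0[OF ell2_apply[OF x]] by (simp add: fun_eq_iff)
qed (rule ell2_complete)

end

text \<open>The elementary tensor of the unit vector at \<open>\<epsilon>\<close> with \<open>v\<close>.\<close>

definition single_vec :: "'i \<Rightarrow> 'v::zero \<Rightarrow> 'i \<Rightarrow> 'v" where
  "single_vec \<epsilon> v = (\<lambda>\<delta>. if \<delta> = \<epsilon> then v else 0)"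

context hilbert_space
begin

lemma single_vec_same [simp]: "single_vec \<epsilon> v \<epsilon> = v"
  by (simp add: single_vec_def)

lemma ip_single_vec:
  assumes "\<epsilon> \<in> D" "v \<in> vecs H" "f \<in> vecs (ell2 D H)"
  shows "ip (ell2 D H) (single_vec \<epsilon> v) f = ip H v (f \<epsilon>)"
    and "ip (ell2 D H) f (single_vec \<epsilon> v) = ip H (f \<epsilon>) v"
proof -
  have "ip (ell2 D H) (single_vec \<epsilon> v) f = (\<Sum>\<^sub>\<infinity>\<delta>\<in>{\<epsilon>}. ip H (single_vec \<epsilon> v \<delta>) (f \<delta>))"
    unfolding ip_ell2 using assms by (intro infsum_cong_neutral) (auto simp: single_vec_def ell2_apply[OF assms(3)])
  then show "ip (ell2 D H) (single_vec \<epsilon> v) f = ip H v (f \<epsilon>)" by simp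
  have "ip (ell2 D H) f (single_vec \<epsilon> v) = (\<Sum>\<^sub>\<infinity>\<delta>\<in>{\<epsilon>}. ip H (f \<delta>) (single_vec \<epsilon> v \<delta>))"
    unfolding ip_ell2 using assms by (intro infsum_cong_neutral) (auto simp: single_vec_def ell2_apply[OF assms(3)])
  then show "ip (ell2 D H) f (single_vec \<epsilon> v) = ip H (f \<epsilon>) v" by simp
qed

lemma single_vec_ell2:
  assumes "\<epsilon> \<in> D" "v \<in> vecs H"
  shows "single_vec \<epsilon> v \<in> vecs (ell2 D H)"
proof -
  have "(\<lambda>\<delta>. (hnorm H (single_vec \<epsilon> v \<delta>))\<^sup>2) summable_on D \<longleftrightarrow>
      (\<lambda>\<delta>. (hnorm H (single_vec \<epsilon> v \<delta>))\<^sup>2) summable_on {\<epsilon>}"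
    using assms by (intro summable_on_cong_neutral) (auto simp: single_vec_def)
  then show ?thesis using assms by (auto simp: vecs_ell2 single_vec_def)
qed

lemma hnorm_single_vec:
  assumes "\<epsilon> \<in> D" "v \<in> vecs H"
  shows "hnorm (ell2 D H) (single_vec \<epsilon> v) = hnorm H v"
  unfolding hnorm_def using ip_single_vec(1)[OF assms single_vec_ell2[OF assms]] by simp

end

section \<open>Uniqueness of Haar measure\<close>

lemma space_borel_of [simp]: "space (borel_of T) = topspace T"
  by (simp add: borel_of_def space_measure_of_conv)

lemma sets_borel_of: "sets (borel_of T) = sigma_sets (topspace T) {U. openin T U}"
  unfolding borel_of_def by (rule sets_measure_of) (auto dest: openin_subset)

lemma openin_sets_borel_of: "openin T U \<Longrightarrow> U \<in> sets (borel_of T)"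
  by (simp add: sets_borel_of)

lemma measurable_borel_ofI:
  assumes "\<And>x. x \<in> space M \<Longrightarrow> f x \<in> topspace T"
    and "\<And>U. openin T U \<Longrightarrow> f -` U \<inter> space M \<in> sets M"
  shows "f \<in> measurable M (borel_of T)"
  unfolding borel_of_def by (rule measurable_measure_of) (use assms in \<open>auto dest: openin_subset\<close>)

lemma continuous_map_measurable:
  assumes "continuous_map S T f"
  shows "f \<in> measurable (borel_of S) (borel_of T)"
  using assms
  by (intro measurable_borel_ofI)
    (auto simp: continuous_map_def Int_def vimage_def conj_commute intro!: openin_sets_borel_of)

text \<open>An open set of the product is a countable union of open rectangles. So continuous functions of
  two variables are measurable for the product of the Borel algebras, as Fubini's theorem
  requires.\<close>

lemma openin_prod_sets:
  assumes S: "second_countable S" and T: "second_countable T"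
    and W: "openin (prod_topology S T) W"
  shows "W \<in> sets (borel_of S \<Otimes>\<^sub>M borel_of T)"
proof -
  obtain A where A: "countable A" "\<And>V. V \<in> A \<Longrightarrow> openin S V"
    "\<And>U x. \<lbrakk>openin S U; x \<in> U\<rbrakk> \<Longrightarrow> \<exists>V\<in>A. x \<in> V \<and> V \<subseteq> U"
    using S by (auto simp: second_countable_def)
  obtain B where B: "countable B" "\<And>V. V \<in> B \<Longrightarrow> openin T V"
    "\<And>U x. \<lbrakk>openin T U; x \<in> U\<rbrakk> \<Longrightarrow> \<exists>V\<in>B. x \<in> V \<and> V \<subseteq> U"
    using T by (auto simp: second_countable_def)
  define P where "P = {(U, V) \<in> A \<times> B. U \<times> V \<subseteq> W}"
  have "countable P"
    using A(1) B(1) by (auto simp: P_def intro: countable_subset[of _ "A \<times> B"])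
  moreover have "W = (\<Union>(U, V)\<in>P. U \<times> V)"
  proof (intro equalityI subsetI)
    fix z assume "z \<in> W"
    then obtain U V where "openin S U" "openin T V" "z \<in> U \<times> V" "U \<times> V \<subseteq> W"
      using W by (cases z) (metis SigmaI openin_prod_topology_alt)
    moreover then obtain U' V' where "U' \<in> A" "fst z \<in> U'" "U' \<subseteq> U" "V' \<in> B" "snd z \<in> V'" "V' \<subseteq> V"
      using A(3)[of U "fst z"] B(3)[of V "snd z"] by (auto simp: mem_Times_iff)
    ultimately have "(U', V') \<in> P" "z \<in> U' \<times> V'" by (auto simp: P_def mem_Times_iff)
    then show "z \<in> (\<Union>(U, V)\<in>P. U \<times> V)" by blast
  qed (auto simp: P_def)
  moreover have "U \<times> V \<in> sets (borel_of S \<Otimes>\<^sub>M borel_of T)" if "(U, V) \<in> P" for U V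
    using that A(2) B(2) by (auto simp: P_def intro!: pair_measureI openin_sets_borel_of)
  ultimately show ?thesis
    by (auto intro!: sets.countable_UN' simp: split_beta)
qed

lemma continuous_map_prod_measurable:
  assumes "second_countable S" "second_countable T" "continuous_map (prod_topology S T) X f"
  shows "f \<in> measurable (borel_of S \<Otimes>\<^sub>M borel_of T) (borel_of X)"
proof (rule measurable_borel_ofI)
  show "f z \<in> topspace X" if "z \<in> space (borel_of S \<Otimes>\<^sub>M borel_of T)" for z
    using that assms(3) by (auto simp: continuous_map_def space_pair_measure)
  show "f -` U \<inter> space (borel_of S \<Otimes>\<^sub>M borel_of T) \<in> sets (borel_of S \<Otimes>\<^sub>M borel_of T)"
    if "openin X U" for U
  proof -
    have "openin (prod_topology S T) {z \<in> topspace (prod_topology S T). f z \<in> U}"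
      using assms(3) that by (rule openin_continuous_map_preimage)
    moreover have "f -` U \<inter> space (borel_of S \<Otimes>\<^sub>M borel_of T)
        = {z \<in> topspace (prod_topology S T). f z \<in> U}"
      by (auto simp: space_pair_measure)
    ultimately show ?thesis using openin_prod_sets assms by metis
  qed
qed

lemma borel_measurable_continuous_map:
  assumes "continuous_map T euclidean f"
  shows "f \<in> borel_measurable (borel_of T)"
proof (rule borel_measurableI)
  fix S :: "'b set" assume "open S"
  then have "openin T {x \<in> topspace T. f x \<in> S}"
    using assms by (auto intro: openin_continuous_map_preimage)
  moreover have "f -` S \<inter> space (borel_of T) = {x \<in> topspace T. f x \<in> S}" by auto
  ultimately show "f -` S \<inter> space (borel_of T) \<in> sets (borel_of T)"
    by (metis openin_sets_borel_of)
qed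

locale second_countable_group = locally_compact_group +
  assumes second_countable: "second_countable T"
begin

lemma continuous_left_mult: "s \<in> carrier G \<Longrightarrow> continuous_map T T (\<lambda>x. s \<otimes> x)"
proof -
  assume s: "s \<in> carrier G"
  have "continuous_map T (prod_topology T T) (\<lambda>x. (s, x))"
    using s by (auto simp: continuous_map_pairwise o_def topspace_eq)
  from continuous_map_compose[OF this continuous_mult] show ?thesis by (simp add: o_def)
qed

lemma continuous_right_mult: "s \<in> carrier G \<Longrightarrow> continuous_map T T (\<lambda>x. x \<otimes> s)"
proof -
  assume s: "s \<in> carrier G"
  have "continuous_map T (prod_topology T T) (\<lambda>x. (x, s))"
    using s by (auto simp: continuous_map_pairwise o_def topspace_eq)
  from continuous_map_compose[OF this continuous_mult] show ?thesis by (simp add: o_def)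
qed

lemma openin_carrier: "openin T U \<Longrightarrow> U \<subseteq> carrier G"
  using openin_subset topspace_eq by metis

lemma l_coset_eq_preimage:
  assumes "s \<in> carrier G" "E \<subseteq> carrier G"
  shows "s <# E = {x \<in> carrier G. inv s \<otimes> x \<in> E}"
proof -
  have "x \<in> s <# E" if "x \<in> carrier G" "inv s \<otimes> x \<in> E" for x
    unfolding l_coset_def using that assms
    by (intro UN_I[of "inv s \<otimes> x"]) (auto simp: m_assoc[symmetric])
  moreover have "inv s \<otimes> (s \<otimes> x) = x" if "x \<in> E" for x
    using that assms by (simp add: m_assoc[symmetric] subset_eq)
  ultimately show ?thesis using assms by (auto simp: l_coset_def)
qed

lemma r_coset_eq_preimage:
  assumes "s \<in> carrier G" "E \<subseteq> carrier G"
  shows "E #> s = {x \<in> carrier G. x \<otimes> inv s \<in> E}"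
proof -
  have "x \<in> E #> s" if "x \<in> carrier G" "x \<otimes> inv s \<in> E" for x
    unfolding r_coset_def using that assms
    by (intro UN_I[of "x \<otimes> inv s"]) (auto simp: m_assoc)
  moreover have "x \<otimes> s \<otimes> inv s = x" if "x \<in> E" for x
    using that assms by (simp add: m_assoc subset_eq)
  ultimately show ?thesis using assms by (auto simp: r_coset_def)
qed

lemma openin_l_coset: "\<lbrakk>s \<in> carrier G; openin T U\<rbrakk> \<Longrightarrow> openin T (s <# U)"
  using openin_continuous_map_preimage[OF continuous_left_mult[of "inv s"], of U]
  by (simp add: l_coset_eq_preimage openin_carrier topspace_eq)

lemma openin_r_coset: "\<lbrakk>s \<in> carrier G; openin T U\<rbrakk> \<Longrightarrow> openin T (U #> s)"
  using openin_continuous_map_preimage[OF continuous_right_mult[of "inv s"], of U]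
  by (simp add: r_coset_eq_preimage openin_carrier topspace_eq)

lemma countable_subcover:
  assumes "\<And>U. U \<in> \<U> \<Longrightarrow> openin T U" "\<Union>\<U> = carrier G"
  obtains \<V> where "countable \<V>" "\<V> \<subseteq> \<U>" "\<Union>\<V> = carrier G"
  using second_countable_imp_Lindelof_space[OF second_countable] assms
  unfolding Lindelof_space_def topspace_eq by metis

end

text \<open>These properties of a Haar measure pass at once to its restriction to an open subgroup and to
  its images under right translations and inversion, and they suffice for uniqueness up to a
  factor.\<close>

locale haar_space = second_countable_group +
  fixes \<mu> :: "'a measure"
  assumes sets_haar: "sets \<mu> = sets (borel_of T)"
    and haar_nonzero: "emeasure \<mu> (space \<mu>) \<noteq> 0"
    and haar_compact: "compactin T C \<Longrightarrow> emeasure \<mu> C < \<infinity>"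
    and haar_left_invariant:
      "\<lbrakk>s \<in> carrier G; E \<in> sets \<mu>\<rbrakk> \<Longrightarrow> emeasure \<mu> (s <# E) = emeasure \<mu> E"
begin

lemma space_haar [simp]: "space \<mu> = carrier G"
  using sets_eq_imp_space_eq[OF sets_haar] by (simp add: topspace_eq)

lemma sets_haar_carrier: "E \<in> sets \<mu> \<Longrightarrow> E \<subseteq> carrier G"
  using sets.sets_into_space by fastforce

lemma openin_sets_haar: "openin T U \<Longrightarrow> U \<in> sets \<mu>"
  by (simp add: sets_haar openin_sets_borel_of)

lemma measurable_continuous: "continuous_map T T f \<Longrightarrow> f \<in> measurable \<mu> \<mu>"
  using continuous_map_measurable measurable_cong_sets[OF sets_haar sets_haar] by blast

lemma left_mult_measurable: "s \<in> carrier G \<Longrightarrow> (\<lambda>x. s \<otimes> x) \<in> measurable \<mu> \<mu>"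
  and right_mult_measurable: "s \<in> carrier G \<Longrightarrow> (\<lambda>x. x \<otimes> s) \<in> measurable \<mu> \<mu>"
  and inv_measurable: "(\<lambda>x. inv x) \<in> measurable \<mu> \<mu>"
  by (simp_all add: measurable_continuous continuous_left_mult continuous_right_mult continuous_inv)

lemma distr_left_mult:
  assumes s: "s \<in> carrier G"
  shows "distr \<mu> \<mu> (\<lambda>x. s \<otimes> x) = \<mu>"
proof (rule measure_eqI)
  fix E assume "E \<in> sets (distr \<mu> \<mu> (\<lambda>x. s \<otimes> x))"
  then have E: "E \<in> sets \<mu>" by simp
  have "(\<lambda>x. s \<otimes> x) -` E \<inter> space \<mu> = inv s <# E"
    using s sets_haar_carrier[OF E] by (auto simp: l_coset_eq_preimage)
  then show "emeasure (distr \<mu> \<mu> (\<lambda>x. s \<otimes> x)) E = emeasure \<mu> E"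
    using s E by (simp add: emeasure_distr left_mult_measurable haar_left_invariant)
qed simp

lemma nn_integral_left_mult:
  assumes "s \<in> carrier G" "f \<in> borel_measurable \<mu>"
  shows "(\<integral>\<^sup>+x. f (s \<otimes> x) \<partial>\<mu>) = (\<integral>\<^sup>+x. f x \<partial>\<mu>)"
  using nn_integral_distr[OF left_mult_measurable[OF assms(1)], of f] assms
  by (simp add: distr_left_mult)

text \<open>Countably many translates of a nonempty open set cover the group.\<close>

lemma haar_open_pos:
  assumes U: "openin T U" "U \<noteq> {}"
  shows "emeasure \<mu> U \<noteq> 0"
proof
  assume null: "emeasure \<mu> U = 0"
  obtain u where u: "u \<in> U" using U by blast
  have "x \<in> (x \<otimes> inv u) <# U" if "x \<in> carrier G" for x
    using that u openin_carrier[OF U(1)]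
    by (auto simp: l_coset_def m_assoc intro!: bexI[of _ u])
  then have "carrier G \<subseteq> (\<Union>s\<in>carrier G. s <# U)"
    using u openin_carrier[OF U(1)] by fastforce
  moreover have "(\<Union>s\<in>carrier G. s <# U) \<subseteq> carrier G"
    using openin_carrier[OF openin_l_coset[OF _ U(1)]] by blast
  ultimately have "\<Union>((\<lambda>s. s <# U) ` carrier G) = carrier G" by (rule subset_antisym[rotated])
  then obtain \<V> where \<V>: "countable \<V>" "\<V> \<subseteq> (\<lambda>s. s <# U) ` carrier G" "\<Union>\<V> = carrier G"
    by (rule countable_subcover[rotated]) (auto intro: openin_l_coset U(1))
  have "V \<in> null_sets \<mu>" if V: "V \<in> \<V>" for V
  proof -
    obtain s where s: "s \<in> carrier G" "V = s <# U" using V \<V>(2) by blast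
    show ?thesis
      unfolding s(2)
      using haar_left_invariant[OF s(1) openin_sets_haar[OF U(1)]] null
        openin_sets_haar[OF openin_l_coset[OF s(1) U(1)]] by (intro null_setsI) simp_all
  qed
  then have "(\<Union>V\<in>\<V>. V) \<in> null_sets \<mu>" using \<V>(1) by (intro null_sets_UN')
  then have "emeasure \<mu> (carrier G) = 0" using \<V>(3) by (simp add: null_sets_def)
  then show False using haar_nonzero by simp
qed

lemma compact_sets_haar:
  assumes "compactin T C"
  shows "C \<in> sets \<mu>"
proof -
  have "closedin T C" using assms Hausdorff compactin_imp_closedin by blast
  then show ?thesis
    using sets.compl_sets[OF openin_sets_haar, of "topspace T - C"] compactin_subset_topspace[OF assms]
    by (simp add: closedin_def double_diff topspace_eq)
qed

lemma sigma_finite_haar: "sigma_finite_measure \<mu>"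
proof
  let ?\<U> = "{U. openin T U \<and> (\<exists>C. compactin T C \<and> U \<subseteq> C)}"
  have "\<Union>?\<U> = carrier G"
  proof (intro equalityI subsetI)
    fix x assume "x \<in> carrier G"
    then show "x \<in> \<Union>?\<U>"
      using locally_compact unfolding locally_compact_space_def topspace_eq by blast
  next
    fix x assume "x \<in> \<Union>?\<U>"
    then show "x \<in> carrier G" using openin_carrier by blast
  qed
  then obtain \<V> where \<V>: "countable \<V>" "\<V> \<subseteq> ?\<U>" "\<Union>\<V> = carrier G"
    by (rule countable_subcover[rotated]) auto
  have "emeasure \<mu> V \<noteq> \<infinity>" if V: "V \<in> \<V>" for V
  proof -
    obtain C where C: "compactin T C" "V \<subseteq> C" using V \<V>(2) by blast
    have "emeasure \<mu> V \<le> emeasure \<mu> C" using C compact_sets_haar by (intro emeasure_mono)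
    then show ?thesis using haar_compact[OF C(1)] by (auto simp: top_unique)
  qed
  then show "\<exists>A. countable A \<and> A \<subseteq> sets \<mu> \<and> \<Union>A = space \<mu> \<and> (\<forall>a\<in>A. emeasure \<mu> a \<noteq> \<infinity>)"
    using \<V> openin_sets_haar by (intro exI[of _ \<V>]) auto
qed

lemma exists_finite_open:
  obtains W where "openin T W" "W \<noteq> {}" "\<And>s. s \<in> carrier G \<Longrightarrow> emeasure \<mu> (W #> s) < \<infinity>"
    "emeasure \<mu> W < \<infinity>"
proof -
  obtain W C where W: "openin T W" "compactin T C" "\<one> \<in> W" "W \<subseteq> C"
    using locally_compact unfolding locally_compact_space_def topspace_eq by (meson one_closed)
  have fin: "emeasure \<mu> (W #> s) < \<infinity>" if s: "s \<in> carrier G" for s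
  proof -
    have c: "compactin T ((\<lambda>x. x \<otimes> s) ` C)"
      using image_compactin[OF W(2) continuous_right_mult[OF s]] .
    have "emeasure \<mu> (W #> s) \<le> emeasure \<mu> ((\<lambda>x. x \<otimes> s) ` C)"
      using W(4) compact_sets_haar[OF c] by (intro emeasure_mono) (auto simp: r_coset_def)
    then show ?thesis using haar_compact[OF c] by (rule le_less_trans)
  qed
  have "W #> \<one> = W" using openin_carrier[OF W(1)] by (auto simp: r_coset_def subset_eq)
  then have "emeasure \<mu> W < \<infinity>" using fin[of \<one>] by simp
  then show ?thesis using that[OF W(1)] W(3) fin by blast
qed

end

context second_countable_group
begin

lemma mult_pair_measurable:
  "(\<lambda>(x, y). x \<otimes> y) \<in> measurable (borel_of T \<Otimes>\<^sub>M borel_of T) (borel_of T)"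
  using continuous_map_prod_measurable[OF second_countable second_countable continuous_mult] .

text \<open>The integral of \<open>f(x) g(yx) / \<integral>g(tx) d\<nu>(t)\<close> over \<open>\<mu> \<times> \<nu>\<close> is \<open>\<integral>f d\<mu>\<close>. The substitutions
  \<open>x \<mapsto> y\<^sup>-\<^sup>1x\<close> and \<open>y \<mapsto> xy\<close> turn it into a product of \<open>\<integral>g d\<mu>\<close> and a factor that does not
  involve \<open>\<mu>\<close>. Here \<open>f\<close> and \<open>g\<close> are the indicator functions of \<open>E\<close> and \<open>W\<close>.\<close>

lemma haar_integral_formula:
  assumes \<mu>: "haar_space G T \<mu>" and \<nu>: "haar_space G T \<nu>"
    and W: "openin T W" "W \<noteq> {}" "\<And>s. s \<in> carrier G \<Longrightarrow> emeasure \<nu> (W #> s) < \<infinity>"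
    and E: "E \<in> sets (borel_of T)"
  shows "emeasure \<mu> E = emeasure \<mu> W *
    (\<integral>\<^sup>+y. indicator E (inv y) * inverse (\<integral>\<^sup>+t. indicator W (t \<otimes> inv y) \<partial>\<nu>) \<partial>\<nu>)"
proof -
  interpret M: haar_space G T \<mu> by (rule \<mu>)
  interpret N: haar_space G T \<nu> by (rule \<nu>)
  interpret MN: pair_sigma_finite \<mu> \<nu>
    using M.sigma_finite_haar N.sigma_finite_haar by (simp add: pair_sigma_finite_def)
  let ?B = "borel_of T"
  have Wm [measurable]: "W \<in> sets ?B" using W(1) by (rule openin_sets_borel_of)
  have [measurable_cong]: "sets \<mu> = sets ?B" "sets \<nu> = sets ?B"
    by (rule M.sets_haar, rule N.sets_haar)
  note [measurable] = E
  have [measurable]: "(\<lambda>x. inv x) \<in> measurable ?B ?B"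
    by (rule continuous_map_measurable[OF continuous_inv])
  have mult [measurable (raw)]: "(\<lambda>x. f x \<otimes> g x) \<in> measurable A ?B"
    if "f \<in> measurable A ?B" "g \<in> measurable A ?B" for f g and A :: "'c measure"
    using measurable_compose[OF measurable_Pair[OF that] mult_pair_measurable] by simp
  define D where "D x = (\<integral>\<^sup>+t. indicator W (t \<otimes> x) \<partial>\<nu>)" for x
  have Dm [measurable]: "D \<in> borel_measurable ?B"
  proof -
    have "(\<lambda>x. \<integral>\<^sup>+t. indicator W (t \<otimes> x) \<partial>\<nu>) \<in> borel_measurable ?B"
      by (rule sigma_finite_measure.borel_measurable_nn_integral[OF N.sigma_finite_haar]) measurable
    then show ?thesis by (simp add: D_def[abs_def])
  qed
  have D: "D x * inverse (D x) = 1" if x: "x \<in> carrier G" for x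
  proof -
    have "D x = (\<integral>\<^sup>+t. indicator (W #> inv x) t \<partial>\<nu>)"
      unfolding D_def using x openin_carrier[OF W(1)]
      by (intro nn_integral_cong) (auto simp: r_coset_eq_preimage indicator_def)
    also have "\<dots> = emeasure \<nu> (W #> inv x)"
      using N.openin_sets_haar[OF openin_r_coset[OF _ W(1)], of "inv x"] x by simp
    finally have "D x = emeasure \<nu> (W #> inv x)" .
    moreover have "W #> inv x \<noteq> {}" using W(2) by (auto simp: r_coset_def)
    then have "emeasure \<nu> (W #> inv x) \<noteq> 0"
      using N.haar_open_pos[OF openin_r_coset[OF _ W(1)], of "inv x"] x by blast
    ultimately show ?thesis
      using W(3)[of "inv x"] x by (simp add: ennreal_divide_self divide_ennreal_def[symmetric])
  qed
  define h :: "'a \<Rightarrow> 'a \<Rightarrow> ennreal"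
    where "h x y = indicator E x * (indicator W (y \<otimes> x) * inverse (D x))" for x y
  have hm [measurable (raw)]: "(\<lambda>x. h (f x) (g x)) \<in> borel_measurable A"
    if [measurable]: "f \<in> measurable A ?B" "g \<in> measurable A ?B" for f g and A :: "'c measure"
    unfolding h_def by measurable
  have "emeasure \<mu> E = (\<integral>\<^sup>+x. indicator E x \<partial>\<mu>)" using E by (simp add: M.sets_haar)
  also have "\<dots> = (\<integral>\<^sup>+x. \<integral>\<^sup>+y. h x y \<partial>\<nu> \<partial>\<mu>)"
  proof (rule nn_integral_cong)
    fix x assume "x \<in> space \<mu>"
    then have x: "x \<in> carrier G" by simp
    have [measurable]: "x \<in> space ?B" using x by (simp add: topspace_eq)
    have "(\<integral>\<^sup>+y. h x y \<partial>\<nu>) = indicator E x * (D x * inverse (D x))"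
      unfolding h_def D_def by (subst nn_integral_cmult, measurable) (subst nn_integral_multc, measurable)
    then show "indicator E x = (\<integral>\<^sup>+y. h x y \<partial>\<nu>)" using D[OF x] by simp
  qed
  also have "\<dots> = (\<integral>\<^sup>+y. \<integral>\<^sup>+x. h x y \<partial>\<mu> \<partial>\<nu>)"
    by (rule MN.Fubini'[symmetric]) measurable
  also have "\<dots> = (\<integral>\<^sup>+y. \<integral>\<^sup>+x. h (inv y \<otimes> x) y \<partial>\<mu> \<partial>\<nu>)"
  proof (rule nn_integral_cong)
    fix y assume "y \<in> space \<nu>"
    then have y: "y \<in> carrier G" by simp
    then have [measurable]: "y \<in> space ?B" by (simp add: topspace_eq)
    have "(\<lambda>x. h x y) \<in> borel_measurable \<mu>" by measurable
    then show "(\<integral>\<^sup>+x. h x y \<partial>\<mu>) = (\<integral>\<^sup>+x. h (inv y \<otimes> x) y \<partial>\<mu>)"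
      using M.nn_integral_left_mult[of "inv y" "\<lambda>x. h x y"] y by simp
  qed
  also have "\<dots> = (\<integral>\<^sup>+x. \<integral>\<^sup>+y. h (inv y \<otimes> x) y \<partial>\<nu> \<partial>\<mu>)"
    by (rule MN.Fubini') measurable
  also have "\<dots> = (\<integral>\<^sup>+x. \<integral>\<^sup>+y. h (inv (x \<otimes> y) \<otimes> x) (x \<otimes> y) \<partial>\<nu> \<partial>\<mu>)"
  proof (rule nn_integral_cong)
    fix x assume "x \<in> space \<mu>"
    then have x: "x \<in> carrier G" by simp
    then have [measurable]: "x \<in> space ?B" by (simp add: topspace_eq)
    have "(\<lambda>y. h (inv y \<otimes> x) y) \<in> borel_measurable \<nu>" by measurable
    then show "(\<integral>\<^sup>+y. h (inv y \<otimes> x) y \<partial>\<nu>) = (\<integral>\<^sup>+y. h (inv (x \<otimes> y) \<otimes> x) (x \<otimes> y) \<partial>\<nu>)"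
      using N.nn_integral_left_mult[OF x, of "\<lambda>y. h (inv y \<otimes> x) y"] by simp
  qed
  also have "\<dots> = (\<integral>\<^sup>+x. \<integral>\<^sup>+y. indicator W x * (indicator E (inv y) * inverse (D (inv y))) \<partial>\<nu> \<partial>\<mu>)"
  proof (intro nn_integral_cong)
    fix x y assume "x \<in> space \<mu>" "y \<in> space \<nu>"
    then have xy: "x \<in> carrier G" "y \<in> carrier G" by simp_all
    then have "inv (x \<otimes> y) \<otimes> x = inv y" "x \<otimes> y \<otimes> inv y = x"
      by (simp_all add: inv_mult_group m_assoc)
    then show "h (inv (x \<otimes> y) \<otimes> x) (x \<otimes> y)
        = indicator W x * (indicator E (inv y) * inverse (D (inv y)))"
      by (simp add: h_def mult_ac)
  qed
  also have "\<dots> = (\<integral>\<^sup>+x. indicator W x * (\<integral>\<^sup>+y. indicator E (inv y) * inverse (D (inv y)) \<partial>\<nu>) \<partial>\<mu>)"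
    by (intro nn_integral_cong nn_integral_cmult) measurable
  also have "\<dots> = emeasure \<mu> W * (\<integral>\<^sup>+y. indicator E (inv y) * inverse (D (inv y)) \<partial>\<nu>)"
    by (subst nn_integral_multc) (simp_all add: M.sets_haar)
  finally show ?thesis by (simp add: D_def)
qed

text \<open>Both measures are multiples of the same set function \<open>I\<close>, with factors \<open>\<mu>(W)\<close> and \<open>\<nu>(W)\<close>.\<close>

theorem haar_unique:
  assumes \<mu>: "haar_space G T \<mu>" and \<nu>: "haar_space G T \<nu>"
  obtains c :: real where "c > 0" "\<And>E. E \<in> sets (borel_of T) \<Longrightarrow> emeasure \<mu> E = ennreal c * emeasure \<nu> E"
proof -
  interpret M: haar_space G T \<mu> by (rule \<mu>)
  interpret N: haar_space G T \<nu> by (rule \<nu>)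
  obtain W1 where W1: "openin T W1" "W1 \<noteq> {}" "\<And>s. s \<in> carrier G \<Longrightarrow> emeasure \<nu> (W1 #> s) < \<infinity>"
    "emeasure \<nu> W1 < \<infinity>" using N.exists_finite_open by blast
  obtain W where W: "openin T W" "W \<noteq> {}" "emeasure \<mu> W < \<infinity>"
    using M.exists_finite_open by blast
  define I where "I E = (\<integral>\<^sup>+y. indicator E (inv y) * inverse (\<integral>\<^sup>+t. indicator W1 (t \<otimes> inv y) \<partial>\<nu>) \<partial>\<nu>)" for E
  have f1: "emeasure \<mu> E = emeasure \<mu> W1 * I E" if "E \<in> sets (borel_of T)" for E
    unfolding I_def by (rule haar_integral_formula[OF \<mu> \<nu> W1(1,2,3) that])
  have f2: "emeasure \<nu> E = emeasure \<nu> W1 * I E" if "E \<in> sets (borel_of T)" for E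
    unfolding I_def by (rule haar_integral_formula[OF \<nu> \<nu> W1(1,2,3) that])
  have pos: "emeasure \<mu> W1 \<noteq> 0" "emeasure \<nu> W1 \<noteq> 0" "emeasure \<nu> W \<noteq> 0"
    using M.haar_open_pos N.haar_open_pos W W1 by blast+
  have "emeasure \<mu> W1 \<noteq> \<infinity>"
  proof
    assume "emeasure \<mu> W1 = \<infinity>"
    moreover have "I W \<noteq> 0" using f2[OF openin_sets_borel_of[OF W(1)]] pos(3) by auto
    ultimately have "emeasure \<mu> W = \<infinity>"
      using f1[OF openin_sets_borel_of[OF W(1)]] by (simp add: ennreal_top_mult)
    then show False using W(3) by simp
  qed
  then obtain a where a: "a > 0" "emeasure \<mu> W1 = ennreal a"
    using pos(1) by (cases "emeasure \<mu> W1") (auto simp: le_less)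
  obtain b where b: "b > 0" "emeasure \<nu> W1 = ennreal b"
    using pos(2) W1(4) by (cases "emeasure \<nu> W1") (auto simp: le_less)
  show ?thesis
  proof (rule that[of "a / b"])
    fix E assume E: "E \<in> sets (borel_of T)"
    have "ennreal (a / b) * emeasure \<nu> E = (ennreal (a / b) * ennreal b) * I E"
      using f2[OF E] b by (simp add: mult.assoc)
    also have "ennreal (a / b) * ennreal b = ennreal a"
      using a b by (simp add: ennreal_mult[symmetric])
    finally show "emeasure \<mu> E = ennreal (a / b) * emeasure \<nu> E" using f1[OF E] a by simp
  qed (use a b in simp)
qed

end

section \<open>Square integrable coefficients and intertwiners\<close>

locale unitary_rep = second_countable_group G T
  for G :: "('a, 'm) monoid_scheme" (structure) and T :: "'a topology" +
  fixes H :: "'v::ab_group_add hilbert" and \<pi> :: "'a \<Rightarrow> 'v \<Rightarrow> 'v"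
  assumes rep: "unitary_representation G T H \<pi>"
begin

sublocale hs: hilbert_space H
  using rep by (simp add: unitary_representation_def)

lemma unitary: "s \<in> carrier G \<Longrightarrow> unitary_op H (\<pi> s)"
  and rep_mult: "\<lbrakk>s \<in> carrier G; t \<in> carrier G; x \<in> vecs H\<rbrakk> \<Longrightarrow> \<pi> (s \<otimes> t) x = \<pi> s (\<pi> t x)"
  and rep_continuous: "\<lbrakk>x \<in> vecs H; s \<in> carrier G\<rbrakk>
    \<Longrightarrow> ((\<lambda>t. hnorm H (\<pi> t x - \<pi> s x)) \<longlongrightarrow> 0) (atin T s)"
  using rep by (simp_all add: unitary_representation_def)

lemma rep_closed [simp, intro]: "\<lbrakk>s \<in> carrier G; x \<in> vecs H\<rbrakk> \<Longrightarrow> \<pi> s x \<in> vecs H"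
  by (rule hs.unitary_opD(4)[OF unitary])

lemma rep_ip: "\<lbrakk>s \<in> carrier G; x \<in> vecs H; y \<in> vecs H\<rbrakk> \<Longrightarrow> ip H (\<pi> s x) (\<pi> s y) = ip H x y"
  by (rule hs.unitary_opD(2)[OF unitary])

lemma rep_one: "x \<in> vecs H \<Longrightarrow> \<pi> \<one> x = x"
proof -
  assume x: "x \<in> vecs H"
  have "\<pi> \<one> (\<pi> \<one> x) = \<pi> \<one> x" using rep_mult[of \<one> \<one> x] x by simp
  moreover have "inj_on (\<pi> \<one>) (vecs H)"
    using unitary[of \<one>] by (simp add: unitary_op_def bij_betw_def)
  ultimately show ?thesis using x by (simp add: inj_on_eq_iff)
qed

lemma rep_inv: "\<lbrakk>s \<in> carrier G; x \<in> vecs H\<rbrakk> \<Longrightarrow> \<pi> (inv s) (\<pi> s x) = x"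
  using rep_mult[of "inv s" s x] by (simp add: rep_one)

lemma rep_adjoint:
  "\<lbrakk>s \<in> carrier G; x \<in> vecs H; y \<in> vecs H\<rbrakk> \<Longrightarrow> ip H (\<pi> s x) y = ip H x (\<pi> (inv s) y)"
  using rep_ip[of s x "\<pi> (inv s) y"] rep_inv[of "inv s" y] by simp

lemma rep_bounded: "\<pi> ` carrier G \<subseteq> bounded_ops H"
  using hs.unitary_opD(1)[OF unitary] by blast

lemma rep_adjoint_closed:
  "A \<in> \<pi> ` carrier G \<Longrightarrow> \<exists>B\<in>\<pi> ` carrier G. \<forall>x\<in>vecs H. \<forall>y\<in>vecs H. ip H (A x) y = ip H x (B y)"
  using rep_adjoint by (auto intro!: bexI[of _ "\<pi> (inv s)" for s])

lemma coefficient_continuous: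
  assumes "\<xi> \<in> vecs H" "\<eta> \<in> vecs H"
  shows "continuous_map T euclidean (coefficient H \<pi> \<xi> \<eta>)"
  unfolding continuous_map_atin limitin_canonical_iff
proof
  fix s assume "s \<in> topspace T"
  then have s: "s \<in> carrier G" by (simp add: topspace_eq)
  have "((\<lambda>t. coefficient H \<pi> \<xi> \<eta> t - coefficient H \<pi> \<xi> \<eta> s) \<longlongrightarrow> 0) (atin T s)"
  proof (rule Lim_null_comparison)
    have "cmod (coefficient H \<pi> \<xi> \<eta> t - coefficient H \<pi> \<xi> \<eta> s)
        \<le> hnorm H (\<pi> t \<xi> - \<pi> s \<xi>) * hnorm H \<eta>" if "t \<in> topspace T" for t
      using hs.cauchy_schwarz[of "\<pi> t \<xi> - \<pi> s \<xi>" \<eta>] assms s that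
      by (simp add: coefficient_def hs.ip_diff topspace_eq)
    then show "\<forall>\<^sub>F t in atin T s. cmod (coefficient H \<pi> \<xi> \<eta> t - coefficient H \<pi> \<xi> \<eta> s)
        \<le> hnorm H (\<pi> t \<xi> - \<pi> s \<xi>) * hnorm H \<eta>"
      unfolding eventually_atin using s by (metis DiffD1 openin_topspace topspace_eq)
    show "((\<lambda>t. hnorm H (\<pi> t \<xi> - \<pi> s \<xi>) * hnorm H \<eta>) \<longlongrightarrow> 0) (atin T s)"
      using tendsto_mult_right[OF rep_continuous[OF assms(1) s], of "hnorm H \<eta>"] by simp
  qed
  then show "(coefficient H \<pi> \<xi> \<eta> \<longlongrightarrow> coefficient H \<pi> \<xi> \<eta> s) (atin T s)"
    by (simp add: LIM_zero_iff)
qed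

end

locale haar_rep = unitary_rep G T H \<pi> + haar_space G T \<mu>
  for G :: "('a, 'm) monoid_scheme" (structure) and T :: "'a topology"
    and H :: "'v::ab_group_add hilbert" and \<pi> :: "'a \<Rightarrow> 'v \<Rightarrow> 'v" and \<mu> :: "'a measure"
begin

abbreviation "c \<equiv> coefficient H \<pi>"

lemma coefficient_measurable:
  assumes "\<xi> \<in> vecs H" "\<eta> \<in> vecs H"
  shows "c \<xi> \<eta> \<in> borel_measurable \<mu>"
  using borel_measurable_continuous_map[OF coefficient_continuous[OF assms]]
    measurable_cong_sets[OF sets_haar refl] by blast

definition coeff_norm2 :: "'v \<Rightarrow> 'v \<Rightarrow> ennreal" where
  "coeff_norm2 \<xi> \<eta> = (\<integral>\<^sup>+k. ennreal ((cmod (c \<xi> \<eta> k))\<^sup>2) \<partial>\<mu>)"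

definition form_dom :: "'v \<Rightarrow> 'v set" where
  "form_dom \<xi> = {\<eta> \<in> vecs H. integrable \<mu> (\<lambda>k. (cmod (c \<xi> \<eta> k))\<^sup>2)}"

text \<open>The domain of the form with its graph inner product. The coefficient is conjugate linear in the
  second vector, so the conjugation goes to the first factor of the integrand.\<close>

definition form_space :: "'v \<Rightarrow> 'v hilbert" where
  "form_space \<xi> = \<lparr>vecs = form_dom \<xi>, scl = scl H,
     ip = \<lambda>\<eta> \<zeta>. ip H \<eta> \<zeta> + (\<integral>k. cnj (c \<xi> \<eta> k) * c \<xi> \<zeta> k \<partial>\<mu>)\<rparr>"

lemma form_domD [simp]: "\<eta> \<in> form_dom \<xi> \<Longrightarrow> \<eta> \<in> vecs H"
  by (simp add: form_dom_def)

lemma vecs_form_space: "vecs (form_space \<xi>) = form_dom \<xi>"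
  and scl_form_space: "scl (form_space \<xi>) = scl H"
  and ip_form_space: "ip (form_space \<xi>) \<eta> \<zeta> = ip H \<eta> \<zeta> + (\<integral>k. cnj (c \<xi> \<eta> k) * c \<xi> \<zeta> k \<partial>\<mu>)"
  by (simp_all only: form_space_def hilbert.simps)

lemma form_dom_iff:
  assumes "\<xi> \<in> vecs H" "\<eta> \<in> vecs H"
  shows "\<eta> \<in> form_dom \<xi> \<longleftrightarrow> coeff_norm2 \<xi> \<eta> < \<infinity>"
  using assms coefficient_measurable[OF assms]
  by (simp add: form_dom_def coeff_norm2_def integrable_iff_bounded del: form_domD)

lemma coeff_norm2_eq:
  assumes "\<eta> \<in> form_dom \<xi>"
  shows "coeff_norm2 \<xi> \<eta> = ennreal (\<integral>k. (cmod (c \<xi> \<eta> k))\<^sup>2 \<partial>\<mu>)"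
  using assms unfolding coeff_norm2_def form_dom_def by (intro nn_integral_eq_integral) (simp_all del: form_domD)

lemma c_add: "\<lbrakk>k \<in> carrier G; \<xi> \<in> vecs H; \<eta> \<in> vecs H; \<zeta> \<in> vecs H\<rbrakk>
    \<Longrightarrow> c \<xi> (\<eta> + \<zeta>) k = c \<xi> \<eta> k + c \<xi> \<zeta> k"
  and c_scl: "\<lbrakk>k \<in> carrier G; \<xi> \<in> vecs H; \<eta> \<in> vecs H\<rbrakk> \<Longrightarrow> c \<xi> (scl H a \<eta>) k = cnj a * c \<xi> \<eta> k"
  by (simp_all add: coefficient_def hs.ip_add_right hs.ip_diff_right hs.ip_scl_right)

lemma cmod_add_sq_le: "(cmod (a + b))\<^sup>2 \<le> 2 * (cmod a)\<^sup>2 + 2 * (cmod b)\<^sup>2"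
proof -
  have "(cmod (a + b))\<^sup>2 \<le> (cmod a + cmod b)\<^sup>2"
    by (intro power_mono norm_triangle_ineq) simp
  also have "\<dots> \<le> 2 * (cmod a)\<^sup>2 + 2 * (cmod b)\<^sup>2"
    using zero_le_power2[of "cmod a - cmod b"] unfolding power2_sum power2_diff by linarith
  finally show ?thesis .
qed

lemma form_dom_zero:
  assumes \<xi>: "\<xi> \<in> vecs H"
  shows "0 \<in> form_dom \<xi>"
proof -
  have "coeff_norm2 \<xi> 0 = (\<integral>\<^sup>+k. 0 \<partial>\<mu>)"
    unfolding coeff_norm2_def using \<xi> by (intro nn_integral_cong) (simp add: coefficient_def)
  then show ?thesis using form_dom_iff[OF \<xi> hs.zero_closed] by simp
qed

lemma form_dom_add:
  assumes \<xi>: "\<xi> \<in> vecs H" and \<eta>: "\<eta> \<in> form_dom \<xi>" and \<zeta>: "\<zeta> \<in> form_dom \<xi>"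
  shows "\<eta> + \<zeta> \<in> form_dom \<xi>"
proof -
  have "integrable \<mu> (\<lambda>k. (cmod (c \<xi> (\<eta> + \<zeta>) k))\<^sup>2)"
  proof (rule Bochner_Integration.integrable_bound)
    show "integrable \<mu> (\<lambda>k. 2 * (cmod (c \<xi> \<eta> k))\<^sup>2 + 2 * (cmod (c \<xi> \<zeta> k))\<^sup>2)"
      using \<eta> \<zeta> by (simp add: form_dom_def del: form_domD)
    show "(\<lambda>k. (cmod (c \<xi> (\<eta> + \<zeta>) k))\<^sup>2) \<in> borel_measurable \<mu>"
      using coefficient_measurable[of \<xi> "\<eta> + \<zeta>"] assms by simp
    show "AE k in \<mu>. norm ((cmod (c \<xi> (\<eta> + \<zeta>) k))\<^sup>2)
        \<le> norm (2 * (cmod (c \<xi> \<eta> k))\<^sup>2 + 2 * (cmod (c \<xi> \<zeta> k))\<^sup>2)"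
    proof (rule AE_I2)
      fix k assume "k \<in> space \<mu>"
      then show "norm ((cmod (c \<xi> (\<eta> + \<zeta>) k))\<^sup>2)
        \<le> norm (2 * (cmod (c \<xi> \<eta> k))\<^sup>2 + 2 * (cmod (c \<xi> \<zeta> k))\<^sup>2)"
        using cmod_add_sq_le[of "c \<xi> \<eta> k" "c \<xi> \<zeta> k"] assms by (simp add: c_add)
    qed
  qed
  then show ?thesis using form_domD[OF \<eta>] form_domD[OF \<zeta>]
    by (simp add: form_dom_def del: form_domD)
qed

lemma form_dom_scl:
  assumes \<xi>: "\<xi> \<in> vecs H" and \<eta>: "\<eta> \<in> form_dom \<xi>"
  shows "scl H a \<eta> \<in> form_dom \<xi>"
proof -
  have "integrable \<mu> (\<lambda>k. (cmod (c \<xi> (scl H a \<eta>) k))\<^sup>2)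
      \<longleftrightarrow> integrable \<mu> (\<lambda>k. (cmod a)\<^sup>2 * (cmod (c \<xi> \<eta> k))\<^sup>2)"
    using assms by (intro Bochner_Integration.integrable_cong)
      (auto simp: c_scl norm_mult power_mult_distrib)
  then show ?thesis using \<eta> by (simp add: form_dom_def del: form_domD)
qed

lemma form_dom_diff:
  assumes "\<xi> \<in> vecs H" "\<eta> \<in> form_dom \<xi>" "\<zeta> \<in> form_dom \<xi>"
  shows "\<eta> - \<zeta> \<in> form_dom \<xi>"
  using form_dom_add[OF assms(1,2) form_dom_scl[OF assms(1,3), of "-1"]] assms by simp

lemma form_integrable:
  assumes \<xi>: "\<xi> \<in> vecs H" and \<eta>: "\<eta> \<in> form_dom \<xi>" and \<zeta>: "\<zeta> \<in> form_dom \<xi>"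
  shows "integrable \<mu> (\<lambda>k. cnj (c \<xi> \<eta> k) * c \<xi> \<zeta> k)"
proof (rule Bochner_Integration.integrable_bound)
  show "integrable \<mu> (\<lambda>k. (cmod (c \<xi> \<eta> k))\<^sup>2 + (cmod (c \<xi> \<zeta> k))\<^sup>2)"
    using \<eta> \<zeta> by (simp add: form_dom_def del: form_domD)
  have [measurable]: "c \<xi> \<eta> \<in> borel_measurable \<mu>" "c \<xi> \<zeta> \<in> borel_measurable \<mu>"
    using assms by (auto intro: coefficient_measurable)
  have "(\<lambda>k. cnj (c \<xi> \<eta> k)) \<in> borel_measurable \<mu>"
    by (rule borel_measurable_continuous_on[OF continuous_on_cnj[OF continuous_on_id]]) measurable
  then show "(\<lambda>k. cnj (c \<xi> \<eta> k) * c \<xi> \<zeta> k) \<in> borel_measurable \<mu>" by measurable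
  show "AE k in \<mu>. norm (cnj (c \<xi> \<eta> k) * c \<xi> \<zeta> k)
      \<le> norm ((cmod (c \<xi> \<eta> k))\<^sup>2 + (cmod (c \<xi> \<zeta> k))\<^sup>2)"
  proof (rule AE_I2)
    fix k
    have "0 \<le> cmod (c \<xi> \<eta> k) * cmod (c \<xi> \<zeta> k)" by simp
    then have "cmod (c \<xi> \<eta> k) * cmod (c \<xi> \<zeta> k) \<le> (cmod (c \<xi> \<eta> k))\<^sup>2 + (cmod (c \<xi> \<zeta> k))\<^sup>2"
      using sum_squares_bound[of "cmod (c \<xi> \<eta> k)" "cmod (c \<xi> \<zeta> k)"] unfolding mult.assoc
      by linarith
    then show "norm (cnj (c \<xi> \<eta> k) * c \<xi> \<zeta> k)
      \<le> norm ((cmod (c \<xi> \<eta> k))\<^sup>2 + (cmod (c \<xi> \<zeta> k))\<^sup>2)" by (simp add: norm_mult)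
  qed
qed

lemma ip_self_form_space:
  assumes "\<eta> \<in> form_dom \<xi>"
  shows "ip (form_space \<xi>) \<eta> \<eta>
    = of_real ((hnorm H \<eta>)\<^sup>2 + (\<integral>k. (cmod (c \<xi> \<eta> k))\<^sup>2 \<partial>\<mu>))"
proof -
  have "(\<integral>k. cnj (c \<xi> \<eta> k) * c \<xi> \<eta> k \<partial>\<mu>) = (\<integral>k. complex_of_real ((cmod (c \<xi> \<eta> k))\<^sup>2) \<partial>\<mu>)"
    by (simp add: complex_norm_square mult.commute del: of_real_power)
  then show ?thesis using assms by (simp add: ip_form_space hs.ip_self del: of_real_power)
qed

lemma hnorm_form_space_sq:
  assumes "\<eta> \<in> form_dom \<xi>"
  shows "(hnorm (form_space \<xi>) \<eta>)\<^sup>2 = (hnorm H \<eta>)\<^sup>2 + (\<integral>k. (cmod (c \<xi> \<eta> k))\<^sup>2 \<partial>\<mu>)"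
  unfolding hnorm_def[of "form_space \<xi>"] ip_self_form_space[OF assms] by simp

lemma hnorm_form_space_nonneg: "\<eta> \<in> form_dom \<xi> \<Longrightarrow> 0 \<le> hnorm (form_space \<xi>) \<eta>"
  by (simp add: hnorm_def[of "form_space \<xi>"] ip_self_form_space)

lemma hnorm_le_form_space:
  assumes "\<eta> \<in> form_dom \<xi>"
  shows "hnorm H \<eta> \<le> hnorm (form_space \<xi>) \<eta>"
  by (rule power2_le_imp_le)
    (simp_all add: hnorm_form_space_sq[OF assms] hnorm_form_space_nonneg[OF assms])

text \<open>The form \<open>\<eta> \<mapsto> \<integral>|\<langle>\<pi>(k)\<xi>, \<eta>\<rangle>|\<^sup>2 dk\<close> is closed: convergence in \<open>H\<close> makes the coefficients
  converge pointwise, and Fatou's lemma passes to the limit.\<close>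

lemma form_space_complete:
  assumes \<xi>: "\<xi> \<in> vecs H"
    and X: "\<And>n. X n \<in> form_dom \<xi>"
    and cauchy: "\<And>e. e > 0 \<Longrightarrow> \<exists>N. \<forall>m\<ge>N. \<forall>n\<ge>N. hnorm (form_space \<xi>) (X m - X n) < e"
  shows "\<exists>x\<in>form_dom \<xi>. (\<lambda>n. hnorm (form_space \<xi>) (X n - x)) \<longlonglongrightarrow> 0"
proof -
  note diff = form_dom_diff[OF \<xi>]
  have XV: "X n \<in> vecs H" for n using form_domD[OF X] .
  have "\<exists>x\<in>vecs H. (\<lambda>n. hnorm H (X n - x)) \<longlonglongrightarrow> 0"
  proof (rule hs.complete[OF XV])
    fix e :: real assume "e > 0"
    then obtain N where "\<And>m n. \<lbrakk>m \<ge> N; n \<ge> N\<rbrakk> \<Longrightarrow> hnorm (form_space \<xi>) (X m - X n) < e"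
      using cauchy by blast
    then show "\<exists>N. \<forall>m\<ge>N. \<forall>n\<ge>N. hnorm H (X m - X n) < e"
      using hnorm_le_form_space[OF diff[OF X X]] by (meson le_less_trans)
  qed
  then obtain x where x: "x \<in> vecs H" and lim: "(\<lambda>n. hnorm H (X n - x)) \<longlonglongrightarrow> 0" by blast
  have near: "\<exists>N. \<forall>n\<ge>N. coeff_norm2 \<xi> (X n - x) \<le> ennreal (e\<^sup>2)" if e: "e > 0" for e :: real
  proof -
    obtain N where N: "\<And>m n. \<lbrakk>m \<ge> N; n \<ge> N\<rbrakk> \<Longrightarrow> hnorm (form_space \<xi>) (X m - X n) < e"
      using cauchy[OF e] by blast
    have "coeff_norm2 \<xi> (X n - x) \<le> ennreal (e\<^sup>2)" if n: "n \<ge> N" for n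
    proof -
      let ?u = "\<lambda>m k. ennreal ((cmod (c \<xi> (X n - X m) k))\<^sup>2)"
      have "(\<lambda>m. ?u m k) \<longlonglongrightarrow> ennreal ((cmod (c \<xi> (X n - x) k))\<^sup>2)" if k: "k \<in> carrier G" for k
      proof -
        have *: "c \<xi> y k = cnj (ip H y (\<pi> k \<xi>))" if "y \<in> vecs H" for y
          using hs.ip_commute[OF that rep_closed[OF k \<xi>]] by (simp add: coefficient_def)
        have "(\<lambda>m. ip H (X n - X m) (\<pi> k \<xi>)) \<longlonglongrightarrow> ip H (X n - x) (\<pi> k \<xi>)"
        proof (rule hs.ip_tendsto)
          show "(\<lambda>m. hnorm H (X n - X m - (X n - x))) \<longlonglongrightarrow> 0"
            using lim hs.hnorm_minus_commute[OF XV x] by simp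
        qed (use XV x k \<xi> in auto)
        then show ?thesis
          using XV x by (subst (1 2) *) (auto intro!: tendsto_intros)
      qed
      then have "coeff_norm2 \<xi> (X n - x) = (\<integral>\<^sup>+k. liminf (\<lambda>m. ?u m k) \<partial>\<mu>)"
        unfolding coeff_norm2_def
        by (intro nn_integral_cong lim_imp_Liminf[symmetric]) simp_all
      also have "\<dots> \<le> liminf (\<lambda>m. \<integral>\<^sup>+k. ?u m k \<partial>\<mu>)"
      proof (rule nn_integral_liminf)
        show "?u m \<in> borel_measurable \<mu>" for m
          using coefficient_measurable[of \<xi> "X n - X m"] \<xi> XV by simp
      qed
      also have "\<dots> \<le> limsup (\<lambda>m. \<integral>\<^sup>+k. ?u m k \<partial>\<mu>)"
        by (rule Liminf_le_Limsup) simp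
      also have "\<dots> \<le> ennreal (e\<^sup>2)"
      proof (rule Limsup_bounded, rule eventually_sequentiallyI)
        fix m assume m: "N \<le> m"
        have "(\<integral>k. (cmod (c \<xi> (X n - X m) k))\<^sup>2 \<partial>\<mu>) \<le> (hnorm (form_space \<xi>) (X n - X m))\<^sup>2"
          by (simp add: hnorm_form_space_sq[OF diff[OF X X]])
        also have "\<dots> \<le> e\<^sup>2"
          using N[OF n m] hnorm_form_space_nonneg[OF diff[OF X X], of n m] by (intro power_mono) auto
        finally show "(\<integral>\<^sup>+k. ?u m k \<partial>\<mu>) \<le> ennreal (e\<^sup>2)"
          using coeff_norm2_eq[OF diff[OF X X], of n m] by (simp add: coeff_norm2_def ennreal_leI)
      qed
      finally show ?thesis .
    qed
    then show ?thesis by blast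
  qed
  obtain N where N: "\<And>n. n \<ge> N \<Longrightarrow> coeff_norm2 \<xi> (X n - x) \<le> ennreal (1\<^sup>2)" using near[of 1] by auto
  have dX: "X n - x \<in> vecs H" for n using XV x by simp
  have "X N - x \<in> form_dom \<xi>"
    using le_less_trans[OF N[OF order_refl] ennreal_less_top] by (simp add: form_dom_iff[OF \<xi> dX])
  then have "X N - (X N - x) \<in> form_dom \<xi>" by (rule diff[OF X])
  then have xD: "x \<in> form_dom \<xi>" by simp
  define q where "q n = (\<integral>k. (cmod (c \<xi> (X n - x) k))\<^sup>2 \<partial>\<mu>)" for n
  have q0: "q n \<ge> 0" for n by (simp add: q_def)
  have "q \<longlonglongrightarrow> 0"
  proof (rule LIMSEQ_I)
    fix r :: real assume r: "r > 0"
    then obtain N where N: "\<And>n. n \<ge> N \<Longrightarrow> coeff_norm2 \<xi> (X n - x) \<le> ennreal ((sqrt (r / 2))\<^sup>2)"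
      using near[of "sqrt (r / 2)"] by auto
    have "q n < r" if "n \<ge> N" for n
    proof -
      have "ennreal (q n) \<le> ennreal (r / 2)"
        using N[OF that] r coeff_norm2_eq[OF diff[OF X xD]] by (simp add: q_def)
      then show ?thesis using r by simp
    qed
    then show "\<exists>N. \<forall>n\<ge>N. norm (q n - 0) < r" using q0 by auto
  qed
  then have "(\<lambda>n. sqrt ((hnorm H (X n - x))\<^sup>2 + q n)) \<longlonglongrightarrow> sqrt (0\<^sup>2 + 0)"
    by (intro tendsto_intros lim)
  moreover have "hnorm (form_space \<xi>) (X n - x) = sqrt ((hnorm H (X n - x))\<^sup>2 + q n)" for n
    using hnorm_form_space_sq[OF diff[OF X xD], of n] hnorm_form_space_nonneg[OF diff[OF X xD], of n]
    unfolding q_def by (metis real_sqrt_unique)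
  ultimately show ?thesis using xD by (intro bexI[of _ x]) simp_all
qed

lemma hilbert_space_form_space:
  assumes \<xi>: "\<xi> \<in> vecs H"
  shows "hilbert_space (form_space \<xi>)"
proof (unfold_locales, unfold vecs_form_space scl_form_space)
  have m: "module (scl H)"
    by (simp only: module_iff_vector_space hs.vector_space)
  show "module.subspace (scl H) (form_dom \<xi>)"
    unfolding module.subspace_def[OF m]
    using form_dom_add[OF \<xi>] form_dom_scl[OF \<xi>] form_dom_zero[OF \<xi>] by blast
next
  fix x y z assume *: "x \<in> form_dom \<xi>" "y \<in> form_dom \<xi>" "z \<in> form_dom \<xi>"
  have "(\<integral>k. cnj (c \<xi> (x + y) k) * c \<xi> z k \<partial>\<mu>)
      = (\<integral>k. cnj (c \<xi> x k) * c \<xi> z k + cnj (c \<xi> y k) * c \<xi> z k \<partial>\<mu>)"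
    using * \<xi> by (intro Bochner_Integration.integral_cong) (auto simp: c_add algebra_simps)
  then show "ip (form_space \<xi>) (x + y) z = ip (form_space \<xi>) x z + ip (form_space \<xi>) y z"
    using * by (simp add: ip_form_space hs.ip_add form_integrable[OF \<xi>])
next
  fix x y a assume *: "x \<in> form_dom \<xi>" "y \<in> form_dom \<xi>"
  have "(\<integral>k. cnj (c \<xi> (scl H a x) k) * c \<xi> y k \<partial>\<mu>)
      = (\<integral>k. a * (cnj (c \<xi> x k) * c \<xi> y k) \<partial>\<mu>)"
    using * \<xi> by (intro Bochner_Integration.integral_cong) (auto simp: c_scl)
  then show "ip (form_space \<xi>) (scl H a x) y = a * ip (form_space \<xi>) x y"
    using * by (simp add: ip_form_space hs.ip_scl algebra_simps)
  have "cnj (\<integral>k. cnj (c \<xi> x k) * c \<xi> y k \<partial>\<mu>) = (\<integral>k. cnj (cnj (c \<xi> x k) * c \<xi> y k) \<partial>\<mu>)"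
    by (rule Bochner_Integration.integral_cnj[symmetric])
  then have "(\<integral>k. cnj (c \<xi> y k) * c \<xi> x k \<partial>\<mu>) = cnj (\<integral>k. cnj (c \<xi> x k) * c \<xi> y k \<partial>\<mu>)"
    by (simp add: mult.commute)
  then show "ip (form_space \<xi>) y x = cnj (ip (form_space \<xi>) x y)"
    using * hs.ip_commute[of x y] by (simp add: ip_form_space)
next
  fix x assume x: "x \<in> form_dom \<xi>"
  have nn: "0 \<le> (\<integral>k. (cmod (c \<xi> x k))\<^sup>2 \<partial>\<mu>)" by simp
  show "0 \<le> Re (ip (form_space \<xi>) x x)"
    unfolding ip_self_form_space[OF x] using nn by simp
  assume "ip (form_space \<xi>) x x = 0"
  then have "hnorm (form_space \<xi>) x = 0" by (simp add: hnorm_def)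
  then have "hnorm H x = 0"
    using hnorm_le_form_space[OF x] hs.hnorm_nonneg[OF form_domD[OF x]] by linarith
  then show "x = 0" using hs.hnorm_eq_0 x by simp
qed (auto intro: form_space_complete[OF \<xi>] hs.vs.scale_right_distrib hs.vs.scale_left_distrib)

text \<open>On the closure of the form domain \<open>R\<close> is the inverse of \<open>1 + Q\<close>, where \<open>Q\<close> is the positive
  operator that belongs to the form; on the orthogonal complement \<open>R\<close> vanishes. It comes from the Riesz representation on the form space, and it commutes with \<open>\<pi>(G)\<close> because the
  form is invariant.\<close>

lemma resolvent:
  assumes \<xi>: "\<xi> \<in> vecs H"
  obtains R where "R \<in> commutant H (\<pi> ` carrier G)"
    "\<And>\<eta>. \<eta> \<in> vecs H \<Longrightarrow> R \<eta> \<in> form_dom \<xi>"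
    "\<And>\<zeta> \<eta>. \<lbrakk>\<zeta> \<in> form_dom \<xi>; \<eta> \<in> vecs H\<rbrakk> \<Longrightarrow> ip H \<zeta> \<eta> = ip (form_space \<xi>) \<zeta> (R \<eta>)"
proof -
  interpret D: hilbert_space "form_space \<xi>" by (rule hilbert_space_form_space[OF \<xi>])
  note [simp] = vecs_form_space scl_form_space
  have dom_rep: "\<pi> s \<zeta> \<in> form_dom \<xi>" "c \<xi> (\<pi> s \<zeta>) k = c \<xi> \<zeta> (inv s \<otimes> k)"
    if s: "s \<in> carrier G" and \<zeta>: "\<zeta> \<in> form_dom \<xi>" and k: "k \<in> carrier G" for s \<zeta> k
  proof -
    have eq: "c \<xi> (\<pi> s \<zeta>) k = c \<xi> \<zeta> (inv s \<otimes> k)" if k: "k \<in> carrier G" for k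
      using rep_adjoint[of "inv s" "\<pi> k \<xi>" \<zeta>] s k \<xi> \<zeta> by (simp add: coefficient_def rep_mult)
    have "coeff_norm2 \<xi> (\<pi> s \<zeta>) = (\<integral>\<^sup>+k. ennreal ((cmod (c \<xi> \<zeta> (inv s \<otimes> k)))\<^sup>2) \<partial>\<mu>)"
      unfolding coeff_norm2_def by (intro nn_integral_cong) (simp add: eq)
    also have "\<dots> = coeff_norm2 \<xi> \<zeta>"
      unfolding coeff_norm2_def
      using s coefficient_measurable[OF \<xi> form_domD[OF \<zeta>]]
      by (intro nn_integral_left_mult[where f = "\<lambda>k. ennreal ((cmod (c \<xi> \<zeta> k))\<^sup>2)"]) auto
    finally show "\<pi> s \<zeta> \<in> form_dom \<xi>"
      using form_dom_iff[OF \<xi> form_domD[OF \<zeta>]] form_dom_iff[OF \<xi>, of "\<pi> s \<zeta>"] \<zeta> s by simp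
    show "c \<xi> (\<pi> s \<zeta>) k = c \<xi> \<zeta> (inv s \<otimes> k)" using eq k .
  qed
  have ip_rep: "ip (form_space \<xi>) (\<pi> s \<zeta>) (\<pi> s \<eta>) = ip (form_space \<xi>) \<zeta> \<eta>"
    if s: "s \<in> carrier G" and \<zeta>: "\<zeta> \<in> form_dom \<xi>" and \<eta>: "\<eta> \<in> form_dom \<xi>" for s \<zeta> \<eta>
  proof -
    let ?f = "\<lambda>k. cnj (c \<xi> \<zeta> k) * c \<xi> \<eta> k"
    have "(\<integral>k. cnj (c \<xi> (\<pi> s \<zeta>) k) * c \<xi> (\<pi> s \<eta>) k \<partial>\<mu>) = (\<integral>k. ?f (inv s \<otimes> k) \<partial>\<mu>)"
      using dom_rep(2)[OF s \<zeta>] dom_rep(2)[OF s \<eta>]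
      by (intro Bochner_Integration.integral_cong) auto
    also have "\<dots> = (\<integral>k. ?f k \<partial>distr \<mu> \<mu> (\<lambda>k. inv s \<otimes> k))"
      using s form_integrable[OF \<xi> \<zeta> \<eta>]
      by (intro integral_distr[symmetric] left_mult_measurable) auto
    finally show ?thesis using s \<zeta> \<eta> by (simp add: ip_form_space rep_ip distr_left_mult)
  qed
  have "\<exists>z\<in>form_dom \<xi>. \<forall>\<zeta>\<in>form_dom \<xi>. ip H \<zeta> \<eta> = ip (form_space \<xi>) \<zeta> z"
    if \<eta>: "\<eta> \<in> vecs H" for \<eta>
  proof -
    obtain z where "z \<in> vecs (form_space \<xi>)" "\<And>\<zeta>. \<zeta> \<in> form_dom \<xi> \<Longrightarrow> ip H \<zeta> \<eta> = ip (form_space \<xi>) \<zeta> z"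
    proof (rule D.riesz_representation[where W = "form_dom \<xi>" and \<phi> = "\<lambda>\<zeta>. ip H \<zeta> \<eta>" and B = "hnorm H \<eta>"])
      fix z assume "z \<in> vecs (form_space \<xi>)" "\<And>x. x \<in> form_dom \<xi> \<Longrightarrow> ip H x \<eta> = ip (form_space \<xi>) x z"
      then show thesis by (rule that)
    next
      fix x assume x: "x \<in> form_dom \<xi>"
      have "cmod (ip H x \<eta>) \<le> hnorm H x * hnorm H \<eta>" using x \<eta> by (simp add: hs.cauchy_schwarz)
      also have "\<dots> \<le> hnorm (form_space \<xi>) x * hnorm H \<eta>"
        using hnorm_le_form_space[OF x] \<eta> by (simp add: mult_right_mono)
      finally show "cmod (ip H x \<eta>) \<le> hnorm H \<eta> * hnorm (form_space \<xi>) x" by (simp add: mult.commute)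
    qed (use \<eta> D.zero_closed in \<open>auto simp: hs.ip_add hs.ip_scl intro: form_dom_add[OF \<xi>] form_dom_scl[OF \<xi>]\<close>)
    then show ?thesis by auto
  qed
  then obtain R where R: "\<And>\<eta>. \<eta> \<in> vecs H \<Longrightarrow> R \<eta> \<in> form_dom \<xi>"
    and ip_R: "\<And>\<zeta> \<eta>. \<lbrakk>\<zeta> \<in> form_dom \<xi>; \<eta> \<in> vecs H\<rbrakk> \<Longrightarrow> ip H \<zeta> \<eta> = ip (form_space \<xi>) \<zeta> (R \<eta>)"
    by metis
  have "R \<in> bounded_ops H"
  proof (rule hs.bounded_opsI[of _ 1])
    fix x y assume xy: "x \<in> vecs H" "y \<in> vecs H"
    show "R (x + y) = R x + R y"
      by (rule D.eq_by_ip)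
        (use xy R form_dom_add[OF \<xi>] in \<open>auto simp: hs.ip_add_right D.ip_add_right ip_R[symmetric]\<close>)
  next
    fix a x assume x: "x \<in> vecs H"
    show "R (scl H a x) = scl H a (R x)"
    proof (rule D.eq_by_ip)
      fix z assume z: "z \<in> vecs (form_space \<xi>)"
      have "ip (form_space \<xi>) z (scl H a (R x)) = cnj a * ip (form_space \<xi>) z (R x)"
        using D.ip_scl_right[of z "R x" a] z x R by simp
      then show "ip (form_space \<xi>) z (R (scl H a x)) = ip (form_space \<xi>) z (scl H a (R x))"
        using z x by (simp add: ip_R[symmetric] hs.ip_scl_right)
    qed (use x R form_dom_scl[OF \<xi>] in auto)
  next
    fix x assume x: "x \<in> vecs H"
    have "(hnorm H (R x))\<^sup>2 \<le> (hnorm (form_space \<xi>) (R x))\<^sup>2"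
      using hnorm_le_form_space[OF R[OF x]] R[OF x] by (intro power_mono) auto
    also have "\<dots> = Re (ip H (R x) x)"
      using ip_R[OF R[OF x] x] D.hnorm_sq[of "R x"] R[OF x] by simp
    also have "\<dots> \<le> hnorm H (R x) * hnorm H x"
      using hs.cauchy_schwarz[of "R x" x] complex_Re_le_cmod[of "ip H (R x) x"] x R[OF x] by simp
    finally have "hnorm H (R x) * hnorm H (R x) \<le> hnorm H x * hnorm H (R x)"
      by (simp add: power2_eq_square mult.commute)
    then show "hnorm H (R x) \<le> 1 * hnorm H x"
      using hs.hnorm_nonneg[OF form_domD[OF R[OF x]]] hs.hnorm_nonneg[OF x]
      by (cases "hnorm H (R x) = 0") (auto dest: mult_right_le_imp_le)
  qed (rule form_domD[OF R])
  moreover have "R (\<pi> s x) = \<pi> s (R x)" if s: "s \<in> carrier G" and x: "x \<in> vecs H" for s x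
  proof (rule D.eq_by_ip)
    note Rx = R[OF x]
    show "R (\<pi> s x) \<in> vecs (form_space \<xi>)" "\<pi> s (R x) \<in> vecs (form_space \<xi>)"
      using s x R dom_rep(1)[OF s Rx one_closed] by auto
    fix z assume "z \<in> vecs (form_space \<xi>)"
    then have z: "z \<in> form_dom \<xi>" by simp
    have si: "inv s \<in> carrier G" using s by simp
    have zs: "\<pi> (inv s) z \<in> form_dom \<xi>" by (rule dom_rep(1)[OF si z one_closed])
    have "ip (form_space \<xi>) z (R (\<pi> s x)) = ip H z (\<pi> s x)"
      using ip_R[OF z] s x by simp
    also have "\<dots> = ip H (\<pi> (inv s) z) x"
      using rep_adjoint[OF si form_domD[OF z] x] s by simp
    also have "\<dots> = ip (form_space \<xi>) (\<pi> (inv s) z) (R x)" by (rule ip_R[OF zs x])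
    also have "\<dots> = ip (form_space \<xi>) (\<pi> s (\<pi> (inv s) z)) (\<pi> s (R x))"
      by (rule ip_rep[OF s zs Rx, symmetric])
    also have "\<pi> s (\<pi> (inv s) z) = z" using rep_inv[OF si form_domD[OF z]] s by simp
    finally show "ip (form_space \<xi>) z (R (\<pi> s x)) = ip (form_space \<xi>) z (\<pi> s (R x))" .
  qed
  ultimately have "R \<in> commutant H (\<pi> ` carrier G)" by (auto simp: commutant_def)
  then show ?thesis using that R ip_R by blast
qed

text \<open>Membership in the form domain and the value of the form are encoded by the resolvent
  \<open>R\<close>: \<open>\<parallel>\<eta>\<parallel>\<^sup>2 + q(\<eta>) \<le> C\<close> holds iff \<open>|\<langle>\<eta>, \<zeta>\<rangle>|\<^sup>2 \<le> C \<langle>R\<zeta>, \<zeta>\<rangle>\<close> for all \<open>\<zeta>\<close>. As \<open>R\<close> lies in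
  \<open>\<pi>(G)'\<close>, the right hand side is compatible with operators of \<open>\<pi>(G)''\<close>.\<close>

lemma coeff_norm2_le:
  assumes x: "x \<in> commutant H (commutant H (\<pi> ` carrier G))"
    and a: "a > 0"
    and ip_x: "\<And>\<eta> \<zeta>. \<lbrakk>\<eta> \<in> vecs H; \<zeta> \<in> vecs H\<rbrakk> \<Longrightarrow> ip H (x \<eta>) (x \<zeta>) = of_real a * ip H \<eta> \<zeta>"
    and surj: "\<And>\<zeta>. \<zeta> \<in> vecs H \<Longrightarrow> \<exists>\<zeta>'\<in>vecs H. x \<zeta>' = \<zeta>"
    and \<xi>: "\<xi> \<in> vecs H" and \<eta>: "\<eta> \<in> vecs H"
  shows "coeff_norm2 \<xi> (x \<eta>) \<le> ennreal a * coeff_norm2 \<xi> \<eta>"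
proof (cases "\<eta> \<in> form_dom \<xi>")
  case False
  then have "coeff_norm2 \<xi> \<eta> = \<infinity>" using form_dom_iff[OF \<xi> \<eta>] by (simp add: not_less top_unique)
  then show ?thesis using a by (simp add: ennreal_mult_top)
next
  case \<eta>D: True
  interpret D: hilbert_space "form_space \<xi>" by (rule hilbert_space_form_space[OF \<xi>])
  note [simp] = vecs_form_space scl_form_space
  note xb = hs.commutantD(1)[OF x]
  note x_closed = hs.bounded_opsD(1)[OF xb]
  obtain R where R: "R \<in> commutant H (\<pi> ` carrier G)"
    and R_dom: "\<And>\<eta>. \<eta> \<in> vecs H \<Longrightarrow> R \<eta> \<in> form_dom \<xi>"
    and ip_R: "\<And>\<zeta> \<eta>. \<lbrakk>\<zeta> \<in> form_dom \<xi>; \<eta> \<in> vecs H\<rbrakk> \<Longrightarrow> ip H \<zeta> \<eta> = ip (form_space \<xi>) \<zeta> (R \<eta>)"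
    using resolvent[OF \<xi>] by blast
  note Rb = hs.bounded_opsD[OF hs.commutantD(1)[OF R]]
  define C where "C = (hnorm (form_space \<xi>) \<eta>)\<^sup>2"
  have C: "C \<ge> 0" by (simp add: C_def)
  have R_norm: "(hnorm (form_space \<xi>) (R \<zeta>))\<^sup>2 = Re (ip H (R \<zeta>) \<zeta>)" if "\<zeta> \<in> vecs H" for \<zeta>
    using ip_R[OF R_dom[OF that] that] D.hnorm_sq[of "R \<zeta>"] R_dom[OF that] by simp
  have bound: "cmod (ip H \<zeta> (x \<eta>)) \<le> sqrt (a * C) * hnorm (form_space \<xi>) (R \<zeta>)"
    if \<zeta>: "\<zeta> \<in> vecs H" for \<zeta>
  proof -
    obtain \<zeta>' where \<zeta>': "\<zeta>' \<in> vecs H" "x \<zeta>' = \<zeta>" using surj[OF \<zeta>] by blast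
    have "ip H (R \<zeta>) \<zeta> = ip H (x (R \<zeta>')) (x \<zeta>')"
      using hs.commutantD(2)[OF x R \<zeta>'(1)] \<zeta>'(2) by simp
    then have "ip H (R \<zeta>) \<zeta> = of_real a * ip H (R \<zeta>') \<zeta>'" using ip_x[of "R \<zeta>'" \<zeta>'] \<zeta>' Rb(1) by simp
    then have "(hnorm (form_space \<xi>) (R \<zeta>))\<^sup>2 = a * (hnorm (form_space \<xi>) (R \<zeta>'))\<^sup>2"
      using R_norm \<zeta> \<zeta>'(1) by simp
    then have n: "hnorm (form_space \<xi>) (R \<zeta>) = sqrt a * hnorm (form_space \<xi>) (R \<zeta>')"
      using hnorm_form_space_nonneg[OF R_dom[OF \<zeta>]] hnorm_form_space_nonneg[OF R_dom[OF \<zeta>'(1)]]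
      by (metis real_sqrt_abs real_sqrt_mult abs_of_nonneg)
    have "cmod (ip H \<zeta> (x \<eta>)) = a * cmod (ip H \<zeta>' \<eta>)"
      using ip_x[OF \<zeta>'(1) \<eta>] \<zeta>'(2) a by (simp add: norm_mult)
    also have "cmod (ip H \<zeta>' \<eta>) = cmod (ip H \<eta> \<zeta>')"
      using hs.ip_commute[OF \<zeta>'(1) \<eta>] by simp
    also have "\<dots> = cmod (ip (form_space \<xi>) \<eta> (R \<zeta>'))" using ip_R[OF \<eta>D \<zeta>'(1)] by simp
    also have "\<dots> \<le> hnorm (form_space \<xi>) \<eta> * hnorm (form_space \<xi>) (R \<zeta>')"
      using D.cauchy_schwarz[of \<eta> "R \<zeta>'"] \<eta>D R_dom[OF \<zeta>'(1)] by simp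
    also have "hnorm (form_space \<xi>) \<eta> = sqrt C"
      using hnorm_form_space_nonneg[OF \<eta>D] by (simp add: C_def)
    finally have "cmod (ip H \<zeta> (x \<eta>)) \<le> a * (sqrt C * hnorm (form_space \<xi>) (R \<zeta>'))"
      using a by simp
    also have "\<dots> = sqrt (a * C) * hnorm (form_space \<xi>) (R \<zeta>)"
      using a by (simp add: n real_sqrt_mult)
    finally show ?thesis .
  qed
  have x\<eta>: "x \<eta> \<in> vecs H" using x_closed \<eta> by simp
  \<comment> \<open>The functional \<open>R\<zeta> \<mapsto> \<langle>\<zeta>, x\<eta>\<rangle>\<close> on the range of \<open>R\<close>; the bound makes it well defined. The form
    space vector that represents it is \<open>x\<eta>\<close>.\<close>
  define \<phi> where "\<phi> w = ip H (SOME \<zeta>. \<zeta> \<in> vecs H \<and> R \<zeta> = w) (x \<eta>)" for w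
  have \<phi>: "\<phi> (R \<zeta>) = ip H \<zeta> (x \<eta>)" if \<zeta>: "\<zeta> \<in> vecs H" for \<zeta>
  proof -
    define \<zeta>' where "\<zeta>' = (SOME \<zeta>'. \<zeta>' \<in> vecs H \<and> R \<zeta>' = R \<zeta>)"
    have "\<zeta>' \<in> vecs H \<and> R \<zeta>' = R \<zeta>"
      unfolding \<zeta>'_def by (rule someI[of _ \<zeta>]) (simp add: \<zeta>)
    then have \<zeta>': "\<zeta>' \<in> vecs H" "R (\<zeta>' - \<zeta>) = 0" using Rb(4) \<zeta> by simp_all
    then have "cmod (ip H (\<zeta>' - \<zeta>) (x \<eta>)) \<le> 0" using bound[of "\<zeta>' - \<zeta>"] \<zeta> by simp
    then show ?thesis using \<zeta> \<zeta>' x\<eta> by (simp add: \<phi>_def \<zeta>'_def[symmetric] hs.ip_diff)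
  qed
  obtain z where z: "z \<in> form_dom \<xi>" "\<And>w. w \<in> R ` vecs H \<Longrightarrow> \<phi> w = ip (form_space \<xi>) w z"
    "hnorm (form_space \<xi>) z \<le> max (sqrt (a * C)) 0"
  proof (rule D.riesz_representation[where W = "R ` vecs H" and \<phi> = \<phi> and B = "sqrt (a * C)"])
    show "0 \<in> R ` vecs H" using Rb(5) by (metis hs.zero_closed imageI)
    show "u + w \<in> R ` vecs H" "\<phi> (u + w) = \<phi> u + \<phi> w"
      if "u \<in> R ` vecs H" "w \<in> R ` vecs H" for u w
    proof -
      obtain u' w' where uw: "u' \<in> vecs H" "u = R u'" "w' \<in> vecs H" "w = R w'" using \<open>u \<in> R ` vecs H\<close> \<open>w \<in> R ` vecs H\<close> by blast
      then have e: "u + w = R (u' + w')" by (simp add: Rb(2))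
      show "u + w \<in> R ` vecs H" unfolding e using uw by blast
      show "\<phi> (u + w) = \<phi> u + \<phi> w"
        unfolding e using uw x\<eta> by (simp add: \<phi> hs.ip_add)
    qed
    show "scl (form_space \<xi>) b u \<in> R ` vecs H" "\<phi> (scl (form_space \<xi>) b u) = b * \<phi> u"
      if "u \<in> R ` vecs H" for b u
    proof -
      obtain u' where u: "u' \<in> vecs H" "u = R u'" using \<open>u \<in> R ` vecs H\<close> by blast
      then have e: "scl (form_space \<xi>) b u = R (scl H b u')" by (simp add: Rb(3))
      show "scl (form_space \<xi>) b u \<in> R ` vecs H" unfolding e using u by blast
      show "\<phi> (scl (form_space \<xi>) b u) = b * \<phi> u"
        unfolding e using u x\<eta> by (simp add: \<phi> hs.ip_scl)
    qed
    show "cmod (\<phi> u) \<le> sqrt (a * C) * hnorm (form_space \<xi>) u" if "u \<in> R ` vecs H" for u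
      using that bound by (auto simp: \<phi>)
  qed (use R_dom that in auto)
  have "z = x \<eta>"
  proof (rule hs.eq_by_ip)
    fix \<zeta> assume \<zeta>: "\<zeta> \<in> vecs H"
    have "ip H \<zeta> (x \<eta>) = ip (form_space \<xi>) (R \<zeta>) z" using z(2)[of "R \<zeta>"] \<phi> \<zeta> by simp
    also have "\<dots> = cnj (ip (form_space \<xi>) z (R \<zeta>))"
      using D.ip_commute[of z "R \<zeta>"] z(1) R_dom[OF \<zeta>] by simp
    also have "\<dots> = cnj (ip H z \<zeta>)" using ip_R[OF z(1) \<zeta>] by simp
    also have "\<dots> = ip H \<zeta> z" using hs.ip_commute[of z \<zeta>] z(1) \<zeta> by simp
    finally show "ip H \<zeta> z = ip H \<zeta> (x \<eta>)" by simp
  qed (use z(1) x\<eta> in auto)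
  then have dom: "x \<eta> \<in> form_dom \<xi>" and "hnorm (form_space \<xi>) (x \<eta>) \<le> sqrt (a * C)"
    using z a C by (simp_all add: max_absorb1)
  then have "(hnorm (form_space \<xi>) (x \<eta>))\<^sup>2 \<le> (sqrt (a * C))\<^sup>2"
    using hnorm_form_space_nonneg by (intro power_mono) auto
  then have "(hnorm (form_space \<xi>) (x \<eta>))\<^sup>2 \<le> a * C" using a C by simp
  moreover have "(hnorm H (x \<eta>))\<^sup>2 = a * (hnorm H \<eta>)\<^sup>2"
    using ip_x[OF \<eta> \<eta>] \<eta> x\<eta> by (simp add: hs.hnorm_sq)
  ultimately have "(\<integral>k. (cmod (c \<xi> (x \<eta>) k))\<^sup>2 \<partial>\<mu>) \<le> a * (\<integral>k. (cmod (c \<xi> \<eta> k))\<^sup>2 \<partial>\<mu>)"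
    by (simp add: C_def hnorm_form_space_sq[OF dom] hnorm_form_space_sq[OF \<eta>D] distrib_left)
  then show ?thesis
    using a by (simp add: coeff_norm2_eq[OF dom] coeff_norm2_eq[OF \<eta>D] ennreal_mult[symmetric] ennreal_leI)
qed

lemma coeff_norm2_scl:
  assumes "\<xi> \<in> vecs H" "\<eta> \<in> vecs H" and a: "a > 0"
  shows "coeff_norm2 \<xi> (scl H (of_real a) \<eta>) = ennreal a * (ennreal a * coeff_norm2 \<xi> \<eta>)"
proof -
  have [measurable]: "c \<xi> \<eta> \<in> borel_measurable \<mu>" by (rule coefficient_measurable[OF assms(1,2)])
  have "coeff_norm2 \<xi> (scl H (of_real a) \<eta>)
      = (\<integral>\<^sup>+k. ennreal (a * a) * ennreal ((cmod (c \<xi> \<eta> k))\<^sup>2) \<partial>\<mu>)"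
    unfolding coeff_norm2_def using assms
    by (intro nn_integral_cong)
      (simp add: c_scl norm_mult power_mult_distrib power2_eq_square ennreal_mult[symmetric])
  also have "\<dots> = ennreal (a * a) * coeff_norm2 \<xi> \<eta>"
    unfolding coeff_norm2_def by (rule nn_integral_cmult) measurable
  finally show ?thesis using a by (simp add: ennreal_mult mult.assoc)
qed

text \<open>A nonzero intertwiner \<open>x \<in> \<pi>(G)''\<close> between \<open>\<pi>\<close> and \<open>\<pi> \<circ> \<alpha>\<close> is a multiple of a unitary, because
  \<open>x\<^sup>*x\<close> and \<open>xx\<^sup>*\<close> are central. Moving a coefficient by \<open>x\<close> in both arguments amounts to composing
  it with \<open>\<alpha>\<inverse>\<close>, which scales the integral of its square by the modulus of \<open>\<alpha>\<close>; but the integral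
  does not see \<open>x\<close> in the second argument and, by symmetry of the form up to a constant, not in the
  first. So \<open>\<alpha>\<close> preserves Haar measure. In the proof \<open>y = x\<^sup>*\<close> and \<open>x\<^sup>*x = xx\<^sup>* = n\<close>.\<close>

theorem intertwiner_preserves_haar:
  assumes factor: "factor H (commutant H (commutant H (\<pi> ` carrier G)))"
    and \<alpha>: "\<alpha> \<in> hom G G" "bij_betw \<alpha> (carrier G) (carrier G)"
    and r: "\<And>f. f \<in> borel_measurable \<mu> \<Longrightarrow> (\<integral>\<^sup>+k. f (\<alpha> k) \<partial>\<mu>) = ennreal r * (\<integral>\<^sup>+k. f k \<partial>\<mu>)"
    and \<kappa>: "\<And>f. f \<in> borel_measurable \<mu> \<Longrightarrow> (\<integral>\<^sup>+k. f (inv k) \<partial>\<mu>) = \<kappa> * (\<integral>\<^sup>+k. f k \<partial>\<mu>)"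
    and \<kappa>0: "\<kappa> \<noteq> 0"
    and x: "x \<in> commutant H (commutant H (\<pi> ` carrier G))"
    and intertwines: "\<And>k v. \<lbrakk>k \<in> carrier G; v \<in> vecs H\<rbrakk> \<Longrightarrow> x (\<pi> k v) = \<pi> (\<alpha> k) (x v)"
    and nonzero: "v \<in> vecs H" "x v \<noteq> 0"
    and square_integrable: "\<xi> \<in> vecs H" "\<eta> \<in> vecs H" "coeff_norm2 \<xi> \<eta> \<noteq> 0" "coeff_norm2 \<xi> \<eta> \<noteq> \<infinity>"
  shows "r = 1"
proof -
  let ?S = "\<pi> ` carrier G" and ?M = "commutant H (commutant H (\<pi> ` carrier G))"
  note xb = hs.bounded_opsD[OF hs.commutantD(1)[OF x]]
  have \<alpha>_closed: "\<alpha> k \<in> carrier G" if "k \<in> carrier G" for k using that \<alpha>(1) by (auto simp: hom_def)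
  have \<alpha>_inv: "\<alpha> (inv k) = inv (\<alpha> k)" if "k \<in> carrier G" for k
    using group_hom.hom_inv[of G G \<alpha> k] that \<alpha>(1) is_group
    by (simp add: group_hom_def group_hom_axioms_def)
  obtain y where y: "y \<in> ?M" and adj: "\<And>u w. \<lbrakk>u \<in> vecs H; w \<in> vecs H\<rbrakk> \<Longrightarrow> ip H (x u) w = ip H u (y w)"
    using factor x unfolding factor_def von_neumann_algebra_def by meson
  note yb = hs.bounded_opsD[OF hs.commutantD(1)[OF y]]
  have adj': "ip H (y u) w = ip H u (x w)" if "u \<in> vecs H" "w \<in> vecs H" for u w
    using hs.adjoint_sym[OF hs.commutantD(1)[OF x] hs.commutantD(1)[OF y] adj that] .
  have y_intertwines: "y (\<pi> (\<alpha> k) u) = \<pi> k (y u)" if k: "k \<in> carrier G" and u: "u \<in> vecs H" for k u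
  proof (rule hs.eq_by_ip)
    fix w assume w: "w \<in> vecs H"
    have "ip H w (y (\<pi> (\<alpha> k) u)) = ip H (x w) (\<pi> (\<alpha> k) u)"
      using adj w u k \<alpha>_closed by simp
    also have "\<dots> = ip H (\<pi> (\<alpha> (inv k)) (x w)) u"
      using rep_adjoint[of "\<alpha> (inv k)" "x w" u] w u k xb(1) \<alpha>_closed by (simp add: \<alpha>_inv)
    also have "\<dots> = ip H (x (\<pi> (inv k) w)) u" using intertwines w k by simp
    also have "\<dots> = ip H (\<pi> (inv k) w) (y u)" using adj w k u by simp
    also have "\<dots> = ip H w (\<pi> k (y u))" using rep_adjoint[of "inv k" w "y u"] w k u yb(1) by simp
    finally show "ip H w (y (\<pi> (\<alpha> k) u)) = ip H w (\<pi> k (y u))" .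
  qed (use k u yb(1) \<alpha>_closed in auto)
  have comp: "(\<lambda>u. A (B u)) \<in> bounded_ops H" if A: "A \<in> bounded_ops H" and B: "B \<in> bounded_ops H" for A B
  proof -
    obtain a b where a: "a \<ge> 0" "\<And>u. u \<in> vecs H \<Longrightarrow> hnorm H (A u) \<le> a * hnorm H u"
      and b: "b \<ge> 0" "\<And>u. u \<in> vecs H \<Longrightarrow> hnorm H (B u) \<le> b * hnorm H u"
      using hs.bounded_ops_bound[OF A] hs.bounded_ops_bound[OF B] by metis
    show ?thesis
    proof (rule hs.bounded_opsI[of _ "a * b"])
      fix u assume u: "u \<in> vecs H"
      have "hnorm H (A (B u)) \<le> a * hnorm H (B u)" using a u hs.bounded_opsD(1)[OF B] by simp
      also have "\<dots> \<le> a * (b * hnorm H u)" using a b u by (intro mult_left_mono) auto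
      finally show "hnorm H (A (B u)) \<le> a * b * hnorm H u" by (simp add: mult.assoc)
    qed (simp_all add: hs.bounded_opsD[OF A] hs.bounded_opsD[OF B])
  qed
  have scalar: "\<exists>a. \<forall>u\<in>vecs H. A (B u) = scl H a u"
    if A: "A \<in> ?M" and B: "B \<in> ?M"
      and AB: "\<And>k u. \<lbrakk>k \<in> carrier G; u \<in> vecs H\<rbrakk> \<Longrightarrow> A (B (\<pi> k u)) = \<pi> k (A (B u))" for A B
  proof -
    note Ab = hs.commutantD[OF A] and Bb = hs.commutantD[OF B]
    have "(\<lambda>u. A (B u)) \<in> commutant H ?S"
      using comp[OF Ab(1) Bb(1)] AB by (auto simp: commutant_def)
    then have "(\<lambda>u. A (B u)) \<in> commutant H ?M" by (simp add: hs.tricommutant[OF rep_bounded])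
    moreover have "(\<lambda>u. A (B u)) \<in> ?M"
    proof -
      have "A (B (C u)) = C (A (B u))" if "C \<in> commutant H ?S" "u \<in> vecs H" for C u
        using Ab(2)[OF that(1)] Bb(2)[OF that] hs.bounded_opsD(1)[OF Bb(1)] that(2) by simp
      then show ?thesis using comp[OF Ab(1) Bb(1)] by (auto simp: commutant_def[of H "commutant H ?S"])
    qed
    ultimately have "(\<lambda>u. A (B u)) \<in> scalar_ops H" using factor by (auto simp: factor_def)
    then show ?thesis by (auto simp: scalar_ops_def)
  qed
  obtain a where a: "\<And>u. u \<in> vecs H \<Longrightarrow> y (x u) = scl H a u"
    using scalar[OF y x] intertwines y_intertwines xb(1) by metis
  have "x (y (\<pi> k u)) = \<pi> k (x (y u))" if k: "k \<in> carrier G" and u: "u \<in> vecs H" for k u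
  proof -
    obtain j where j: "j \<in> carrier G" "\<alpha> j = k" using \<alpha>(2) k by (metis bij_betw_imp_surj_on imageE)
    then show ?thesis using y_intertwines[OF j(1) u] intertwines[OF j(1)] yb(1) u by simp
  qed
  then obtain b where b: "\<And>u. u \<in> vecs H \<Longrightarrow> x (y u) = scl H b u"
    using scalar[OF x y] by blast
  have xv: "x v \<in> vecs H" using xb(1) nonzero by simp
  have "scl H a (x v) = scl H b (x v)"
    using a[OF nonzero(1)] b[OF xv] xb(3)[OF nonzero(1)] by simp
  then have ab: "b = a" using nonzero(2) by simp
  define n where "n = (hnorm H (x v))\<^sup>2 / (hnorm H v)\<^sup>2"
  have "v \<noteq> 0" using nonzero xb(5) by auto
  then have pos: "(hnorm H v)\<^sup>2 > 0" "(hnorm H (x v))\<^sup>2 > 0"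
    using hs.hnorm_eq_0 nonzero xv by auto
  then have n: "n > 0" by (simp add: n_def)
  have "of_real ((hnorm H (x v))\<^sup>2) = ip H (y (x v)) v"
    using adj'[OF xv nonzero(1)] xv by (simp add: hs.ip_self)
  also have "\<dots> = a * of_real ((hnorm H v)\<^sup>2)"
    using a nonzero(1) by (simp add: hs.ip_scl hs.ip_self)
  finally have an: "a = of_real n"
    using pos by (simp add: n_def field_simps del: of_real_power)
  have ip_x: "ip H (x u) (x w) = of_real n * ip H u w" if "u \<in> vecs H" "w \<in> vecs H" for u w
    using adj[OF that(1) xb(1)[OF that(2)]] a that by (simp add: hs.ip_scl_right an)
  have ip_y: "ip H (y u) (y w) = of_real n * ip H u w" if "u \<in> vecs H" "w \<in> vecs H" for u w
    using adj'[OF that(1) yb(1)[OF that(2)]] b that by (simp add: hs.ip_scl_right an ab)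
  have surj_x: "\<exists>w\<in>vecs H. x w = u" if "u \<in> vecs H" for u
  proof
    show "x (scl H (inverse a) (y u)) = u"
      using that b n by (simp add: xb yb ab an)
  qed (use that yb in simp)
  have surj_y: "\<exists>w\<in>vecs H. y w = u" if "u \<in> vecs H" for u
  proof
    show "y (scl H (inverse a) (x u)) = u"
      using that a n by (simp add: xb yb an)
  qed (use that xb in simp)
  have norm2_x: "coeff_norm2 u (x w) = ennreal n * coeff_norm2 u w"
    if u: "u \<in> vecs H" and w: "w \<in> vecs H" for u w
  proof (rule antisym)
    show "coeff_norm2 u (x w) \<le> ennreal n * coeff_norm2 u w"
      by (rule coeff_norm2_le[OF x n ip_x surj_x u w])
    \<comment> \<open>The reverse inequality is the first one for \<open>y = x\<^sup>*\<close>, because \<open>yx = n\<close>.\<close>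
    have "ennreal n * (ennreal n * coeff_norm2 u w) = coeff_norm2 u (y (x w))"
      using a[OF w] coeff_norm2_scl[OF u w n] an by simp
    also have "\<dots> \<le> ennreal n * coeff_norm2 u (x w)"
      by (rule coeff_norm2_le[OF y n ip_y surj_y u xb(1)[OF w]])
    finally show "ennreal n * coeff_norm2 u w \<le> coeff_norm2 u (x w)"
      using n by (simp add: ennreal_mult_le_mult_iff)
  qed
  have sym: "coeff_norm2 u w = \<kappa> * coeff_norm2 w u" if u: "u \<in> vecs H" and w: "w \<in> vecs H" for u w
  proof -
    have "c u w k = cnj (c w u (inv k))" if "k \<in> carrier G" for k
      using rep_adjoint[of k u w] hs.ip_commute[of "\<pi> (inv k) w" u] that u w
      by (simp add: coefficient_def)
    then have "coeff_norm2 u w = (\<integral>\<^sup>+k. ennreal ((cmod (c w u (inv k)))\<^sup>2) \<partial>\<mu>)"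
      unfolding coeff_norm2_def by (intro nn_integral_cong) simp
    also have "\<dots> = \<kappa> * coeff_norm2 w u"
      unfolding coeff_norm2_def using coefficient_measurable[OF w u]
      by (intro \<kappa>[where f = "\<lambda>k. ennreal ((cmod (c w u k))\<^sup>2)"]) simp
    finally show ?thesis .
  qed
  let ?q = "coeff_norm2 \<xi> \<eta>"
  note \<xi> = square_integrable(1) and \<eta> = square_integrable(2)
  have "coeff_norm2 (x \<xi>) (x \<eta>) = ennreal n * (\<kappa> * coeff_norm2 \<eta> (x \<xi>))"
    using norm2_x[OF xb(1)[OF \<xi>] \<eta>] sym[OF xb(1)[OF \<xi>] \<eta>] by simp
  also have "\<dots> = ennreal n * (ennreal n * (\<kappa> * coeff_norm2 \<eta> \<xi>))"
    by (simp only: norm2_x[OF \<eta> \<xi>] mult.left_commute)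
  also have "\<dots> = ennreal n * (ennreal n * ?q)" by (simp only: sym[OF \<xi> \<eta>, symmetric])
  finally have 1: "coeff_norm2 (x \<xi>) (x \<eta>) = ennreal n * (ennreal n * ?q)" .
  have "ennreal n * (ennreal n * ?q) = (\<integral>\<^sup>+k. ennreal ((cmod (c (x \<xi>) (x \<eta>) (\<alpha> k)))\<^sup>2) \<partial>\<mu>)"
  proof -
    have "c (x \<xi>) (x \<eta>) (\<alpha> k) = cnj (of_real n) * c \<xi> \<eta> k" if k: "k \<in> carrier G" for k
      using intertwines[OF k \<xi>, symmetric] ip_x[of "\<pi> k \<xi>" \<eta>] k \<xi> \<eta> by (simp add: coefficient_def)
    then have "c (x \<xi>) (x \<eta>) (\<alpha> k) = c \<xi> (scl H (of_real n) \<eta>) k" if k: "k \<in> carrier G" for k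
      using c_scl[OF k \<xi> \<eta>] k by simp
    then show ?thesis
      unfolding coeff_norm2_scl[OF \<xi> \<eta> n, symmetric] coeff_norm2_def[of \<xi> "scl H _ _"]
      by (intro nn_integral_cong) simp
  qed
  also have "\<dots> = ennreal r * coeff_norm2 (x \<xi>) (x \<eta>)"
    unfolding coeff_norm2_def using coefficient_measurable[OF xb(1)[OF \<xi>] xb(1)[OF \<eta>]]
    by (intro r[where f = "\<lambda>k. ennreal ((cmod (c (x \<xi>) (x \<eta>) k))\<^sup>2)"]) simp
  finally have 2: "ennreal n * (ennreal n * ?q) = ennreal r * (ennreal n * (ennreal n * ?q))"
    by (simp only: 1)
  define p where "p = enn2real (ennreal n * (ennreal n * ?q))"
  have "ennreal n * (ennreal n * ?q) \<noteq> \<infinity>"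
    using square_integrable(4) by (auto simp: ennreal_mult_eq_top_iff)
  then have p: "ennreal n * (ennreal n * ?q) = ennreal p" "p \<ge> 0" by (simp_all add: p_def less_top)
  have "ennreal p \<noteq> 0" using n square_integrable(3) unfolding p(1)[symmetric] by simp
  then have "p > 0" using p(2) by (cases "p = 0") auto
  then have "r \<ge> 0" using 2 unfolding p(1) by (metis ennreal_neg linorder_le_cases mult_zero_left ennreal_eq_0_iff not_less)
  then show "r = 1" using 2 \<open>p > 0\<close> unfolding p(1) by (simp add: ennreal_mult[symmetric])
qed

end

section \<open>The modular function and its kernel\<close>

context haar_space
begin

lemma nn_integral_scaling:
  assumes \<phi>: "\<phi> \<in> measurable \<mu> \<mu>"
    and scale: "\<And>E. E \<in> sets \<mu> \<Longrightarrow> emeasure \<mu> (\<phi> -` E \<inter> carrier G) = a * emeasure \<mu> E"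
    and f: "f \<in> borel_measurable \<mu>"
  shows "(\<integral>\<^sup>+k. f (\<phi> k) \<partial>\<mu>) = a * (\<integral>\<^sup>+k. f k \<partial>\<mu>)"
proof -
  have "distr \<mu> \<mu> \<phi> = scale_measure a \<mu>"
    by (rule measure_eqI) (simp_all add: emeasure_distr \<phi> scale)
  then show ?thesis
    using nn_integral_distr[OF \<phi>, of f] f by (simp add: nn_integral_scale_measure)
qed

lemma r_coset_sets: "\<lbrakk>s \<in> carrier G; E \<in> sets \<mu>\<rbrakk> \<Longrightarrow> E #> s \<in> sets \<mu>"
  using measurable_sets[OF right_mult_measurable[of "inv s"], of E]
  by (simp add: r_coset_eq_preimage sets_haar_carrier Int_def vimage_def conj_commute)

lemma l_coset_sets: "\<lbrakk>s \<in> carrier G; E \<in> sets \<mu>\<rbrakk> \<Longrightarrow> s <# E \<in> sets \<mu>"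
  using measurable_sets[OF left_mult_measurable[of "inv s"], of E]
  by (simp add: l_coset_eq_preimage sets_haar_carrier Int_def vimage_def conj_commute)

lemma emeasure_distr_right:
  assumes "s \<in> carrier G" "E \<in> sets \<mu>"
  shows "emeasure (distr \<mu> \<mu> (\<lambda>x. x \<otimes> inv s)) E = emeasure \<mu> (E #> s)"
proof -
  have "(\<lambda>x. x \<otimes> inv s) -` E \<inter> space \<mu> = E #> s"
    using assms by (auto simp: r_coset_eq_preimage sets_haar_carrier)
  then show ?thesis using assms by (simp add: emeasure_distr right_mult_measurable)
qed

lemma haar_space_homeomorphic_image:
  assumes \<phi>: "continuous_map T T \<phi>" and \<psi>: "continuous_map T T \<psi>"
    and inverse: "\<And>x. x \<in> carrier G \<Longrightarrow> \<phi> (\<psi> x) = x" "\<And>x. x \<in> carrier G \<Longrightarrow> \<psi> (\<phi> x) = x"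
    and invariant: "\<And>s E. \<lbrakk>s \<in> carrier G; E \<in> sets \<mu>\<rbrakk>
      \<Longrightarrow> emeasure \<mu> (\<phi> -` (s <# E) \<inter> carrier G) = emeasure \<mu> (\<phi> -` E \<inter> carrier G)"
  shows "haar_space G T (distr \<mu> \<mu> \<phi>)"
proof
  have \<phi>m: "\<phi> \<in> measurable \<mu> \<mu>" by (rule measurable_continuous[OF \<phi>])
  have \<phi>_closed: "\<phi> x \<in> carrier G" if "x \<in> carrier G" for x
    using that \<phi> by (auto simp: continuous_map_def topspace_eq)
  show "sets (distr \<mu> \<mu> \<phi>) = sets (borel_of T)" by (simp add: sets_haar)
  have "\<phi> -` carrier G \<inter> carrier G = carrier G" using \<phi>_closed by auto
  then show "emeasure (distr \<mu> \<mu> \<phi>) (space (distr \<mu> \<mu> \<phi>)) \<noteq> 0"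
    using haar_nonzero sets.top[of \<mu>] by (simp add: emeasure_distr[OF \<phi>m])
  show "emeasure (distr \<mu> \<mu> \<phi>) C < \<infinity>" if C: "compactin T C" for C
  proof (cases "C \<in> sets \<mu>")
    case True
    have C': "C \<subseteq> carrier G" using compactin_subset_topspace[OF C] by (simp add: topspace_eq)
    have "\<phi> -` C \<inter> carrier G = \<psi> ` C"
    proof (intro equalityI subsetI)
      fix x assume "x \<in> \<phi> -` C \<inter> carrier G"
      then show "x \<in> \<psi> ` C" using inverse(2)[of x] by (metis IntE image_eqI vimageE)
    next
      fix x assume "x \<in> \<psi> ` C"
      then show "x \<in> \<phi> -` C \<inter> carrier G"
        using inverse(1) C' \<psi> by (auto simp: continuous_map_def topspace_eq)
    qed
    then show ?thesis
      using haar_compact[OF image_compactin[OF C \<psi>]] True by (simp add: emeasure_distr[OF \<phi>m])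
  qed (simp add: emeasure_notin_sets)
  show "emeasure (distr \<mu> \<mu> \<phi>) (s <# E) = emeasure (distr \<mu> \<mu> \<phi>) E"
    if "s \<in> carrier G" "E \<in> sets (distr \<mu> \<mu> \<phi>)" for s E
    using that invariant l_coset_sets by (simp add: emeasure_distr[OF \<phi>m])
qed

lemma right_scaling:
  assumes s: "s \<in> carrier G"
  obtains d :: real where "d > 0" "\<And>E. E \<in> sets \<mu> \<Longrightarrow> emeasure \<mu> (E #> s) = ennreal d * emeasure \<mu> E"
proof -
  have "haar_space G T (distr \<mu> \<mu> (\<lambda>x. x \<otimes> inv s))"
  proof (rule haar_space_homeomorphic_image[where \<psi> = "\<lambda>x. x \<otimes> s"])
    fix t E assume t: "t \<in> carrier G" and E: "E \<in> sets \<mu>"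
    note E' = sets_haar_carrier[OF E]
    have "(\<lambda>x. x \<otimes> inv s) -` (t <# E) \<inter> carrier G = t <# ((\<lambda>x. x \<otimes> inv s) -` E \<inter> carrier G)"
      using s t E' by (subst (1 2) l_coset_eq_preimage) (auto simp: m_assoc)
    moreover have "(\<lambda>x. x \<otimes> inv s) -` E \<inter> carrier G \<in> sets \<mu>"
      using measurable_sets[OF right_mult_measurable[of "inv s"] E] s by simp
    ultimately show "emeasure \<mu> ((\<lambda>x. x \<otimes> inv s) -` (t <# E) \<inter> carrier G)
        = emeasure \<mu> ((\<lambda>x. x \<otimes> inv s) -` E \<inter> carrier G)"
      using haar_left_invariant t by simp
  qed (use s in \<open>simp_all add: continuous_right_mult m_assoc\<close>)
  from haar_unique[OF this haar_space_axioms] obtain d :: real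
    where "d > 0" "\<And>E. E \<in> sets (borel_of T) \<Longrightarrow>
      emeasure (distr \<mu> \<mu> (\<lambda>x. x \<otimes> inv s)) E = ennreal d * emeasure \<mu> E" by blast
  then show ?thesis using that[of d] s by (simp add: emeasure_distr_right sets_haar[symmetric])
qed

text \<open>The image of a bi-invariant measure under inversion is left invariant.\<close>

lemma inversion_scaling:
  assumes unimodular: "\<And>s E. \<lbrakk>s \<in> carrier G; E \<in> sets \<mu>\<rbrakk> \<Longrightarrow> emeasure \<mu> (E #> s) = emeasure \<mu> E"
  obtains \<kappa> :: real where "\<kappa> > 0"
    "\<And>f. f \<in> borel_measurable \<mu> \<Longrightarrow> (\<integral>\<^sup>+k. f (inv k) \<partial>\<mu>) = ennreal \<kappa> * (\<integral>\<^sup>+k. f k \<partial>\<mu>)"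
proof -
  have "haar_space G T (distr \<mu> \<mu> (\<lambda>x. inv x))"
  proof (rule haar_space_homeomorphic_image[where \<psi> = "\<lambda>x. inv x"])
    fix t E assume t: "t \<in> carrier G" and E: "E \<in> sets \<mu>"
    note E' = sets_haar_carrier[OF E]
    have "(\<lambda>x. inv x) -` (t <# E) \<inter> carrier G = ((\<lambda>x. inv x) -` E \<inter> carrier G) #> inv t"
      using t E' by (subst l_coset_eq_preimage, simp_all, subst r_coset_eq_preimage)
        (auto simp: inv_mult_group)
    moreover have "(\<lambda>x. inv x) -` E \<inter> carrier G \<in> sets \<mu>"
      using measurable_sets[OF inv_measurable E] by simp
    ultimately show "emeasure \<mu> ((\<lambda>x. inv x) -` (t <# E) \<inter> carrier G)
        = emeasure \<mu> ((\<lambda>x. inv x) -` E \<inter> carrier G)"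
      using unimodular t by simp
  qed (simp_all add: continuous_inv)
  from haar_unique[OF this haar_space_axioms] obtain d :: real
    where d: "d > 0" "\<And>E. E \<in> sets (borel_of T) \<Longrightarrow>
      emeasure (distr \<mu> \<mu> (\<lambda>x. inv x)) E = ennreal d * emeasure \<mu> E" by blast
  have "(\<integral>\<^sup>+k. f (inv k) \<partial>\<mu>) = ennreal d * (\<integral>\<^sup>+k. f k \<partial>\<mu>)" if "f \<in> borel_measurable \<mu>" for f
  proof (rule nn_integral_scaling[OF inv_measurable _ that])
    fix E assume E: "E \<in> sets \<mu>"
    then show "emeasure \<mu> ((\<lambda>x. inv x) -` E \<inter> carrier G) = ennreal d * emeasure \<mu> E"
      using d(2)[of E] by (simp add: emeasure_distr inv_measurable sets_haar[symmetric])
  qed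
  then show ?thesis using that d(1) by blast
qed

end

context second_countable_group
begin

lemma left_haar_measure_haar_space:
  assumes "left_haar_measure G T \<mu>"
  shows "haar_space G T \<mu>"
  by unfold_locales (use assms in \<open>auto simp: left_haar_measure_def\<close>)

text \<open>The factor for right translation by \<open>s\<close> is the same for all Haar measures, as these are
  proportional. So the definite description in the modular function has a value as soon as one
  Haar measure exists.\<close>

lemma modular_function_eqI:
  assumes \<mu>: "left_haar_measure G T \<mu>" and d: "d > 0"
    and scale: "\<And>E. E \<in> sets \<mu> \<Longrightarrow> emeasure \<mu> (E #> s) = ennreal d * emeasure \<mu> E"
  shows "modular_function G T s = d"
  unfolding modular_function_def
proof (rule the_equality)
  show "d > 0 \<and> (\<exists>\<mu>. left_haar_measure G T \<mu> \<and>
      (\<forall>E\<in>sets \<mu>. emeasure \<mu> (E #> s) = ennreal d * emeasure \<mu> E))"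
    using assms by blast
  fix d' assume "d' > 0 \<and> (\<exists>\<mu>. left_haar_measure G T \<mu> \<and>
      (\<forall>E\<in>sets \<mu>. emeasure \<mu> (E #> s) = ennreal d' * emeasure \<mu> E))"
  then obtain \<nu> where d': "d' > 0" and \<nu>: "left_haar_measure G T \<nu>"
    "\<And>E. E \<in> sets \<nu> \<Longrightarrow> emeasure \<nu> (E #> s) = ennreal d' * emeasure \<nu> E" by blast
  interpret M: haar_space G T \<mu> by (rule left_haar_measure_haar_space[OF \<mu>])
  interpret N: haar_space G T \<nu> by (rule left_haar_measure_haar_space[OF \<nu>(1)])
  obtain a where a: "a > 0" "\<And>E. E \<in> sets (borel_of T) \<Longrightarrow> emeasure \<nu> E = ennreal a * emeasure \<mu> E"
    using haar_unique[OF N.haar_space_axioms M.haar_space_axioms] by blast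
  obtain W where W: "openin T W" "W \<noteq> {}" "emeasure \<mu> W < \<infinity>"
    using M.exists_finite_open by blast
  have Wm: "W \<in> sets (borel_of T)" using W(1) by (rule openin_sets_borel_of)
  have W0: "emeasure \<mu> W \<noteq> 0" using M.haar_open_pos W by blast
  have "emeasure \<nu> (W #> s) = ennreal a * emeasure \<mu> (W #> s)"
  proof (cases "W #> s \<in> sets (borel_of T)")
    case False
    then show ?thesis by (simp add: emeasure_notin_sets M.sets_haar N.sets_haar)
  qed (rule a(2))
  then have "ennreal a * (ennreal d' * emeasure \<mu> W) = ennreal a * (ennreal d * emeasure \<mu> W)"
    using \<nu>(2)[of W] scale[of W] a(2)[OF Wm] Wm
    by (simp add: M.sets_haar N.sets_haar mult.left_commute)
  then have "ennreal d' * emeasure \<mu> W = ennreal d * emeasure \<mu> W"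
    using a(1) by (simp add: ennreal_mult_cancel_left)
  then have "emeasure \<mu> W * ennreal d' = emeasure \<mu> W * ennreal d" by (simp add: mult.commute)
  then show "d' = d" using W0 W(3) d d' by (auto simp: ennreal_mult_cancel_left)
qed

lemma modular_function_pos_scaling:
  assumes \<mu>: "left_haar_measure G T \<mu>" and s: "s \<in> carrier G"
  shows "modular_function G T s > 0"
    and "E \<in> sets \<mu> \<Longrightarrow> emeasure \<mu> (E #> s) = ennreal (modular_function G T s) * emeasure \<mu> E"
proof -
  interpret M: haar_space G T \<mu> by (rule left_haar_measure_haar_space[OF \<mu>])
  obtain d where "d > 0" "\<And>E. E \<in> sets \<mu> \<Longrightarrow> emeasure \<mu> (E #> s) = ennreal d * emeasure \<mu> E"
    using M.right_scaling[OF s] by blast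
  moreover from this have "modular_function G T s = d" by (rule modular_function_eqI[OF \<mu>])
  ultimately show "modular_function G T s > 0"
    "E \<in> sets \<mu> \<Longrightarrow> emeasure \<mu> (E #> s) = ennreal (modular_function G T s) * emeasure \<mu> E" by auto
qed

end

locale almost_unimodular_group = second_countable_group +
  fixes \<mu> :: "'a measure"
  assumes left_haar: "left_haar_measure G T \<mu>"
    and open_kernel: "openin T (modular_kernel G T)"
begin

sublocale haar_space G T \<mu>
  by (rule left_haar_measure_haar_space[OF left_haar])

abbreviation "\<Delta> \<equiv> modular_function G T"
abbreviation "K \<equiv> modular_kernel G T"
abbreviation "L \<equiv> G\<lparr>carrier := modular_kernel G T\<rparr>"
abbreviation "T\<^sub>K \<equiv> subtopology T (modular_kernel G T)"
abbreviation "\<mu>\<^sub>K \<equiv> restrict_space \<mu> (modular_kernel G T)"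

lemma modular_pos: "s \<in> carrier G \<Longrightarrow> \<Delta> s > 0"
  and modular_scaling:
    "\<lbrakk>s \<in> carrier G; E \<in> sets \<mu>\<rbrakk> \<Longrightarrow> emeasure \<mu> (E #> s) = ennreal (\<Delta> s) * emeasure \<mu> E"
  by (simp_all add: modular_function_pos_scaling[OF left_haar])

lemma modular_mult:
  assumes s: "s \<in> carrier G" and t: "t \<in> carrier G"
  shows "\<Delta> (s \<otimes> t) = \<Delta> s * \<Delta> t"
proof (rule modular_function_eqI[OF left_haar])
  fix E assume E: "E \<in> sets \<mu>"
  have "E #> (s \<otimes> t) = (E #> s) #> t"
    using coset_mult_assoc[of E s t] sets_haar_carrier[OF E] s t by simp
  then show "emeasure \<mu> (E #> (s \<otimes> t)) = ennreal (\<Delta> s * \<Delta> t) * emeasure \<mu> E"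
    using modular_scaling[OF t r_coset_sets[OF s E]] modular_scaling[OF s E]
      modular_pos[OF s] modular_pos[OF t] by (simp add: ennreal_mult mult_ac)
qed (simp add: modular_pos s t)

lemma modular_one: "\<Delta> \<one> = 1"
  using modular_mult[of \<one> \<one>] modular_pos[of \<one>] by simp

lemma modular_inv: "s \<in> carrier G \<Longrightarrow> \<Delta> (inv s) = inverse (\<Delta> s)"
  using modular_mult[of "inv s" s] modular_pos[of s] by (simp add: modular_one field_simps)

lemma kernel_iff: "k \<in> K \<longleftrightarrow> k \<in> carrier G \<and> \<Delta> k = 1"
  by (simp add: modular_kernel_def)

lemma kernel_subgroup: "subgroup K G"
  by (rule subgroup.intro) (auto simp: kernel_iff modular_mult modular_one modular_inv)

lemma kernel_conj:
  assumes "g \<in> carrier G" "k \<in> K"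
  shows "g \<otimes> k \<otimes> inv g \<in> K"
  using assms modular_pos[of g] by (simp add: kernel_iff modular_mult modular_inv)

lemma kernel_subset: "K \<subseteq> carrier G"
  by (auto simp: kernel_iff)

lemma topspace_kernel [simp]: "topspace T \<inter> K = K"
  using kernel_subset by (auto simp: topspace_eq)

lemma openin_kernel_iff: "openin T\<^sub>K U \<longleftrightarrow> openin T U \<and> U \<subseteq> K"
  by (rule openin_open_subtopology[OF open_kernel])

lemma kernel_group: "second_countable_group L T\<^sub>K"
proof -
  interpret L: group L by (rule subgroup.subgroup_is_group[OF kernel_subgroup is_group])
  show ?thesis
  proof
    show "topspace T\<^sub>K = carrier L" by simp
    show "continuous_map (prod_topology T\<^sub>K T\<^sub>K) T\<^sub>K (\<lambda>(x, y). x \<otimes>\<^bsub>L\<^esub> y)"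
      unfolding subtopology_Times
      using continuous_map_from_subtopology[OF continuous_mult, of "K \<times> K"]
        subgroup.m_closed[OF kernel_subgroup]
      by (auto simp: continuous_map_in_subtopology topspace_eq subtopology_Times[symmetric])
    have "continuous_map T\<^sub>K T\<^sub>K (\<lambda>x. inv x)"
      using continuous_map_from_subtopology[OF continuous_inv, of K]
        subgroup.m_inv_closed[OF kernel_subgroup]
      by (auto simp: continuous_map_in_subtopology)
    then show "continuous_map T\<^sub>K T\<^sub>K (\<lambda>x. inv\<^bsub>L\<^esub> x)"
      using m_inv_consistent[OF kernel_subgroup] by (auto intro: continuous_map_eq)
    show "locally_compact_space T\<^sub>K"
      using locally_compact_space_open_subset[OF _ locally_compact open_kernel] Hausdorff by blast
    show "Hausdorff_space T\<^sub>K" using Hausdorff by (rule Hausdorff_space_subtopology)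
    show "second_countable T\<^sub>K" using second_countable by (rule second_countable_subtopology)
  qed
qed

lemma sets_kernel: "sets \<mu>\<^sub>K = sets (borel_of T\<^sub>K)"
proof
  have [simp]: "K \<inter> carrier G = K" using kernel_subset by blast
  have 1: "(\<lambda>x. x) \<in> measurable (borel_of T\<^sub>K) (borel_of T)"
    by (rule continuous_map_measurable) (rule continuous_map_from_subtopology[OF continuous_map_id[unfolded id_def]])
  show "sets \<mu>\<^sub>K \<subseteq> sets (borel_of T\<^sub>K)"
  proof
    fix E assume "E \<in> sets \<mu>\<^sub>K"
    then obtain F where F: "F \<in> sets (borel_of T)" "E = K \<inter> F"
      by (auto simp: sets_restrict_space sets_haar)
    then show "E \<in> sets (borel_of T\<^sub>K)"
      using measurable_sets[OF 1 F(1)] by (simp add: Int_commute)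
  qed
  have 2: "(\<lambda>x. x) \<in> measurable \<mu>\<^sub>K (borel_of T\<^sub>K)"
  proof (rule measurable_borel_ofI)
    fix U assume "openin T\<^sub>K U"
    then have U: "U \<in> sets \<mu>" "U \<subseteq> K" by (simp_all add: openin_kernel_iff openin_sets_haar)
    then have "U \<inter> K = U" by blast
    then show "(\<lambda>x. x) -` U \<inter> space \<mu>\<^sub>K \<in> sets \<mu>\<^sub>K"
      using U kernel_subset
      by (auto simp: sets_restrict_space space_restrict_space Int_commute intro!: image_eqI[of _ _ U])
  qed (simp add: space_restrict_space)
  show "sets (borel_of T\<^sub>K) \<subseteq> sets \<mu>\<^sub>K"
  proof
    fix E assume E: "E \<in> sets (borel_of T\<^sub>K)"
    then have "E \<subseteq> K" using sets.sets_into_space by fastforce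
    then show "E \<in> sets \<mu>\<^sub>K" using measurable_sets[OF 2 E] by (simp add: space_restrict_space Int_absorb2)
  qed
qed

lemma kernel_sets: "E \<in> sets \<mu>\<^sub>K \<longleftrightarrow> E \<in> sets \<mu> \<and> E \<subseteq> K"
  using openin_sets_haar[OF open_kernel] kernel_subset
  by (subst sets_restrict_space_iff) (auto simp: Int_absorb2)

lemma emeasure_kernel: "E \<subseteq> K \<Longrightarrow> emeasure \<mu>\<^sub>K E = emeasure \<mu> E"
  using openin_sets_haar[OF open_kernel] kernel_subset
  by (intro emeasure_restrict_space) (auto simp: Int_absorb2)

lemma kernel_haar: "haar_space L T\<^sub>K \<mu>\<^sub>K"
proof -
  interpret L: second_countable_group L T\<^sub>K by (rule kernel_group)
  have K1: "\<one> \<in> K" using subgroup.one_closed[OF kernel_subgroup] .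
  show ?thesis
  proof
    show "sets \<mu>\<^sub>K = sets (borel_of T\<^sub>K)" by (rule sets_kernel)
    have "space \<mu>\<^sub>K = K" using kernel_subset by (auto simp: space_restrict_space)
    then show "emeasure \<mu>\<^sub>K (space \<mu>\<^sub>K) \<noteq> 0"
      using haar_open_pos[OF open_kernel] K1 by (auto simp: emeasure_kernel)
    show "emeasure \<mu>\<^sub>K C < \<infinity>" if "compactin T\<^sub>K C" for C
      using that haar_compact[of C] by (simp add: compactin_subtopology emeasure_kernel)
    show "emeasure \<mu>\<^sub>K (s <#\<^bsub>L\<^esub> E) = emeasure \<mu>\<^sub>K E" if s: "s \<in> carrier L" and E: "E \<in> sets \<mu>\<^sub>K" for s E
    proof -
      have "s <#\<^bsub>L\<^esub> E = s <# E" by (simp add: l_coset_def)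
      moreover have "s <# E \<subseteq> K"
        using s E subgroup.m_closed[OF kernel_subgroup] by (auto simp: l_coset_def kernel_sets)
      ultimately show ?thesis
        using s E kernel_subset haar_left_invariant by (auto simp: emeasure_kernel kernel_sets)
    qed
  qed
qed

lemma kernel_unimodular:
  assumes s: "s \<in> K" and E: "E \<in> sets \<mu>\<^sub>K"
  shows "emeasure \<mu>\<^sub>K (E #>\<^bsub>L\<^esub> s) = emeasure \<mu>\<^sub>K E"
proof -
  have "E #>\<^bsub>L\<^esub> s = E #> s" by (simp add: r_coset_def)
  moreover have "E #> s \<subseteq> K"
    using s E subgroup.m_closed[OF kernel_subgroup] by (auto simp: r_coset_def kernel_sets)
  ultimately show ?thesis
    using s E modular_scaling[of s E] by (simp add: emeasure_kernel kernel_sets kernel_iff)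
qed

text \<open>The preimage of \<open>E\<close> under conjugation by \<open>g\<close> is \<open>g\<^sup>-\<^sup>1(Eg)\<close>: left translation preserves its
  measure and right translation multiplies it by \<open>\<Delta>(g)\<close>.\<close>

lemma kernel_conj_scaling:
  assumes g: "g \<in> carrier G" and f: "f \<in> borel_measurable \<mu>\<^sub>K"
  shows "(\<integral>\<^sup>+k. f (g \<otimes> k \<otimes> inv g) \<partial>\<mu>\<^sub>K) = ennreal (\<Delta> g) * (\<integral>\<^sup>+k. f k \<partial>\<mu>\<^sub>K)"
proof -
  interpret L: haar_space L T\<^sub>K \<mu>\<^sub>K by (rule kernel_haar)
  let ?\<alpha> = "\<lambda>k. g \<otimes> k \<otimes> inv g"
  have c: "continuous_map T T ?\<alpha>"
    using continuous_map_compose[OF continuous_left_mult[OF g] continuous_right_mult[of "inv g"]] g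
    by (simp add: o_def)
  have "continuous_map T\<^sub>K T\<^sub>K ?\<alpha>"
    using continuous_map_from_subtopology[OF c, of K] kernel_conj[OF g]
    by (auto simp: continuous_map_in_subtopology)
  then have m: "?\<alpha> \<in> measurable \<mu>\<^sub>K \<mu>\<^sub>K" by (rule L.measurable_continuous)
  have "emeasure \<mu>\<^sub>K (?\<alpha> -` E \<inter> K) = ennreal (\<Delta> g) * emeasure \<mu>\<^sub>K E" if E: "E \<in> sets \<mu>\<^sub>K" for E
  proof -
    have E': "E \<in> sets \<mu>" "E \<subseteq> K" using E by (simp_all add: kernel_sets)
    then have EG: "E \<subseteq> carrier G" using kernel_subset by blast
    have Eg: "E #> g \<subseteq> carrier G" using EG g by (auto simp: r_coset_def)
    have "?\<alpha> -` E \<inter> K = inv g <# (E #> g)"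
    proof (intro equalityI subsetI)
      fix k assume "k \<in> ?\<alpha> -` E \<inter> K"
      then show "k \<in> inv g <# (E #> g)"
        using g kernel_subset Eg EG
        by (subst l_coset_eq_preimage) (auto simp: r_coset_eq_preimage)
    next
      fix k assume "k \<in> inv g <# (E #> g)"
      then have k: "k \<in> carrier G" "?\<alpha> k \<in> E"
        using g Eg EG by (auto simp: l_coset_eq_preimage r_coset_eq_preimage)
      then have "\<Delta> (?\<alpha> k) = 1" using E'(2) by (auto simp: kernel_iff)
      then have "\<Delta> k = 1" using g k modular_pos[OF g] by (simp add: modular_mult modular_inv field_simps)
      then show "k \<in> ?\<alpha> -` E \<inter> K" using k by (simp add: kernel_iff)
    qed
    moreover have "?\<alpha> -` E \<inter> K \<subseteq> K" by blast
    ultimately show ?thesis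
      using g E' haar_left_invariant[of "inv g" "E #> g"] r_coset_sets[OF g E'(1)]
        modular_scaling[OF g E'(1)]
      by (simp add: emeasure_kernel)
  qed
  then show ?thesis using L.nn_integral_scaling[OF m _ f] by simp
qed

end

text \<open>Without a Haar measure the definite description in the modular function has the same
  unsatisfiable condition for all \<open>s\<close>, so the modular function is constant and its kernel is empty or
  the whole group. The kernel is nonempty because it has nonzero measure, so it is the whole group
  and its Haar measure is one of the group.\<close>

lemma left_haar_measure_exists:
  assumes G: "topological_group G T"
    and \<mu>: "left_haar_measure (G\<lparr>carrier := modular_kernel G T\<rparr>) (subtopology T (modular_kernel G T)) \<mu>"
  shows "\<exists>\<mu>. left_haar_measure G T \<mu>"
proof (rule ccontr)
  assume none: "\<nexists>\<mu>. left_haar_measure G T \<mu>"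
  interpret topological_group G T by (rule G)
  let ?K = "modular_kernel G T"
  have const: "modular_function G T s = modular_function G T t" for s t
    unfolding modular_function_def using none by simp
  have sets: "sets \<mu> = sets (borel_of (subtopology T ?K))" and nonzero: "emeasure \<mu> (space \<mu>) \<noteq> 0"
    using \<mu> unfolding left_haar_measure_def by blast+
  have "space \<mu> = topspace T \<inter> ?K"
    using sets_eq_imp_space_eq[OF sets] by simp
  then have "?K \<noteq> {}" using nonzero by auto
  then obtain k where "k \<in> carrier G" "modular_function G T k = 1" by (auto simp: modular_kernel_def)
  then have "modular_function G T s = 1" for s using const by metis
  then have K: "?K = carrier G" by (simp add: modular_kernel_def)
  have top: "subtopology T ?K = T" unfolding K topspace_eq[symmetric] by simp
  have carrier: "carrier (G\<lparr>carrier := ?K\<rparr>) = carrier G" by (simp add: K)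
  have coset: "s <#\<^bsub>G\<lparr>carrier := ?K\<rparr>\<^esub> E = s <#\<^bsub>G\<^esub> E" for s E by (simp add: l_coset_def)
  have "left_haar_measure G T \<mu>"
    using \<mu> unfolding left_haar_measure_def coset top carrier .
  then show False using none by blast
qed

section \<open>The induced representation\<close>

context haar_rep
begin

text \<open>Haar measures are proportional, so the measure \<open>\<mu>\<close> can replace the one that exhibits square
  integrability.\<close>

lemma square_integrableD:
  assumes "square_integrable_representation G T H \<pi>"
  obtains \<xi> \<eta> where "\<xi> \<in> vecs H" "\<eta> \<in> vecs H" "coeff_norm2 \<xi> \<eta> \<noteq> 0" "coeff_norm2 \<xi> \<eta> \<noteq> \<infinity>"
proof -
  obtain \<nu> \<xi> \<eta> where \<nu>: "left_haar_measure G T \<nu>" and \<xi>\<eta>: "\<xi> \<in> vecs H" "\<eta> \<in> vecs H"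
    and int: "integrable \<nu> (\<lambda>s. (cmod (c \<xi> \<eta> s))\<^sup>2)" and nz: "\<not> (AE s in \<nu>. c \<xi> \<eta> s = 0)"
    using assms unfolding square_integrable_representation_def by blast
  interpret N: haar_space G T \<nu> by (rule left_haar_measure_haar_space[OF \<nu>])
  obtain a where a: "a > 0" "\<And>E. E \<in> sets (borel_of T) \<Longrightarrow> emeasure \<nu> E = ennreal a * emeasure \<mu> E"
    using haar_unique[OF N.haar_space_axioms haar_space_axioms] by blast
  have eq: "\<nu> = scale_measure (ennreal a) \<mu>"
    by (rule measure_eqI) (simp_all add: a N.sets_haar sets_haar)
  have [measurable]: "c \<xi> \<eta> \<in> borel_measurable \<mu>" by (rule coefficient_measurable[OF \<xi>\<eta>])
  have n: "(\<integral>\<^sup>+s. ennreal ((cmod (c \<xi> \<eta> s))\<^sup>2) \<partial>\<nu>) = ennreal a * coeff_norm2 \<xi> \<eta>"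
    unfolding eq coeff_norm2_def by (rule nn_integral_scale_measure) measurable
  have "(\<integral>\<^sup>+s. ennreal ((cmod (c \<xi> \<eta> s))\<^sup>2) \<partial>\<nu>) \<noteq> \<infinity>"
    using int by (auto simp: integrable_iff_bounded)
  then have "coeff_norm2 \<xi> \<eta> \<noteq> \<infinity>" unfolding n using a(1) by (auto simp: ennreal_mult_top)
  moreover have "c \<xi> \<eta> \<in> borel_measurable \<nu>"
    by (subst measurable_cong_sets[OF N.sets_haar refl])
      (rule borel_measurable_continuous_map[OF coefficient_continuous[OF \<xi>\<eta>]])
  then have "(\<integral>\<^sup>+s. ennreal ((cmod (c \<xi> \<eta> s))\<^sup>2) \<partial>\<nu>) \<noteq> 0"
    using nz by (subst nn_integral_0_iff_AE) auto
  then have "coeff_norm2 \<xi> \<eta> \<noteq> 0" unfolding n by auto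
  ultimately show ?thesis using that \<xi>\<eta> by blast
qed

lemma square_integrableI:
  assumes \<mu>: "left_haar_measure G T \<mu>" and \<xi>\<eta>: "\<xi> \<in> vecs H" "\<eta> \<in> vecs H"
    and q: "coeff_norm2 \<xi> \<eta> \<noteq> 0" "coeff_norm2 \<xi> \<eta> \<noteq> \<infinity>"
  shows "square_integrable_representation G T H \<pi>"
proof -
  have m [measurable]: "c \<xi> \<eta> \<in> borel_measurable \<mu>" by (rule coefficient_measurable[OF \<xi>\<eta>])
  have "integrable \<mu> (\<lambda>s. (cmod (c \<xi> \<eta> s))\<^sup>2)"
    using form_dom_iff[OF \<xi>\<eta>] q(2) by (simp add: form_dom_def less_top del: form_domD)
  moreover have "\<not> (AE s in \<mu>. c \<xi> \<eta> s = 0)"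
    using q(1) unfolding coeff_norm2_def by (subst (asm) nn_integral_0_iff_AE) auto
  ultimately show ?thesis
    unfolding square_integrable_representation_def using \<mu> \<xi>\<eta> m by blast
qed

end

locale induction_from_kernel = almost_unimodular_group G T \<mu>
  for G :: "('a, 'm) monoid_scheme" (structure) and T :: "'a topology" and \<mu> :: "'a measure" +
  fixes H :: "'v::ab_group_add hilbert" and \<pi> :: "'a \<Rightarrow> 'v \<Rightarrow> 'v" and \<sigma> :: "real \<Rightarrow> 'a"
  assumes normalized: "normalized_section G T \<sigma>"
    and kernel_rep: "unitary_representation (G\<lparr>carrier := modular_kernel G T\<rparr>)
      (subtopology T (modular_kernel G T)) H \<pi>"
begin

sublocale R: haar_rep L T\<^sub>K H \<pi> \<mu>\<^sub>K
  using kernel_haar kernel_rep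
  by (simp add: haar_rep_def unitary_rep_def unitary_rep_axioms_def haar_space_def)

abbreviation "D \<equiv> modular_range G T"
abbreviation "E \<equiv> ell2 (modular_range G T) H"
abbreviation "Ind \<equiv> induced_representation G T \<sigma> \<pi>"

sublocale E: hilbert_space E
  by (rule R.hs.hilbert_space_ell2)

lemma carrier_kernel: "carrier L = K"
  by simp

lemma \<sigma>_closed [simp]: "\<delta> \<in> D \<Longrightarrow> \<sigma> \<delta> \<in> carrier G"
  and modular_\<sigma> [simp]: "\<delta> \<in> D \<Longrightarrow> \<Delta> (\<sigma> \<delta>) = \<delta>"
  and \<sigma>_one: "\<sigma> 1 = \<one>"
  using normalized by (simp_all add: normalized_section_def)

lemma modular_in_range [simp]: "s \<in> carrier G \<Longrightarrow> \<Delta> s \<in> D"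
  by (simp add: modular_range_def)

lemma range_pos: "\<delta> \<in> D \<Longrightarrow> \<delta> > 0"
  by (auto simp: modular_range_def modular_pos)

lemma range_mult: "\<lbrakk>\<delta> \<in> D; \<epsilon> \<in> D\<rbrakk> \<Longrightarrow> \<delta> * \<epsilon> \<in> D"
  using modular_in_range[of "\<sigma> \<delta> \<otimes> \<sigma> \<epsilon>"] by (simp add: modular_mult)

lemma range_inverse: "\<delta> \<in> D \<Longrightarrow> inverse \<delta> \<in> D"
  using modular_in_range[of "inv (\<sigma> \<delta>)"] by (simp add: modular_inv)

lemma range_one [simp]: "1 \<in> D"
  using modular_in_range[of \<one>] by (simp add: modular_one)

lemma range_shift [simp]: "\<lbrakk>s \<in> carrier G; \<delta> \<in> D\<rbrakk> \<Longrightarrow> inverse (\<Delta> s) * \<delta> \<in> D"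
  by (simp add: range_mult range_inverse)

lemma bij_range_shift:
  assumes s: "s \<in> carrier G"
  shows "bij_betw (\<lambda>\<delta>. inverse (\<Delta> s) * \<delta>) D D"
  by (rule bij_betw_byWitness[where f' = "\<lambda>\<delta>. \<Delta> s * \<delta>"])
    (use s modular_pos[OF s] in \<open>auto intro: range_mult\<close>)

text \<open>The element of \<open>K\<close> through which \<open>s\<close> moves the coordinate \<open>\<Delta>(s)\<^sup>-\<^sup>1\<delta>\<close> to \<open>\<delta>\<close>.\<close>

definition cocycle :: "'a \<Rightarrow> real \<Rightarrow> 'a" where
  "cocycle s \<delta> = inv (\<sigma> \<delta>) \<otimes> s \<otimes> \<sigma> (inverse (\<Delta> s) * \<delta>)"

lemma cocycle_kernel [simp]: "\<lbrakk>s \<in> carrier G; \<delta> \<in> D\<rbrakk> \<Longrightarrow> cocycle s \<delta> \<in> K"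
proof -
  assume s: "s \<in> carrier G" and \<delta>: "\<delta> \<in> D"
  have "inverse \<delta> * \<Delta> s * (inverse (\<Delta> s) * \<delta>) = 1"
    using range_pos[OF \<delta>] modular_pos[OF s] by (simp add: field_simps)
  then show ?thesis
    using s \<delta> range_shift[OF s \<delta>] unfolding cocycle_def kernel_iff
    by (simp only: modular_mult modular_inv m_closed inv_closed \<sigma>_closed modular_\<sigma>)
qed

lemma Ind_apply: "Ind s f \<delta> = (if \<delta> \<in> D then \<pi> (cocycle s \<delta>) (f (inverse (\<Delta> s) * \<delta>)) else 0)"
  by (simp add: induced_representation_def cocycle_def)

lemma pi_closed: "\<lbrakk>k \<in> K; v \<in> vecs H\<rbrakk> \<Longrightarrow> \<pi> k v \<in> vecs H"
  using R.rep_closed by simp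

lemma pi_hnorm: "\<lbrakk>k \<in> K; v \<in> vecs H\<rbrakk> \<Longrightarrow> hnorm H (\<pi> k v) = hnorm H v"
  using R.hs.unitary_opD(3)[OF R.unitary] by simp

lemma pi_bounded: "k \<in> K \<Longrightarrow> \<pi> k \<in> bounded_ops H"
  using R.hs.unitary_opD(1)[OF R.unitary] by simp

lemmas E_apply = R.hs.ell2_apply

lemma Ind_closed:
  assumes s: "s \<in> carrier G" and f: "f \<in> vecs E"
  shows "Ind s f \<in> vecs E"
proof -
  have "(\<lambda>\<delta>. (hnorm H (f (inverse (\<Delta> s) * \<delta>)))\<^sup>2) summable_on D"
    using summable_on_reindex_bij_betw[OF bij_range_shift[OF s], where f = "\<lambda>\<delta>. (hnorm H (f \<delta>))\<^sup>2"]
      R.hs.ell2_summable[OF f] by simp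
  then have "(\<lambda>\<delta>. (hnorm H (Ind s f \<delta>))\<^sup>2) summable_on D"
    by (rule summable_on_cong[THEN iffD1, rotated])
      (simp add: Ind_apply pi_hnorm s E_apply[OF f])
  then show ?thesis using s by (simp add: R.hs.vecs_ell2 Ind_apply pi_closed E_apply[OF f])
qed

lemma Ind_ip:
  assumes s: "s \<in> carrier G" and f: "f \<in> vecs E" and g: "g \<in> vecs E"
  shows "ip E (Ind s f) (Ind s g) = ip E f g"
proof -
  have "ip E (Ind s f) (Ind s g)
      = (\<Sum>\<^sub>\<infinity>\<delta>\<in>D. ip H (f (inverse (\<Delta> s) * \<delta>)) (g (inverse (\<Delta> s) * \<delta>)))"
    unfolding R.hs.ip_ell2
    using R.rep_ip s by (intro infsum_cong) (simp add: Ind_apply E_apply[OF f] E_apply[OF g])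
  also have "\<dots> = ip E f g"
    unfolding R.hs.ip_ell2
    by (rule infsum_reindex_bij_betw[OF bij_range_shift[OF s], where f = "\<lambda>\<delta>. ip H (f \<delta>) (g \<delta>)"])
  finally show ?thesis .
qed

lemma Ind_mult:
  assumes s: "s \<in> carrier G" and t: "t \<in> carrier G" and f: "f \<in> vecs E"
  shows "Ind (s \<otimes> t) f = Ind s (Ind t f)"
proof
  fix \<delta>
  show "Ind (s \<otimes> t) f \<delta> = Ind s (Ind t f) \<delta>"
  proof (cases "\<delta> \<in> D")
    case \<delta>: True
    define \<epsilon> where "\<epsilon> = inverse (\<Delta> s) * \<delta>"
    have \<epsilon>: "\<epsilon> \<in> D" using s \<delta> by (simp add: \<epsilon>_def)
    have sh: "inverse (\<Delta> (s \<otimes> t)) * \<delta> = inverse (\<Delta> t) * \<epsilon>"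
      using s t by (simp add: modular_mult \<epsilon>_def inverse_mult_distrib)
    define u where "u = \<sigma> (inverse (\<Delta> t) * \<epsilon>)"
    have u: "u \<in> carrier G" using t \<epsilon> by (simp add: u_def)
    have "\<sigma> \<epsilon> \<otimes> (inv (\<sigma> \<epsilon>) \<otimes> (t \<otimes> u)) = t \<otimes> u"
      using t u \<epsilon> by (simp add: m_assoc[symmetric])
    then have "cocycle (s \<otimes> t) \<delta> = cocycle s \<delta> \<otimes> cocycle t \<epsilon>"
      using s t u \<delta> \<epsilon> unfolding cocycle_def sh u_def[symmetric] \<epsilon>_def[symmetric]
      by (simp add: m_assoc)
    then show ?thesis
      using R.rep_mult[of "cocycle s \<delta>" "cocycle t \<epsilon>" "f (inverse (\<Delta> t) * \<epsilon>)"] s t \<delta> \<epsilon> E_apply[OF f]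
      by (simp add: Ind_apply sh \<epsilon>_def[symmetric])
  qed (simp add: Ind_apply)
qed

lemma Ind_one:
  assumes f: "f \<in> vecs E"
  shows "Ind \<one> f = f"
proof
  fix \<delta>
  show "Ind \<one> f \<delta> = f \<delta>"
  proof (cases "\<delta> \<in> D")
    case True
    then have "cocycle \<one> \<delta> = \<one>" by (simp add: cocycle_def modular_one)
    then show ?thesis using True R.rep_one[of "f \<delta>"] E_apply[OF f] by (simp add: Ind_apply modular_one)
  qed (simp add: Ind_apply R.hs.ell2_outside[OF f])
qed

lemma Ind_unitary:
  assumes s: "s \<in> carrier G"
  shows "unitary_op E (Ind s)"
  unfolding unitary_op_def linear_op_def
proof (intro conjI ballI allI)
  fix f g a assume f: "f \<in> vecs E" and g: "g \<in> vecs E"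
  show "Ind s f \<in> vecs E" by (rule Ind_closed[OF s f])
  show "ip E (Ind s f) (Ind s g) = ip E f g" by (rule Ind_ip[OF s f g])
  show "Ind s (f + g) = Ind s f + Ind s g"
    using R.hs.bounded_opsD(2)[OF pi_bounded] s E_apply[OF f] E_apply[OF g]
    by (simp add: fun_eq_iff Ind_apply)
next
  fix a f assume f: "f \<in> vecs E"
  show "Ind s (scl E a f) = scl E a (Ind s f)"
    using R.hs.bounded_opsD(3)[OF pi_bounded] s E_apply[OF f]
    by (simp add: fun_eq_iff Ind_apply R.hs.scl_ell2)
next
  show "bij_betw (Ind s) (vecs E) (vecs E)"
    by (rule bij_betw_byWitness[where f' = "Ind (inv s)"])
      (use s in \<open>auto simp: Ind_mult[symmetric] Ind_one Ind_closed\<close>)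
qed

text \<open>Near \<open>s\<close>, that is on the open coset \<open>sK\<close>, the permutation of the coordinates is constant. On
  finitely many coordinates strong continuity of \<open>\<pi>\<close> applies; the remaining ones contribute little
  because \<open>f\<close> is square summable and \<open>\<pi>\<close> is isometric.\<close>

lemma Ind_continuous:
  assumes s: "s \<in> carrier G" and f: "f \<in> vecs E"
  shows "((\<lambda>t. hnorm E (Ind t f - Ind s f)) \<longlongrightarrow> 0) (atin T s)"
proof (rule tendstoI)
  fix e :: real assume e: "e > 0"
  define v where "v \<delta> = f (inverse (\<Delta> s) * \<delta>)" for \<delta>
  have v: "v \<delta> \<in> vecs H" for \<delta> using E_apply[OF f] by (simp add: v_def)
  let ?g = "\<lambda>\<delta>. (hnorm H (v \<delta>))\<^sup>2"
  have g: "?g summable_on D"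
    using summable_on_reindex_bij_betw[OF bij_range_shift[OF s], where f = "\<lambda>\<delta>. (hnorm H (f \<delta>))\<^sup>2"]
      R.hs.ell2_summable[OF f] by (simp add: v_def)
  have "\<forall>\<^sub>F F in finite_subsets_at_top D. dist (sum ?g F) (infsum ?g D) < e\<^sup>2 / 16"
    using e has_sum_infsum[OF g] unfolding has_sum_def by (intro tendstoD) auto
  then obtain F where F: "finite F" "F \<subseteq> D" "dist (sum ?g F) (infsum ?g D) < e\<^sup>2 / 16"
    unfolding eventually_finite_subsets_at_top by blast
  have tail: "sum ?g F' \<le> e\<^sup>2 / 16" if F': "finite F'" "F' \<subseteq> D" "F' \<inter> F = {}" for F'
  proof -
    have "sum ?g F' + sum ?g F = sum ?g (F' \<union> F)" using F F' by (intro sum.union_disjoint[symmetric]) auto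
    also have "\<dots> \<le> infsum ?g D" using F F' by (intro finite_sum_le_infsum[OF g]) auto
    finally show ?thesis using F(3) unfolding dist_real_def by linarith
  qed
  define r where "r = e\<^sup>2 / (4 * (real (card F) + 1))"
  have r: "r > 0" using e by (simp add: r_def)
  have "\<exists>U. openin T U \<and> s \<in> U \<and> (\<forall>t\<in>U. \<Delta> t = \<Delta> s \<longrightarrow>
      (hnorm H (\<pi> (cocycle t \<delta>) (v \<delta>) - \<pi> (cocycle s \<delta>) (v \<delta>)))\<^sup>2 < r)" if \<delta>: "\<delta> \<in> F" for \<delta>
  proof -
    have \<delta>D: "\<delta> \<in> D" using \<delta> F by blast
    let ?k = "cocycle s \<delta>"
    have k: "?k \<in> carrier L" using s \<delta>D by simp
    have "\<forall>\<^sub>F k in atin T\<^sub>K ?k. dist (hnorm H (\<pi> k (v \<delta>) - \<pi> ?k (v \<delta>))) 0 < sqrt r"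
      using R.rep_continuous[OF v k] r by (intro tendstoD) auto
    then obtain V where V: "openin T\<^sub>K V" "?k \<in> V"
      "\<And>k. k \<in> V - {?k} \<Longrightarrow> dist (hnorm H (\<pi> k (v \<delta>) - \<pi> ?k (v \<delta>))) 0 < sqrt r"
      unfolding eventually_atin using k kernel_subset by (auto simp: topspace_eq)
    have V': "(hnorm H (\<pi> k (v \<delta>) - \<pi> ?k (v \<delta>)))\<^sup>2 < r" if "k \<in> V" for k
    proof (cases "k = ?k")
      case False
      then have "\<bar>hnorm H (\<pi> k (v \<delta>) - \<pi> ?k (v \<delta>))\<bar> < sqrt r" using V(3)[of k] that by simp
      then have "\<bar>hnorm H (\<pi> k (v \<delta>) - \<pi> ?k (v \<delta>))\<bar>\<^sup>2 < (sqrt r)\<^sup>2"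
        by (intro power_strict_mono) auto
      then show ?thesis using r by simp
    qed (simp add: r)
    let ?\<phi> = "\<lambda>t. inv (\<sigma> \<delta>) \<otimes> t \<otimes> \<sigma> (inverse (\<Delta> s) * \<delta>)"
    have "continuous_map T T ?\<phi>"
      using continuous_map_compose[OF continuous_left_mult[of "inv (\<sigma> \<delta>)"]
          continuous_right_mult[of "\<sigma> (inverse (\<Delta> s) * \<delta>)"]] s \<delta>D by (simp add: o_def)
    moreover have "openin T V" using V(1) by (simp add: openin_kernel_iff)
    ultimately have "openin T {t \<in> topspace T. ?\<phi> t \<in> V}" by (rule openin_continuous_map_preimage)
    then show ?thesis
      using V' V(2) s by (intro exI[of _ "{t \<in> topspace T. ?\<phi> t \<in> V}"]) (auto simp: cocycle_def topspace_eq)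
  qed
  then obtain U where U: "\<And>\<delta>. \<delta> \<in> F \<Longrightarrow> openin T (U \<delta>)" "\<And>\<delta>. \<delta> \<in> F \<Longrightarrow> s \<in> U \<delta>"
    "\<And>\<delta> t. \<lbrakk>\<delta> \<in> F; t \<in> U \<delta>; \<Delta> t = \<Delta> s\<rbrakk>
      \<Longrightarrow> (hnorm H (\<pi> (cocycle t \<delta>) (v \<delta>) - \<pi> (cocycle s \<delta>) (v \<delta>)))\<^sup>2 < r"
    by metis
  define W where "W = (s <# K) \<inter> (\<Inter>\<delta>\<in>F. U \<delta>)"
  have sK: "openin T (s <# K)" "s \<in> s <# K"
    using openin_l_coset[OF s open_kernel] subgroup.one_closed[OF kernel_subgroup] s
    by (auto simp: l_coset_def intro!: bexI[of _ \<one>])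
  have "openin T W"
  proof (cases "F = {}")
    case False
    then have "openin T (\<Inter>\<delta>\<in>F. U \<delta>)" using F(1) U(1) by (intro openin_INT2) auto
    then show ?thesis using sK by (simp add: W_def openin_Int)
  qed (use sK in \<open>simp add: W_def\<close>)
  moreover have "s \<in> W" using sK U(2) by (simp add: W_def)
  moreover have "dist (hnorm E (Ind t f - Ind s f)) 0 < e" if t: "t \<in> W" for t
  proof -
    have "t \<in> s <# K" using t by (simp add: W_def)
    then have tG: "t \<in> carrier G" and \<Delta>t: "\<Delta> t = \<Delta> s"
      using s by (auto simp: l_coset_def kernel_iff modular_mult)
    let ?d = "Ind t f - Ind s f"
    have dE: "?d \<in> vecs E" using Ind_closed[OF tG f] Ind_closed[OF s f] by simp
    have d: "?d \<delta> = \<pi> (cocycle t \<delta>) (v \<delta>) - \<pi> (cocycle s \<delta>) (v \<delta>)" if "\<delta> \<in> D" for \<delta>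
      using that by (simp add: Ind_apply \<Delta>t v_def)
    have "(\<Sum>\<delta>\<in>F'. (hnorm H (?d \<delta>))\<^sup>2) \<le> e\<^sup>2 / 2" if F': "finite F'" "F' \<subseteq> D" for F'
    proof -
      have split: "(\<Sum>\<delta>\<in>F'. (hnorm H (?d \<delta>))\<^sup>2)
          = (\<Sum>\<delta>\<in>F' - F. (hnorm H (?d \<delta>))\<^sup>2) + (\<Sum>\<delta>\<in>F' \<inter> F. (hnorm H (?d \<delta>))\<^sup>2)"
        by (subst sum.Int_Diff[OF F'(1), of _ F]) (rule add.commute)
      have "(\<Sum>\<delta>\<in>F' - F. (hnorm H (?d \<delta>))\<^sup>2) \<le> (\<Sum>\<delta>\<in>F' - F. 4 * ?g \<delta>)"
      proof (rule sum_mono)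
        fix \<delta> assume "\<delta> \<in> F' - F"
        then have \<delta>: "\<delta> \<in> D" using F' by blast
        show "(hnorm H (?d \<delta>))\<^sup>2 \<le> 4 * ?g \<delta>"
          using R.hs.hnorm_diff_sq_le[of "\<pi> (cocycle t \<delta>) (v \<delta>)" "\<pi> (cocycle s \<delta>) (v \<delta>)"]
          by (simp add: d \<delta> pi_closed pi_hnorm tG s v del: minus_apply)
      qed
      also have "(\<Sum>\<delta>\<in>F' - F. 4 * ?g \<delta>) = 4 * sum ?g (F' - F)" by (simp add: sum_distrib_left)
      also have "\<dots> \<le> e\<^sup>2 / 4"
      proof -
        have "sum ?g (F' - F) \<le> e\<^sup>2 / 16" using F' by (intro tail) auto
        then show ?thesis by simp
      qed
      finally have outside: "(\<Sum>\<delta>\<in>F' - F. (hnorm H (?d \<delta>))\<^sup>2) \<le> e\<^sup>2 / 4" .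
      have "(\<Sum>\<delta>\<in>F' \<inter> F. (hnorm H (?d \<delta>))\<^sup>2) \<le> (\<Sum>\<delta>\<in>F. r)"
      proof (rule sum_mono2[THEN order_trans[rotated]])
        have "(hnorm H (?d \<delta>))\<^sup>2 \<le> r" if "\<delta> \<in> F" for \<delta>
        proof -
          have "\<delta> \<in> D" "t \<in> U \<delta>" using that F(2) t by (auto simp: W_def)
          then show ?thesis using U(3)[OF that _ \<Delta>t] d by simp
        qed
        then show "(\<Sum>\<delta>\<in>F' \<inter> F. (hnorm H (?d \<delta>))\<^sup>2) \<le> (\<Sum>\<delta>\<in>F' \<inter> F. r)" by (intro sum_mono) auto
      qed (use F r in auto)
      also have "(\<Sum>\<delta>\<in>F. r) \<le> e\<^sup>2 / 4"
      proof -
        have "real (card F) * r \<le> (real (card F) + 1) * r" using r by simp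
        also have "\<dots> = e\<^sup>2 / 4" by (simp add: r_def field_simps)
        finally show ?thesis by simp
      qed
      finally show ?thesis using split outside by linarith
    qed
    then have "(hnorm E ?d)\<^sup>2 \<le> e\<^sup>2 / 2"
      using R.hs.ell2_finite_sum_le(2)[of D ?d "e\<^sup>2 / 2"] E_apply[OF dE] R.hs.ell2_outside[OF dE]
      by blast
    also have "\<dots> < e\<^sup>2" using e by simp
    finally have "hnorm E ?d < e" using e by (simp add: power_less_imp_less_base)
    then show ?thesis using dE by simp
  qed
  ultimately show "\<forall>\<^sub>F t in atin T s. dist (hnorm E (Ind t f - Ind s f)) 0 < e"
    unfolding eventually_atin by blast
qed

lemma Ind_representation: "unitary_representation G T E Ind"
  unfolding unitary_representation_def
  using E.hilbert_space_axioms Ind_unitary Ind_mult Ind_continuous by blast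

sublocale I: haar_rep G T E Ind \<mu>
  by unfold_locales (rule Ind_representation)

end

section \<open>The center of the induced representation\<close>

context induction_from_kernel
begin

text \<open>The operator \<open>1 \<otimes> A\<close>.\<close>

definition lift :: "('v \<Rightarrow> 'v) \<Rightarrow> (real \<Rightarrow> 'v) \<Rightarrow> real \<Rightarrow> 'v" where
  "lift A f = (\<lambda>\<delta>. if \<delta> \<in> D then A (f \<delta>) else 0)"

lemma lift_commutant:
  assumes A: "A \<in> commutant H (\<pi> ` carrier L)"
  shows "lift A \<in> commutant E (Ind ` carrier G)"
proof -
  note Ab = R.hs.commutantD(1)[OF A]
  note A' = R.hs.bounded_opsD[OF Ab]
  obtain b where b: "b \<ge> 0" "\<And>v. v \<in> vecs H \<Longrightarrow> hnorm H (A v) \<le> b * hnorm H v"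
    using R.hs.bounded_ops_bound[OF Ab] by blast
  have bound: "lift A f \<in> vecs E \<and> (hnorm E (lift A f))\<^sup>2 \<le> (b * hnorm E f)\<^sup>2" if f: "f \<in> vecs E" for f
  proof -
    have "(\<Sum>\<delta>\<in>F. (hnorm H (lift A f \<delta>))\<^sup>2) \<le> (b * hnorm E f)\<^sup>2" if F: "finite F" "F \<subseteq> D" for F
    proof -
      have "(\<Sum>\<delta>\<in>F. (hnorm H (lift A f \<delta>))\<^sup>2) \<le> (\<Sum>\<delta>\<in>F. b\<^sup>2 * (hnorm H (f \<delta>))\<^sup>2)"
      proof (rule sum_mono)
        fix \<delta> assume "\<delta> \<in> F"
        then have "lift A f \<delta> = A (f \<delta>)" using F by (auto simp: lift_def)
        then have "(hnorm H (lift A f \<delta>))\<^sup>2 \<le> (b * hnorm H (f \<delta>))\<^sup>2"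
          using b(2)[OF E_apply[OF f]] A'(1)[OF E_apply[OF f]] by (simp add: power_mono)
        then show "(hnorm H (lift A f \<delta>))\<^sup>2 \<le> b\<^sup>2 * (hnorm H (f \<delta>))\<^sup>2"
          by (simp add: power_mult_distrib)
      qed
      also have "\<dots> = b\<^sup>2 * (\<Sum>\<delta>\<in>F. (hnorm H (f \<delta>))\<^sup>2)" by (simp add: sum_distrib_left)
      also have "\<dots> \<le> b\<^sup>2 * (hnorm E f)\<^sup>2"
        unfolding R.hs.hnorm_ell2_sq[OF f]
        by (intro mult_left_mono finite_sum_le_infsum R.hs.ell2_summable[OF f] F) auto
      finally show ?thesis by (simp add: power_mult_distrib)
    qed
    moreover have "lift A f \<delta> \<in> vecs H" for \<delta>
      using A'(1)[OF E_apply[OF f]] by (simp add: lift_def)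
    moreover have "lift A f \<delta> = 0" if "\<delta> \<notin> D" for \<delta>
      using that by (simp add: lift_def)
    ultimately show ?thesis
      using R.hs.ell2_finite_sum_le[of D "lift A f" "(b * hnorm E f)\<^sup>2"] by blast
  qed
  have "lift A \<in> bounded_ops E"
  proof (rule E.bounded_opsI[of _ b])
    fix f assume f: "f \<in> vecs E"
    show "lift A f \<in> vecs E" using bound[OF f] by blast
    show "hnorm E (lift A f) \<le> b * hnorm E f"
      using bound[OF f] b(1) f by (intro power2_le_imp_le[of "hnorm E (lift A f)"]) auto
    show "lift A (scl E a f) = scl E a (lift A f)" for a
      using A'(3)[OF E_apply[OF f]] by (simp add: fun_eq_iff lift_def R.hs.scl_ell2)
    show "lift A (f + g) = lift A f + lift A g" if "g \<in> vecs E" for g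
      using A'(2)[OF E_apply[OF f] E_apply[OF that]] by (simp add: fun_eq_iff lift_def)
  qed
  moreover have "lift A (Ind s f) = Ind s (lift A f)" if s: "s \<in> carrier G" and f: "f \<in> vecs E" for s f
  proof
    fix \<delta>
    show "lift A (Ind s f) \<delta> = Ind s (lift A f) \<delta>"
      using R.hs.commutantD(2)[OF A] E_apply[OF f] s by (simp add: lift_def Ind_apply)
  qed
  ultimately show ?thesis by (auto simp: commutant_def)
qed

lemma single_in_E: "\<lbrakk>\<epsilon> \<in> D; v \<in> vecs H\<rbrakk> \<Longrightarrow> single_vec \<epsilon> v \<in> vecs E"
  by (rule R.hs.single_vec_ell2)

lemma Ind_single:
  assumes k: "k \<in> K" and \<epsilon>: "\<epsilon> \<in> D"
  shows "Ind k (single_vec \<epsilon> v) = single_vec \<epsilon> (\<pi> (inv (\<sigma> \<epsilon>) \<otimes> k \<otimes> \<sigma> \<epsilon>) v)"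
proof
  fix \<delta>
  have 0: "\<pi> (cocycle k \<delta>) 0 = 0" if "\<delta> \<in> D"
    using R.hs.bounded_opsD(5)[OF pi_bounded[OF cocycle_kernel]] k that kernel_subset by blast
  show "Ind k (single_vec \<epsilon> v) \<delta> = single_vec \<epsilon> (\<pi> (inv (\<sigma> \<epsilon>) \<otimes> k \<otimes> \<sigma> \<epsilon>) v) \<delta>"
    using k \<epsilon> 0 by (auto simp: Ind_apply single_vec_def cocycle_def kernel_iff)
qed

definition entry :: "((real \<Rightarrow> 'v) \<Rightarrow> real \<Rightarrow> 'v) \<Rightarrow> real \<Rightarrow> real \<Rightarrow> 'v \<Rightarrow> 'v" where
  "entry A \<delta> \<epsilon> v = A (single_vec \<epsilon> v) \<delta>"

text \<open>The operator \<open>A\<close> commutes with \<open>1 \<otimes> C\<close> for each \<open>C \<in> \<pi>(K)'\<close>, so its entries commute with \<open>C\<close>.\<close>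

lemma entry_bicommutant:
  assumes A: "A \<in> commutant E (commutant E (Ind ` carrier G))" and \<epsilon>: "\<epsilon> \<in> D"
  shows "entry A \<delta> \<epsilon> \<in> commutant H (commutant H (\<pi> ` carrier L))"
proof -
  note Ab = E.commutantD(1)[OF A]
  note A' = E.bounded_opsD[OF Ab]
  note A_apply = E_apply[OF A'(1)[OF single_in_E[OF \<epsilon>]]]
  obtain b where b: "b \<ge> 0" "\<And>f. f \<in> vecs E \<Longrightarrow> hnorm E (A f) \<le> b * hnorm E f"
    using E.bounded_ops_bound[OF Ab] by blast
  have "entry A \<delta> \<epsilon> \<in> bounded_ops H"
  proof (rule R.hs.bounded_opsI[of _ b])
    fix v assume v: "v \<in> vecs H"
    show "entry A \<delta> \<epsilon> v \<in> vecs H" using A_apply[OF v] by (simp add: entry_def)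
    have "hnorm H (entry A \<delta> \<epsilon> v) \<le> hnorm E (A (single_vec \<epsilon> v))"
      unfolding entry_def by (rule R.hs.hnorm_le_ell2[OF A'(1)[OF single_in_E[OF \<epsilon> v]]])
    also have "\<dots> \<le> b * hnorm H v"
      using b(2)[OF single_in_E[OF \<epsilon> v]] by (simp add: R.hs.hnorm_single_vec[OF \<epsilon> v])
    finally show "hnorm H (entry A \<delta> \<epsilon> v) \<le> b * hnorm H v" .
    have "single_vec \<epsilon> (scl H a v) = scl E a (single_vec \<epsilon> v)" for a
      by (simp add: fun_eq_iff single_vec_def R.hs.scl_ell2)
    then show "entry A \<delta> \<epsilon> (scl H a v) = scl H a (entry A \<delta> \<epsilon> v)" for a
      using A'(3)[OF single_in_E[OF \<epsilon> v]] by (simp add: entry_def R.hs.scl_ell2)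
    have "single_vec \<epsilon> (v + w) = single_vec \<epsilon> v + single_vec \<epsilon> w" for w
      by (simp add: fun_eq_iff single_vec_def)
    then show "entry A \<delta> \<epsilon> (v + w) = entry A \<delta> \<epsilon> v + entry A \<delta> \<epsilon> w" if "w \<in> vecs H" for w
      using A'(2)[OF single_in_E[OF \<epsilon> v] single_in_E[OF \<epsilon> that]] by (simp add: entry_def)
  qed
  moreover have "entry A \<delta> \<epsilon> (C v) = C (entry A \<delta> \<epsilon> v)"
    if C: "C \<in> commutant H (\<pi> ` carrier L)" and v: "v \<in> vecs H" for C v
  proof -
    have C0: "C 0 = 0" using R.hs.bounded_opsD(5)[OF R.hs.commutantD(1)[OF C]] .
    have "lift C (single_vec \<epsilon> v) = single_vec \<epsilon> (C v)"
      using \<epsilon> C0 by (auto simp: fun_eq_iff lift_def single_vec_def)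
    then have eq: "A (single_vec \<epsilon> (C v)) = lift C (A (single_vec \<epsilon> v))"
      using E.commutantD(2)[OF A lift_commutant[OF C] single_in_E[OF \<epsilon> v]] by simp
    show ?thesis
      using C0 R.hs.ell2_outside[OF A'(1)[OF single_in_E[OF \<epsilon> v]], of \<delta>]
      by (simp add: entry_def eq lift_def)
  qed
  ultimately show ?thesis by (auto simp: commutant_def)
qed

lemma entry_intertwines:
  assumes A: "A \<in> commutant E (Ind ` carrier G)" and \<delta>: "\<delta> \<in> D" and \<epsilon>: "\<epsilon> \<in> D"
    and j: "j \<in> K" and v: "v \<in> vecs H"
  defines "g \<equiv> inv (\<sigma> \<delta>) \<otimes> \<sigma> \<epsilon>"
  shows "entry A \<delta> \<epsilon> (\<pi> j v) = \<pi> (g \<otimes> j \<otimes> inv g) (entry A \<delta> \<epsilon> v)"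
proof -
  \<comment> \<open>The element of \<open>K\<close> that acts as \<open>\<pi>(j)\<close> at \<open>\<epsilon>\<close> acts as \<open>\<pi>(gjg\<^sup>-\<^sup>1)\<close> at \<open>\<delta>\<close>.\<close>
  let ?k = "\<sigma> \<epsilon> \<otimes> j \<otimes> inv (\<sigma> \<epsilon>)"
  have jG: "j \<in> carrier G" using j by (simp add: kernel_iff)
  have k: "?k \<in> K" using kernel_conj[OF \<sigma>_closed[OF \<epsilon>] j] .
  then have kG: "?k \<in> carrier G" "\<Delta> ?k = 1" by (simp_all add: kernel_iff)
  have "inv (\<sigma> \<epsilon>) \<otimes> ?k \<otimes> \<sigma> \<epsilon> = (inv (\<sigma> \<epsilon>) \<otimes> \<sigma> \<epsilon>) \<otimes> j \<otimes> (inv (\<sigma> \<epsilon>) \<otimes> \<sigma> \<epsilon>)"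
    using jG \<epsilon> by (simp only: m_assoc m_closed inv_closed \<sigma>_closed)
  then have j': "inv (\<sigma> \<epsilon>) \<otimes> ?k \<otimes> \<sigma> \<epsilon> = j" using jG \<epsilon> by simp
  have cocycle: "cocycle ?k \<delta> = g \<otimes> j \<otimes> inv g"
    unfolding cocycle_def g_def kG(2) using jG \<epsilon> \<delta> by (simp add: inv_mult_group m_assoc)
  have "A (single_vec \<epsilon> (\<pi> j v)) = A (Ind ?k (single_vec \<epsilon> v))"
    by (simp only: Ind_single[OF k \<epsilon>] j')
  also have "\<dots> = Ind ?k (A (single_vec \<epsilon> v))"
    using E.commutantD(2)[OF A _ single_in_E[OF \<epsilon> v]] kG(1) by blast
  finally show ?thesis using \<delta> by (simp add: entry_def Ind_apply kG(2) cocycle)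
qed

lemma conj_automorphism:
  assumes g: "g \<in> carrier G"
  shows "(\<lambda>k. g \<otimes> k \<otimes> inv g) \<in> hom L L"
    and "bij_betw (\<lambda>k. g \<otimes> k \<otimes> inv g) (carrier L) (carrier L)"
proof -
  have cancel: "a \<otimes> (inv a \<otimes> x) = x" "inv a \<otimes> (a \<otimes> x) = x" if "a \<in> carrier G" "x \<in> carrier G" for a x
    using that by (simp_all add: m_assoc[symmetric])
  show "(\<lambda>k. g \<otimes> k \<otimes> inv g) \<in> hom L L"
    using g kernel_conj[OF g] kernel_subset by (auto simp: hom_def m_assoc cancel subset_eq)
  show "bij_betw (\<lambda>k. g \<otimes> k \<otimes> inv g) (carrier L) (carrier L)"
    by (rule bij_betw_byWitness[where f' = "\<lambda>k. inv g \<otimes> k \<otimes> g"])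
      (use g kernel_conj[OF g] kernel_conj[of "inv g"] kernel_subset in
        \<open>auto simp: m_assoc cancel subset_eq\<close>)
qed

text \<open>The entries of a central element off the diagonal intertwine \<open>\<pi>\<close> with its conjugate by an
  element of modulus \<open>\<epsilon> / \<delta> \<noteq> 1\<close>, so they vanish. Those on the diagonal are central in
  \<open>\<pi>(K)''\<close>, hence scalars, and the induced representation permutes the coordinates
  transitively.\<close>

lemma central_single_vec:
  assumes factor: "factor H (commutant H (commutant H (\<pi> ` carrier L)))"
    and square_integrable: "\<xi> \<in> vecs H" "\<eta> \<in> vecs H"
      "R.coeff_norm2 \<xi> \<eta> \<noteq> 0" "R.coeff_norm2 \<xi> \<eta> \<noteq> \<infinity>"
    and A: "A \<in> commutant E (Ind ` carrier G)"
    and A2: "A \<in> commutant E (commutant E (Ind ` carrier G))"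
  obtains a where "\<And>\<epsilon> v. \<lbrakk>\<epsilon> \<in> D; v \<in> vecs H\<rbrakk> \<Longrightarrow> A (single_vec \<epsilon> v) = single_vec \<epsilon> (scl H a v)"
proof -
  note A' = E.bounded_opsD[OF E.commutantD(1)[OF A]]
  obtain \<kappa> :: real where \<kappa>: "\<kappa> > 0"
    "\<And>f. f \<in> borel_measurable \<mu>\<^sub>K \<Longrightarrow> (\<integral>\<^sup>+k. f (inv\<^bsub>L\<^esub> k) \<partial>\<mu>\<^sub>K) = ennreal \<kappa> * (\<integral>\<^sup>+k. f k \<partial>\<mu>\<^sub>K)"
    using R.inversion_scaling kernel_unimodular by (metis carrier_kernel)
  have off_diagonal: "entry A \<delta> \<epsilon> v = 0"
    if \<delta>: "\<delta> \<in> D" and \<epsilon>: "\<epsilon> \<in> D" and v: "v \<in> vecs H" and ne: "\<delta> \<noteq> \<epsilon>" for \<delta> \<epsilon> v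
  proof (rule ccontr)
    assume nz: "entry A \<delta> \<epsilon> v \<noteq> 0"
    define g where "g = inv (\<sigma> \<delta>) \<otimes> \<sigma> \<epsilon>"
    have g: "g \<in> carrier G" using \<delta> \<epsilon> by (simp add: g_def)
    have "\<Delta> g = 1"
    proof (rule R.intertwiner_preserves_haar[OF factor conj_automorphism[OF g]])
      show "entry A \<delta> \<epsilon> \<in> commutant H (commutant H (\<pi> ` carrier L))"
        by (rule entry_bicommutant[OF A2 \<epsilon>])
      show "(\<integral>\<^sup>+k. f (g \<otimes> k \<otimes> inv g) \<partial>\<mu>\<^sub>K) = ennreal (\<Delta> g) * (\<integral>\<^sup>+k. f k \<partial>\<mu>\<^sub>K)"
        if "f \<in> borel_measurable \<mu>\<^sub>K" for f using kernel_conj_scaling[OF g that] .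
      show "entry A \<delta> \<epsilon> (\<pi> k w) = \<pi> (g \<otimes> k \<otimes> inv g) (entry A \<delta> \<epsilon> w)"
        if "k \<in> carrier L" "w \<in> vecs H" for k w
        using entry_intertwines[OF A \<delta> \<epsilon>] that by (simp add: g_def)
      show "ennreal \<kappa> \<noteq> 0" using \<kappa>(1) by simp
    qed (use \<kappa>(2) v nz square_integrable in auto)
    moreover have "\<Delta> g = inverse \<delta> * \<epsilon>" using \<delta> \<epsilon> by (simp add: g_def modular_mult modular_inv)
    ultimately show False using ne range_pos[OF \<delta>] by (simp add: field_simps)
  qed
  have "entry A 1 1 \<in> scalar_ops H"
  proof -
    have "entry A 1 1 (\<pi> j v) = \<pi> j (entry A 1 1 v)" if "j \<in> K" "v \<in> vecs H" for j v
      using entry_intertwines[OF A range_one range_one that] that by (simp add: \<sigma>_one kernel_iff)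
    then have "entry A 1 1 \<in> commutant H (\<pi> ` carrier L)"
      using R.hs.commutantD(1)[OF entry_bicommutant[OF A2 range_one]] by (auto simp: commutant_def)
    then show ?thesis
      using factor entry_bicommutant[OF A2 range_one, of 1] R.hs.tricommutant[OF R.rep_bounded]
      unfolding factor_def by blast
  qed
  then obtain a where a: "\<And>v. v \<in> vecs H \<Longrightarrow> entry A 1 1 v = scl H a v" by (auto simp: scalar_ops_def)
  have diagonal: "entry A \<epsilon> \<epsilon> v = scl H a v" if \<epsilon>: "\<epsilon> \<in> D" and v: "v \<in> vecs H" for \<epsilon> v
  proof -
    have e0: "\<epsilon> \<noteq> 0" using range_pos[OF \<epsilon>] by simp
    have co: "cocycle (\<sigma> \<epsilon>) \<epsilon> = \<one>" using \<epsilon> e0 by (simp add: cocycle_def \<sigma>_one)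
    have Ind_at: "Ind (\<sigma> \<epsilon>) f \<epsilon> = f 1" if f: "f \<in> vecs E" for f
      using R.rep_one[of "f 1"] E_apply[OF f] \<epsilon> e0 by (simp add: Ind_apply co)
    have "Ind (\<sigma> \<epsilon>) (single_vec 1 v) \<delta> = single_vec \<epsilon> v \<delta>" for \<delta>
    proof (cases "\<delta> = \<epsilon>")
      case True
      then show ?thesis using Ind_at[OF single_in_E[OF range_one v]] by simp
    next
      case False
      then have "inverse \<epsilon> * \<delta> \<noteq> 1" using e0 by (simp add: field_simps)
      then show ?thesis
        using False \<epsilon> R.hs.bounded_opsD(5)[OF pi_bounded[OF cocycle_kernel[of "\<sigma> \<epsilon>" \<delta>]]]
        by (auto simp: Ind_apply single_vec_def)
    qed
    then have eq: "single_vec \<epsilon> v = Ind (\<sigma> \<epsilon>) (single_vec 1 v)" by (simp add: fun_eq_iff)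
    have "A (single_vec \<epsilon> v) = Ind (\<sigma> \<epsilon>) (A (single_vec 1 v))"
      unfolding eq using E.commutantD(2)[OF A _ single_in_E[OF range_one v]] \<epsilon> by simp
    then have "entry A \<epsilon> \<epsilon> v = entry A 1 1 v"
      using Ind_at[OF A'(1)[OF single_in_E[OF range_one v]]] by (simp add: entry_def)
    then show ?thesis using a[OF v] by simp
  qed
  have "A (single_vec \<epsilon> v) = single_vec \<epsilon> (scl H a v)" if \<epsilon>: "\<epsilon> \<in> D" and v: "v \<in> vecs H" for \<epsilon> v
  proof
    fix \<delta>
    show "A (single_vec \<epsilon> v) \<delta> = single_vec \<epsilon> (scl H a v) \<delta>"
      using diagonal[OF \<epsilon> v] off_diagonal[OF _ \<epsilon> v, of \<delta>]
        R.hs.ell2_outside[OF A'(1)[OF single_in_E[OF \<epsilon> v]], of \<delta>] \<epsilon>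
      by (cases "\<delta> \<in> D") (auto simp: entry_def single_vec_def)
  qed
  then show ?thesis using that by blast
qed

text \<open>The vectors supported at one coordinate are known to be eigenvectors of each central element. To
  pass to all vectors, this is applied to the adjoint \<open>B\<close> of a central \<open>A\<close>: pairing \<open>Af\<close> with such
  vectors computes each coordinate of \<open>Af\<close>.\<close>

theorem Ind_factorial:
  assumes factor: "factor H (commutant H (commutant H (\<pi> ` carrier L)))"
    and square_integrable: "\<xi> \<in> vecs H" "\<eta> \<in> vecs H"
      "R.coeff_norm2 \<xi> \<eta> \<noteq> 0" "R.coeff_norm2 \<xi> \<eta> \<noteq> \<infinity>"
  shows "factorial_representation G T E Ind"
  unfolding factorial_representation_def
proof (intro conjI Ind_representation E.factor_bicommutantI I.rep_bounded I.rep_adjoint_closed)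
  let ?S = "Ind ` carrier G"
  fix A assume A: "A \<in> commutant E ?S" and A2: "A \<in> commutant E (commutant E ?S)"
  obtain B where B: "B \<in> commutant E ?S" "\<And>x y. \<lbrakk>x \<in> vecs E; y \<in> vecs E\<rbrakk> \<Longrightarrow> ip E (A x) y = ip E x (B y)"
    using E.commutant_adjoint[OF I.rep_bounded I.rep_adjoint_closed A] by blast
  obtain B' where B': "B' \<in> commutant E (commutant E ?S)"
    "\<And>x y. \<lbrakk>x \<in> vecs E; y \<in> vecs E\<rbrakk> \<Longrightarrow> ip E (A x) y = ip E x (B' y)"
    using E.commutant_adjoint[OF E.commutant_subset
        E.commutant_adjoint[OF I.rep_bounded I.rep_adjoint_closed] A2] by blast
  note Bb = E.bounded_opsD[OF E.commutantD(1)[OF B(1)]]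
  note Bb' = E.bounded_opsD[OF E.commutantD(1)[OF B'(1)]]
  note Ab = E.bounded_opsD[OF E.commutantD(1)[OF A]]
  \<comment> \<open>The adjoints found in the commutant and in the bicommutant agree on \<open>E\<close>.\<close>
  have eq: "B y = B' y" if "y \<in> vecs E" for y
    using that by (intro E.eq_by_ip Bb Bb') (simp_all add: B(2)[symmetric] B'(2)[symmetric])
  have "B (C x) = C (B x)" if C: "C \<in> commutant E ?S" and x: "x \<in> vecs E" for C x
    using E.commutantD(2)[OF B'(1) C x] eq[OF x] eq[OF E.bounded_opsD(1)[OF E.commutantD(1)[OF C] x]]
    by simp
  then have B2: "B \<in> commutant E (commutant E ?S)"
    using E.commutantD(1)[OF B(1)] by (auto simp: commutant_def[of E "commutant E ?S"])
  obtain b where b: "\<And>\<epsilon> v. \<lbrakk>\<epsilon> \<in> D; v \<in> vecs H\<rbrakk> \<Longrightarrow> B (single_vec \<epsilon> v) = single_vec \<epsilon> (scl H b v)"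
    using central_single_vec[OF factor square_integrable B(1) B2] by blast
  have "A f = scl E (cnj b) f" if f: "f \<in> vecs E" for f
  proof
    fix \<delta>
    note Af = Ab(1)[OF f]
    show "A f \<delta> = scl E (cnj b) f \<delta>"
    proof (cases "\<delta> \<in> D")
      case \<delta>: True
      have "A f \<delta> = scl H (cnj b) (f \<delta>)"
      proof (rule R.hs.eq_by_ip_left)
        fix v assume v: "v \<in> vecs H"
        have "ip H (A f \<delta>) v = ip E (A f) (single_vec \<delta> v)"
          by (rule R.hs.ip_single_vec(2)[OF \<delta> v Af, symmetric])
        also have "\<dots> = ip E f (single_vec \<delta> (scl H b v))"
          using B(2)[OF f single_in_E[OF \<delta> v]] b[OF \<delta> v] by simp
        also have "\<dots> = ip H (f \<delta>) (scl H b v)"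
          using R.hs.ip_single_vec(2)[OF \<delta> _ f] v by simp
        also have "\<dots> = ip H (scl H (cnj b) (f \<delta>)) v"
          using E_apply[OF f] v by (simp add: R.hs.ip_scl R.hs.ip_scl_right)
        finally show "ip H (A f \<delta>) v = ip H (scl H (cnj b) (f \<delta>)) v" .
      qed (use E_apply[OF Af] E_apply[OF f] in auto)
      then show ?thesis by (simp add: R.hs.scl_ell2)
    next
      case False
      then show ?thesis using R.hs.ell2_outside[OF Af] R.hs.ell2_outside[OF f] by (simp add: R.hs.scl_ell2)
    qed
  qed
  then show "A \<in> scalar_ops E" by (auto simp: scalar_ops_def)
qed

text \<open>The shift by \<open>\<Delta>(s)\<close> moves a vector supported at \<open>1\<close> to the coordinate \<open>\<Delta>(s)\<close>, so the coefficient of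
  two such vectors vanishes off \<open>K\<close>; on \<open>K\<close> it is the coefficient of \<open>\<pi>\<close>, as \<open>\<sigma>(1)\<close> is the
  identity.\<close>

theorem Ind_square_integrable:
  assumes \<xi>: "\<xi> \<in> vecs H" and \<eta>: "\<eta> \<in> vecs H"
    and "R.coeff_norm2 \<xi> \<eta> \<noteq> 0" "R.coeff_norm2 \<xi> \<eta> \<noteq> \<infinity>"
  shows "square_integrable_representation G T E Ind"
proof -
  let ?\<xi> = "single_vec (1::real) \<xi>" and ?\<eta> = "single_vec (1::real) \<eta>"
  have \<xi>E: "?\<xi> \<in> vecs E" and \<eta>E: "?\<eta> \<in> vecs E" using single_in_E[OF range_one] \<xi> \<eta> by auto
  have coeff: "coefficient E Ind ?\<xi> ?\<eta> s = (if s \<in> K then coefficient H \<pi> \<xi> \<eta> s else 0)"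
    if s: "s \<in> carrier G" for s
  proof -
    have "coefficient E Ind ?\<xi> ?\<eta> s = ip H (Ind s ?\<xi> 1) \<eta>"
      unfolding coefficient_def by (rule R.hs.ip_single_vec(2)[OF range_one \<eta> Ind_closed[OF s \<xi>E]])
    also have "Ind s ?\<xi> 1 = (if s \<in> K then \<pi> s \<xi> else 0)"
    proof (cases "\<Delta> s = 1")
      case True
      then show ?thesis using s by (simp add: Ind_apply cocycle_def \<sigma>_one kernel_iff)
    next
      case False
      then have "inverse (\<Delta> s) \<noteq> 1" by simp
      then show ?thesis
        using False s R.hs.bounded_opsD(5)[OF pi_bounded[OF cocycle_kernel[OF s range_one]]]
        by (simp add: Ind_apply single_vec_def kernel_iff)
    qed
    finally show ?thesis using \<eta> by (simp add: coefficient_def)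
  qed
  have "I.coeff_norm2 ?\<xi> ?\<eta> = (\<integral>\<^sup>+s. ennreal ((cmod (coefficient H \<pi> \<xi> \<eta> s))\<^sup>2) * indicator K s \<partial>\<mu>)"
    unfolding I.coeff_norm2_def
    by (intro nn_integral_cong) (simp add: coeff indicator_def)
  also have "\<dots> = R.coeff_norm2 \<xi> \<eta>"
    unfolding R.coeff_norm2_def
    using openin_sets_haar[OF open_kernel] kernel_subset
    by (intro nn_integral_restrict_space[symmetric]) (simp add: Int_absorb2)
  finally have "I.coeff_norm2 ?\<xi> ?\<eta> = R.coeff_norm2 \<xi> \<eta>" .
  then show ?thesis
    using I.square_integrableI[OF left_haar \<xi>E \<eta>E] assms by simp
qed

end

section \<open>Induction of square integrable factorial representations\<close>

theorem theoremB:
  fixes G :: "('g, 'm) monoid_scheme"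
    and T :: "'g topology"
    and H\<^sub>1 :: "'v::ab_group_add hilbert"
    and \<pi>\<^sub>1 :: "'g \<Rightarrow> 'v \<Rightarrow> 'v"
    and \<sigma> :: "real \<Rightarrow> 'g"
  defines "K \<equiv> modular_kernel G T"
  assumes "second_countable T"
    and "almost_unimodular G T"
    and "normalized_section G T \<sigma>"
    and "factorial_representation (G\<lparr>carrier := K\<rparr>) (subtopology T K) H\<^sub>1 \<pi>\<^sub>1"
    and "square_integrable_representation (G\<lparr>carrier := K\<rparr>) (subtopology T K) H\<^sub>1 \<pi>\<^sub>1"
  shows "factorial_representation G T (induced_space G T H\<^sub>1) (induced_representation G T \<sigma> \<pi>\<^sub>1)
    \<and> square_integrable_representation G T (induced_space G T H\<^sub>1) (induced_representation G T \<sigma> \<pi>\<^sub>1)"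
proof -
  interpret locally_compact_group G T
    using assms(3) by (simp add: almost_unimodular_def)
  interpret second_countable_group G T
    by unfold_locales (rule assms(2))
  obtain \<mu> where "left_haar_measure G T \<mu>"
    using left_haar_measure_exists[OF topological_group_axioms] assms(6)
    unfolding K_def square_integrable_representation_def by blast
  then interpret induction_from_kernel G T \<mu> H\<^sub>1 \<pi>\<^sub>1 \<sigma>
    using assms(3,4,5) unfolding K_def
    by unfold_locales (simp_all add: almost_unimodular_def factorial_representation_def)
  have factor: "factor H\<^sub>1 (commutant H\<^sub>1 (commutant H\<^sub>1 (\<pi>\<^sub>1 ` carrier L)))"
    using assms(5) unfolding K_def factorial_representation_def by blast
  obtain \<xi> \<eta> where \<xi>\<eta>: "\<xi> \<in> vecs H\<^sub>1" "\<eta> \<in> vecs H\<^sub>1"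
    "R.coeff_norm2 \<xi> \<eta> \<noteq> 0" "R.coeff_norm2 \<xi> \<eta> \<noteq> \<infinity>"
    using R.square_integrableD assms(6) unfolding K_def by blast
  show ?thesis
    unfolding induced_space_def using Ind_factorial[OF factor \<xi>\<eta>] Ind_square_integrable[OF \<xi>\<eta>] by blast
qed

end
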